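(* Let $(M,\Lambda)$ be an oriented $m$-dimensional regular Nambu-Poisson manifold of order $n$, with $n\geq 3$. Then the modular class of $(M,\Lambda)$ is null if and only if there exists a basic volume with respect to the characteristic foliation $\mathcal{D}$, that is, there exists $\mu\in\Omega^{m-n}(M)$ such that $\mu\neq 0$ at every point of $M$ and $$i(X_{f_1\dots f_{n-1}})\mu=0,\qquad \mathcal{L}_{X_{f_1\dots f_{n-1}}}\mu=0,$$ for all $f_1,\dots,f_{n-1}\in C^\infty(M,\mathbb{R})$.
   Context: All manifolds are smooth and connected. $\Omega^k(M)$ denotes the space of $k$-forms and $\mathcal{V}^k(M)$ the space of $k$-vector fields on $M$. A Nambu-Poisson manifold of order $n$ (with $n\le m=\dim M$) is a pair $(M,\Lambda)$ where $\Lambda\in\mathcal{V}^n(M)$ is such that the bracket $\{f_1,\dots,f_n\}=\Lambda(df_1,\dots,df_n)$ satisfies the fundamental identity $\{f_1,\dots,f_{n-1},\{g_1,\dots,g_n\}\}=\sum_{i=1}^n\{g_1,\dots,\{f_1,\dots,f_{n-1},g_i\},\dots,g_n\}$ for all smooth functions. It is regular if $\Lambda(x)\ne0$ for every $x\in M$; it is oriented if $M$ is an oriented manifold. For $k\le n$, $\#_k:\Omega^k(M)\to\mathcal{V}^{n-k}(M)$ is $\#_k(\beta)=i(\beta)\Lambda$, with contraction in the first slots: $i(\alpha_1\wedge\dots\wedge\alpha_k)P=P(\alpha_1,\dots,\alpha_k,\cdot,\dots)$. The Hamiltonian vector field of $f_1,\dots,f_{n-1}$ is $X_{f_1\dots f_{n-1}}=\#_{n-1}(df_1\wedge\dots\wedge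 df_{n-1})$. The characteristic foliation $\mathcal{D}$ is the distribution $\mathcal{D}(x)$ spanned by the values at $x$ of the Hamiltonian vector fields; in the regular case it is a foliation of dimension $n$. Modular class. Let $\nu$ be a volume form on $M$, and let $\mathrm{div}_\nu X$ be defined by $\mathcal{L}_X\nu=(\mathrm{div}_\nu X)\nu$. There is a unique $(n-1)$-vector field $\mathcal{M}^\nu_\Lambda$ with $\mathcal{M}^\nu_\Lambda(df_1,\dots,df_{n-1})=\mathrm{div}_\nu(X_{f_1\dots f_{n-1}})$ for all $f_i$. The map $\Omega^{n-1}(M)\to C^\infty(M,\mathbb{R})$, $\alpha\mapsto i(\alpha)\mathcal{M}^\nu_\Lambda$, is a 1-cocycle of the Leibniz algebroid cohomology complex of $(\Lambda^{n-1}(T^*M),[\![\;,\;]\!],\#_{n-1})$, where $[\![\alpha,\beta]\!]=\mathcal{L}_{\#_{n-1}(\alpha)}\beta+(-1)^n\#_n(d\alpha)\beta$; in this complex the 0-cochains are the functions $f\in C^\infty(M,\mathbb{R})$, with coboundary $\partial f(\alpha)=\#_{n-1}(\alpha)(f)$. Its cohomology class $\mathcal{M}_\Lambda$, the modular class of $(M,\Lambda)$, does not depend on $\nu$. Concretely, the modular class is null if and only if there is $f\in C^\infty(M,\mathbb{R})$ with $i(\alpha)\mathcal{M}^\nu_\Lambda=\#_{n-1}(\alpha)(f)$ for all $\alpha\in\Omega^{n-1}(M)$. *)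

theory Defs
  imports "HOL-Analysis.Analysis" "HOL-Combinatorics.Permutations"
begin

section \<open>Smooth manifolds\<close>

text \<open>
  \<open>Ck_on k f S\<close> is meant for open \<open>S\<close>: all iterated directional derivatives up to order \<open>k\<close>
  exist (as Frechet derivatives) and are continuous.
\<close>

fun Ck_on :: "nat \<Rightarrow> ('a::real_normed_vector \<Rightarrow> 'b::real_normed_vector) \<Rightarrow> 'a set \<Rightarrow> bool" where
  "Ck_on 0 f S \<longleftrightarrow> continuous_on S f"
| "Ck_on (Suc k) f S \<longleftrightarrow>
     (\<forall>x\<in>S. f differentiable (at x)) \<and>
     (\<forall>v. Ck_on k (\<lambda>x. frechet_derivative f (at x) v) S)"

definition smooth_on :: "('a::real_normed_vector \<Rightarrow> 'b::real_normed_vector) \<Rightarrow> 'a set \<Rightarrow> bool" where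
  "smooth_on f S \<longleftrightarrow> (\<forall>k. Ck_on k f S)"

text \<open>
  The manifold is the whole (Hausdorff, second countable) type \<open>'a\<close>, with charts in
  \<open>real^'m\<close>; its dimension is \<open>CARD('m)\<close>.  An atlas is not required to be maximal: all notions
  below depend only on the smooth structure it generates.
\<close>

type_synonym ('a, 'm) chart = "'a set \<times> ('a \<Rightarrow> real^'m)"

definition is_chart :: "('a::topological_space, 'm::finite) chart \<Rightarrow> bool" where
  "is_chart c \<longleftrightarrow> (case c of (U, \<phi>) \<Rightarrow>
     open U \<and> open (\<phi> ` U) \<and> homeomorphism U (\<phi> ` U) \<phi> (inv_into U \<phi>))"

definition smooth_atlas :: "('a::topological_space, 'm::finite) chart set \<Rightarrow> bool" where
  "smooth_atlas A \<longleftrightarrow>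
     (\<forall>c\<in>A. is_chart c) \<and> (\<Union>c\<in>A. fst c) = UNIV \<and>
     (\<forall>(U, \<phi>)\<in>A. \<forall>(V, \<psi>)\<in>A. smooth_on (\<psi> \<circ> inv_into U \<phi>) (\<phi> ` (U \<inter> V)))"

text \<open>An oriented manifold is given by an atlas whose transition maps have positive Jacobian.\<close>

definition oriented_atlas :: "('a::topological_space, 'm::finite) chart set \<Rightarrow> bool" where
  "oriented_atlas A \<longleftrightarrow>
     smooth_atlas A \<and>
     (\<forall>(U, \<phi>)\<in>A. \<forall>(V, \<psi>)\<in>A. \<forall>x\<in>\<phi> ` (U \<inter> V).
        det (matrix (frechet_derivative (\<psi> \<circ> inv_into U \<phi>) (at x))) > 0)"

definition smooth_functions :: "('a::topological_space, 'm::finite) chart set \<Rightarrow> ('a \<Rightarrow> real) set" where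
  "smooth_functions A = {f. \<forall>(U, \<phi>)\<in>A. smooth_on (f \<circ> inv_into U \<phi>) (\<phi> ` U)}"


section \<open>Multilinear algebra on spaces of real-valued functions\<close>

text \<open>
  Tangent and cotangent spaces are linear subspaces \<open>V\<close> of some type \<open>'x \<Rightarrow> real\<close>, with the pointwise
  operations.  Functions on such a subspace (or on lists of its elements) are extended by \<open>0\<close>
  outside their domain, so that equality of such functions is equality on the domain.
\<close>

definition linear_dual :: "('x \<Rightarrow> real) set \<Rightarrow> (('x \<Rightarrow> real) \<Rightarrow> real) set" where
  "linear_dual V = {\<alpha>.
     (\<forall>u\<in>V. \<forall>v\<in>V. \<forall>a b. \<alpha> (\<lambda>t. a * u t + b * v t) = a * \<alpha> u + b * \<alpha> v) \<and>
     (\<forall>u. u \<notin> V \<longrightarrow> \<alpha> u = 0)}"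

definition alternating_maps :: "('x \<Rightarrow> real) set \<Rightarrow> nat \<Rightarrow> (('x \<Rightarrow> real) list \<Rightarrow> real) set" where
  "alternating_maps V k = {P.
     (\<forall>vs. \<not> (length vs = k \<and> set vs \<subseteq> V) \<longrightarrow> P vs = 0) \<and>
     (\<forall>vs i. \<forall>u\<in>V. \<forall>v\<in>V. \<forall>a b. length vs = k \<and> set vs \<subseteq> V \<and> i < k \<longrightarrow>
        P (vs[i := (\<lambda>t. a * u t + b * v t)]) = a * P (vs[i := u]) + b * P (vs[i := v])) \<and>
     (\<forall>vs i j. length vs = k \<and> set vs \<subseteq> V \<and> i < j \<and> j < k \<and> vs ! i = vs ! j \<longrightarrow> P vs = 0)}"

text \<open>The wedge product of covectors is normalised by \<open>(\<alpha>\<^sub>1 \<and> \<dots> \<and> \<alpha>\<^sub>k)(v\<^sub>1, \<dots>, v\<^sub>k) = det (\<alpha>\<^sub>i(v\<^sub>j))\<close>.\<close>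

definition wedge ::
  "('x \<Rightarrow> real) set \<Rightarrow> (('x \<Rightarrow> real) \<Rightarrow> real) list \<Rightarrow> ('x \<Rightarrow> real) list \<Rightarrow> real" where
  "wedge V \<alpha>s vs =
     (if length vs = length \<alpha>s \<and> set vs \<subseteq> V
      then \<Sum>\<pi> | \<pi> permutes {..<length \<alpha>s}.
             of_int (sign \<pi>) * (\<Prod>i<length \<alpha>s. (\<alpha>s ! i) (vs ! \<pi> i))
      else 0)"

text \<open>
  \<open>contraction V k \<beta> P\<close> is \<open>i(\<beta>)P\<close>, for \<open>\<beta>\<close> an alternating \<open>k\<close>-linear map on \<open>V\<close> and \<open>P\<close> an
  alternating map on the dual of \<open>V\<close>: the linear extension in \<open>\<beta>\<close> of
  \<open>i(\<alpha>\<^sub>1 \<and> \<dots> \<and> \<alpha>\<^sub>k)P = P(\<alpha>\<^sub>1, \<dots>, \<alpha>\<^sub>k, \<cdot>, \<dots>)\<close>.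
  The list \<open>L\<close> writes \<open>\<beta>\<close> as a linear combination of decomposable elements.
\<close>

definition contraction ::
  "('x \<Rightarrow> real) set \<Rightarrow> nat \<Rightarrow> (('x \<Rightarrow> real) list \<Rightarrow> real) \<Rightarrow>
   ((('x \<Rightarrow> real) \<Rightarrow> real) list \<Rightarrow> real) \<Rightarrow> (('x \<Rightarrow> real) \<Rightarrow> real) list \<Rightarrow> real" where
  "contraction V k \<beta> P \<gamma>s =
     (THE r. \<exists>L :: (real \<times> (('x \<Rightarrow> real) \<Rightarrow> real) list) list.
        (\<forall>(c, \<alpha>s)\<in>set L. length \<alpha>s = k \<and> set \<alpha>s \<subseteq> linear_dual V) \<and>
        (\<forall>vs. \<beta> vs = (\<Sum>(c, \<alpha>s)\<leftarrow>L. c * wedge V \<alpha>s vs)) \<and>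
        r = (\<Sum>(c, \<alpha>s)\<leftarrow>L. c * P (\<alpha>s @ \<gamma>s)))"


section \<open>Vector fields, forms and multivector fields\<close>

type_synonym 'a tvec = "('a \<Rightarrow> real) \<Rightarrow> real"
type_synonym 'a covec = "'a tvec \<Rightarrow> real"
type_synonym 'a vfield = "'a \<Rightarrow> 'a tvec"
type_synonym 'a form = "'a \<Rightarrow> 'a tvec list \<Rightarrow> real"
type_synonym 'a mvfield = "'a \<Rightarrow> 'a covec list \<Rightarrow> real"

text \<open>Tangent vectors at \<open>p\<close> are the derivations at \<open>p\<close> of the algebra of smooth functions.\<close>

definition tangent_space :: "('a::topological_space, 'm::finite) chart set \<Rightarrow> 'a \<Rightarrow> 'a tvec set" where
  "tangent_space A p = {v \<in> linear_dual (smooth_functions A).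
     \<forall>f\<in>smooth_functions A. \<forall>g\<in>smooth_functions A. v (\<lambda>q. f q * g q) = f p * v g + g p * v f}"

abbreviation cotangent_space :: "('a::topological_space, 'm::finite) chart set \<Rightarrow> 'a \<Rightarrow> 'a covec set" where
  "cotangent_space A p \<equiv> linear_dual (tangent_space A p)"

definition differential ::
  "('a::topological_space, 'm::finite) chart set \<Rightarrow> ('a \<Rightarrow> real) \<Rightarrow> 'a \<Rightarrow> 'a covec" where
  "differential A f p = (\<lambda>v. if v \<in> tangent_space A p then v f else 0)"

definition vector_fields :: "('a::topological_space, 'm::finite) chart set \<Rightarrow> 'a vfield set" where
  "vector_fields A = {X. (\<forall>p. X p \<in> tangent_space A p) \<and>
     (\<forall>f\<in>smooth_functions A. (\<lambda>p. X p f) \<in> smooth_functions A)}"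

definition one_forms :: "('a::topological_space, 'm::finite) chart set \<Rightarrow> ('a \<Rightarrow> 'a covec) set" where
  "one_forms A = {\<alpha>. (\<forall>p. \<alpha> p \<in> cotangent_space A p) \<and>
     (\<forall>X\<in>vector_fields A. (\<lambda>p. \<alpha> p (X p)) \<in> smooth_functions A)}"

definition forms :: "('a::topological_space, 'm::finite) chart set \<Rightarrow> nat \<Rightarrow> 'a form set" where
  "forms A k = {\<omega>. (\<forall>p. \<omega> p \<in> alternating_maps (tangent_space A p) k) \<and>
     (\<forall>Xs. length Xs = k \<and> set Xs \<subseteq> vector_fields A \<longrightarrow>
        (\<lambda>p. \<omega> p (map (\<lambda>X. X p) Xs)) \<in> smooth_functions A)}"

text \<open>\<open>k\<close>-vectors at \<open>p\<close> are identified with alternating \<open>k\<close>-linear maps on the cotangent space.\<close>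

definition multivector_fields ::
  "('a::topological_space, 'm::finite) chart set \<Rightarrow> nat \<Rightarrow> 'a mvfield set" where
  "multivector_fields A k = {P. (\<forall>p. P p \<in> alternating_maps (cotangent_space A p) k) \<and>
     (\<forall>\<alpha>s. length \<alpha>s = k \<and> set \<alpha>s \<subseteq> one_forms A \<longrightarrow>
        (\<lambda>p. P p (map (\<lambda>\<alpha>. \<alpha> p) \<alpha>s)) \<in> smooth_functions A)}"

definition nowhere_zero :: "('a \<Rightarrow> 'b \<Rightarrow> real) \<Rightarrow> bool" where
  "nowhere_zero \<omega> \<longleftrightarrow> (\<forall>p. \<omega> p \<noteq> (\<lambda>_. 0))"

definition volume_forms :: "('a::topological_space, 'm::finite) chart set \<Rightarrow> 'a form set" where
  "volume_forms A = {\<nu> \<in> forms A (CARD('m)). nowhere_zero \<nu>}"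

text \<open>The vector field corresponding to a \<open>1\<close>-vector field, i.e. to an element of the double dual.\<close>

definition vfield_of ::
  "('a::topological_space, 'm::finite) chart set \<Rightarrow> 'a mvfield \<Rightarrow> 'a vfield" where
  "vfield_of A Q = (\<lambda>p f. if f \<in> smooth_functions A then Q p [differential A f p] else 0)"

definition lie_bracket :: "'a vfield \<Rightarrow> 'a vfield \<Rightarrow> 'a vfield" where
  "lie_bracket X Y = (\<lambda>p f. X p (\<lambda>q. Y q f) - Y p (\<lambda>q. X q f))"

definition interior_product :: "'a vfield \<Rightarrow> 'a form \<Rightarrow> 'a form" where
  "interior_product X \<omega> = (\<lambda>p vs. \<omega> p (X p # vs))"

text \<open>
  The value \<open>(\<L>\<^sub>X \<omega>)(Y\<^sub>1, \<dots>, Y\<^sub>k)\<close> of the Lie derivative of a \<open>k\<close>-form on vector fields \<open>Ys\<close>, namely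
  \<open>X(\<omega>(Y\<^sub>1, \<dots>, Y\<^sub>k)) - (\<Sum>i. \<omega>(Y\<^sub>1, \<dots>, [X, Y\<^sub>i], \<dots>, Y\<^sub>k))\<close>.  It is tensorial in \<open>Ys\<close>, so two forms
  agree iff they agree on all tuples of vector fields.
\<close>

definition lie_derivative :: "'a vfield \<Rightarrow> 'a form \<Rightarrow> 'a vfield list \<Rightarrow> 'a \<Rightarrow> real" where
  "lie_derivative X \<omega> Ys = (\<lambda>p.
     X p (\<lambda>q. \<omega> q (map (\<lambda>Y. Y q) Ys)) -
     (\<Sum>i<length Ys. \<omega> p (map (\<lambda>Y. Y p) (Ys[i := lie_bracket X (Ys ! i)]))))"

definition lie_derivative_zero ::
  "('a::topological_space, 'm::finite) chart set \<Rightarrow> nat \<Rightarrow> 'a vfield \<Rightarrow> 'a form \<Rightarrow> bool" where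
  "lie_derivative_zero A k X \<omega> \<longleftrightarrow>
     (\<forall>Ys. length Ys = k \<and> set Ys \<subseteq> vector_fields A \<longrightarrow> lie_derivative X \<omega> Ys = (\<lambda>_. 0))"

text \<open>\<open>g = div\<^sub>\<nu> X\<close>, i.e. \<open>\<L>\<^sub>X \<nu> = g \<nu>\<close>; such a \<open>g\<close> is unique for a volume form \<open>\<nu>\<close>.\<close>

definition is_divergence ::
  "('a::topological_space, 'm::finite) chart set \<Rightarrow> 'a form \<Rightarrow> 'a vfield \<Rightarrow> ('a \<Rightarrow> real) \<Rightarrow> bool" where
  "is_divergence A \<nu> X g \<longleftrightarrow>
     (\<forall>Ys. length Ys = CARD('m) \<and> set Ys \<subseteq> vector_fields A \<longrightarrow>
        lie_derivative X \<nu> Ys = (\<lambda>p. g p * \<nu> p (map (\<lambda>Y. Y p) Ys)))"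


section \<open>Nambu-Poisson manifolds and the modular class\<close>

definition nambu_bracket ::
  "('a::topological_space, 'm::finite) chart set \<Rightarrow> 'a mvfield \<Rightarrow> ('a \<Rightarrow> real) list \<Rightarrow> 'a \<Rightarrow> real" where
  "nambu_bracket A \<Lambda> fs = (\<lambda>p. \<Lambda> p (map (\<lambda>f. differential A f p) fs))"

definition nambu_poisson ::
  "('a::topological_space, 'm::finite) chart set \<Rightarrow> nat \<Rightarrow> 'a mvfield \<Rightarrow> bool" where
  "nambu_poisson A n \<Lambda> \<longleftrightarrow>
     n \<le> CARD('m) \<and> \<Lambda> \<in> multivector_fields A n \<and>
     (\<forall>fs gs. length fs = n - 1 \<and> length gs = n \<and>
        set fs \<subseteq> smooth_functions A \<and> set gs \<subseteq> smooth_functions A \<longrightarrow>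
        nambu_bracket A \<Lambda> (fs @ [nambu_bracket A \<Lambda> gs]) =
        (\<lambda>p. \<Sum>i<n. nambu_bracket A \<Lambda> (gs[i := nambu_bracket A \<Lambda> (fs @ [gs ! i])]) p))"

text \<open>\<open>sharp A \<Lambda> k\<close> is \<open>#\<^sub>k\<close>, mapping \<open>k\<close>-forms to multivector fields by \<open>#\<^sub>k(\<beta>) = i(\<beta>)\<Lambda>\<close>.\<close>

definition sharp ::
  "('a::topological_space, 'm::finite) chart set \<Rightarrow> 'a mvfield \<Rightarrow> nat \<Rightarrow> 'a form \<Rightarrow> 'a mvfield" where
  "sharp A \<Lambda> k \<beta> = (\<lambda>p. contraction (tangent_space A p) k (\<beta> p) (\<Lambda> p))"

definition hamiltonian ::
  "('a::topological_space, 'm::finite) chart set \<Rightarrow> 'a mvfield \<Rightarrow> ('a \<Rightarrow> real) list \<Rightarrow> 'a vfield" where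
  "hamiltonian A \<Lambda> fs = vfield_of A (sharp A \<Lambda> (length fs)
     (\<lambda>p. wedge (tangent_space A p) (map (\<lambda>f. differential A f p) fs)))"

text \<open>
  \<open>modular_tensor A n \<Lambda> \<nu> M\<close>: \<open>M\<close> is the \<open>(n-1)\<close>-vector field with
  \<open>M(df\<^sub>1, \<dots>, df\<^sub>n\<^sub>-\<^sub>1) = div\<^sub>\<nu>(X\<^sub>f\<^sub>1\<^sub>\<dots>\<^sub>f\<^sub>n\<^sub>-\<^sub>1)\<close>.  There is exactly one such \<open>M\<close> for each volume form \<open>\<nu>\<close>.
\<close>

definition modular_tensor ::
  "('a::topological_space, 'm::finite) chart set \<Rightarrow> nat \<Rightarrow> 'a mvfield \<Rightarrow> 'a form \<Rightarrow> 'a mvfield \<Rightarrow> bool" where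
  "modular_tensor A n \<Lambda> \<nu> M \<longleftrightarrow>
     M \<in> multivector_fields A (n - 1) \<and>
     (\<forall>fs. length fs = n - 1 \<and> set fs \<subseteq> smooth_functions A \<longrightarrow>
        is_divergence A \<nu> (hamiltonian A \<Lambda> fs) (\<lambda>p. M p (map (\<lambda>f. differential A f p) fs)))"

text \<open>\<open>1\<close>-cochains are maps from \<open>(n-1)\<close>-forms to functions, \<open>undefined\<close> elsewhere.\<close>

type_synonym 'a cochain = "'a form \<Rightarrow> 'a \<Rightarrow> real"

definition coboundary ::
  "('a::topological_space, 'm::finite) chart set \<Rightarrow> nat \<Rightarrow> 'a mvfield \<Rightarrow> ('a \<Rightarrow> real) \<Rightarrow> 'a cochain" where
  "coboundary A n \<Lambda> f = (\<lambda>\<alpha>\<in>forms A (n - 1). \<lambda>p. vfield_of A (sharp A \<Lambda> (n - 1) \<alpha>) p f)"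

definition modular_cocycle ::
  "('a::topological_space, 'm::finite) chart set \<Rightarrow> nat \<Rightarrow> 'a mvfield \<Rightarrow> 'a cochain" where
  "modular_cocycle A n M =
     (\<lambda>\<alpha>\<in>forms A (n - 1). \<lambda>p. contraction (tangent_space A p) (n - 1) (\<alpha> p) (M p) [])"

text \<open>A cohomology class is the set of its representatives.\<close>

definition cohomology_class ::
  "('a::topological_space, 'm::finite) chart set \<Rightarrow> nat \<Rightarrow> 'a mvfield \<Rightarrow> 'a cochain \<Rightarrow> 'a cochain set" where
  "cohomology_class A n \<Lambda> c =
     {(\<lambda>\<alpha>\<in>forms A (n - 1). \<lambda>p. c \<alpha> p + coboundary A n \<Lambda> f \<alpha> p) | f. f \<in> smooth_functions A}"

text \<open>
  The class of \<open>\<alpha> \<mapsto> i(\<alpha>)M\<close>, with \<open>M\<close> the modular tensor of a volume form \<open>\<nu>\<close>, does not depend on \<open>\<nu>\<close>;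
  the union over all \<open>\<nu>\<close> is therefore that class, and avoids choosing a volume form.
\<close>

definition modular_class ::
  "('a::topological_space, 'm::finite) chart set \<Rightarrow> nat \<Rightarrow> 'a mvfield \<Rightarrow> 'a cochain set" where
  "modular_class A n \<Lambda> =
     (\<Union>\<nu>\<in>volume_forms A. \<Union>M\<in>{M. modular_tensor A n \<Lambda> \<nu> M}.
        cohomology_class A n \<Lambda> (modular_cocycle A n M))"

abbreviation trivial_class ::
  "('a::topological_space, 'm::finite) chart set \<Rightarrow> nat \<Rightarrow> 'a mvfield \<Rightarrow> 'a cochain set" where
  "trivial_class A n \<Lambda> \<equiv> cohomology_class A n \<Lambda> (\<lambda>\<alpha>\<in>forms A (n - 1). \<lambda>p. 0)"

text \<open>Basic volume with respect to the characteristic foliation, spanned by the Hamiltonian fields.\<close>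

definition basic_volume ::
  "('a::topological_space, 'm::finite) chart set \<Rightarrow> nat \<Rightarrow> 'a mvfield \<Rightarrow> 'a form \<Rightarrow> bool" where
  "basic_volume A n \<Lambda> \<mu> \<longleftrightarrow>
     \<mu> \<in> forms A (CARD('m) - n) \<and> nowhere_zero \<mu> \<and>
     (\<forall>fs. length fs = n - 1 \<and> set fs \<subseteq> smooth_functions A \<longrightarrow>
        interior_product (hamiltonian A \<Lambda> fs) \<mu> = (\<lambda>p vs. 0) \<and>
        lie_derivative_zero A (CARD('m) - n) (hamiltonian A \<Lambda> fs) \<mu>)"

end

(*
If M is the modular tensor of nu and i(alpha)M + #(alpha)(f) = 0 for all alpha, then exp(f) nu is
invariant under all Hamiltonian fields X.  Conversely, if nu is invariant, then any other volume form
is h nu with div(X) = X(ln|h|), so its modular cocycle is a coboundary.  It remains to see that the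
invariant volume forms nu correspond to the basic volumes mu through mu = i(Lambda)nu.

Inserting products into the fundamental identity gives, for n >= 3, the Pluecker relations for Lambda
at each point.  So near each point Lambda is G^(1-n) times the wedge product of X_1, ..., X_n, where
G = {g_1,...,g_n} and X_i is the derivation f |-> {g_1,...,f,...,g_n} with f in position i, and mu is
G^(1-n) nu(X_1,...,X_n,...), independently of the g_i.  The fundamental identity also gives the
component of [X,X_i] along X_i, whence (L_X nu)(X_1,...,X_n,...) = G^(n-1) L_X mu.  Since nu is
determined by mu pointwise, it can be constructed locally.
*)

theory Submission
  imports Defs
begin

section \<open>Differentiable functions of class Ck\<close>

text \<open>The exponent \<open>n - 1\<close> comes from a determinant. \<open>X_i\<close> applied
  to \<open>g_j\<close> is \<open>G\<close> for i = j and 0 otherwise, so the wedge product of the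
  \<open>X_i\<close> takes the value \<open>G^n\<close> on \<open>dg_1, ..., dg_n\<close>, where
  \<Lambda> takes the value \<open>G\<close>. The same exponent has to reappear in the Lie
  derivative: the component of \<open>[X, X_i]\<close> along \<open>X_i\<close> is
  \<open>(X G - a_i) / G\<close>, where the \<open>a_i\<close> add up to \<open>X G\<close>; summed
  over the \<open>n\<close> fields this is \<open>(n - 1) X G / G\<close>, the logarithmic
  derivative of \<open>G^(n-1)\<close>. Two features of the encoding shape the rest. Tangent vectors
  are derivations of the algebra of global functions, so locality, the chain rule and the existence
  of local frames have to be derived from cut-off functions and Hadamard's factorisation. The Lie
  derivative of a form is given by its values on tuples of vector fields, so it must be shown to
  depend only on the values of these fields at the point before one test tuple can decide whether it
  vanishes.\<close>

lemma Ck_on_subset: "Ck_on k f S \<Longrightarrow> T \<subseteq> S \<Longrightarrow> Ck_on k f T"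
  by (induction k arbitrary: f) (auto intro: continuous_on_subset)

lemma has_derivative_frechet_derivative:
  "f differentiable (at x) \<Longrightarrow> (f has_derivative frechet_derivative f (at x)) (at x)"
  by (simp add: frechet_derivative_works)

lemma Ck_on_cong:
  assumes "Ck_on k f S" "open S" "\<And>x. x \<in> S \<Longrightarrow> f x = g x"
  shows "Ck_on k g S"
  using assms
proof (induction k arbitrary: f g)
  case 0
  then show ?case by (auto cong: continuous_on_cong)
next
  case (Suc k)
  have D: "(g has_derivative frechet_derivative f (at x)) (at x)" if "x \<in> S" for x
    using Suc.prems that
    by (intro has_derivative_transform_within_open[OF has_derivative_frechet_derivative, of f x S g]) auto
  have "Ck_on k (\<lambda>x. frechet_derivative g (at x) v) S" for v
  proof (rule Suc.IH)
    show "Ck_on k (\<lambda>x. frechet_derivative f (at x) v) S" using Suc.prems(1) by simp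
    show "frechet_derivative f (at x) v = frechet_derivative g (at x) v" if "x \<in> S" for x
      using frechet_derivative_at[OF D[OF that]] by simp
  qed (rule Suc.prems(2))
  moreover have "g differentiable (at x)" if "x \<in> S" for x
    using D[OF that] unfolding differentiable_def by blast
  ultimately show ?case by simp
qed

text \<open>Working rule for C^k claims: any explicit derivative may stand in for
  \<open>frechet_derivative\<close>, because derivatives are unique and being C^k on an open set
  depends only on the values there.\<close>

lemma Ck_on_SucI:
  assumes "open S" "\<And>x. x \<in> S \<Longrightarrow> (f has_derivative f' x) (at x)"
    and "\<And>v. Ck_on k (\<lambda>x. f' x v) S"
  shows "Ck_on (Suc k) f S"
proof -
  have "f differentiable (at x)" if "x \<in> S" for x
    using assms(2)[OF that] unfolding differentiable_def by blast
  moreover have "Ck_on k (\<lambda>x. frechet_derivative f (at x) v) S" for v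
  proof (rule Ck_on_cong[OF assms(3)[of v] assms(1)])
    show "f' x v = frechet_derivative f (at x) v" if "x \<in> S" for x
      using frechet_derivative_at[OF assms(2)[OF that]] by simp
  qed
  ultimately show ?thesis by simp
qed

lemma Ck_on_SucD:
  assumes "Ck_on (Suc k) f S" "x \<in> S"
  shows "(f has_derivative frechet_derivative f (at x)) (at x)"
  using assms by (auto intro: has_derivative_frechet_derivative)

lemma Ck_on_local:
  assumes "\<And>x. x \<in> S \<Longrightarrow> \<exists>T. open T \<and> x \<in> T \<and> Ck_on k f T"
  shows "Ck_on k f S"
  using assms
proof (induction k arbitrary: f)
  case 0
  show ?case unfolding Ck_on.simps
  proof (rule continuous_at_imp_continuous_on, rule ballI)
    fix x assume "x \<in> S"
    then obtain T where "open T" "x \<in> T" "continuous_on T f" using 0[of x] by auto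
    then show "isCont f x" by (simp add: continuous_on_eq_continuous_at)
  qed
next
  case (Suc k)
  have "Ck_on k (\<lambda>x. frechet_derivative f (at x) v) S" for v
  proof (rule Suc.IH)
    fix x assume "x \<in> S"
    from Suc.prems[OF this] show "\<exists>T. open T \<and> x \<in> T \<and> Ck_on k (\<lambda>x. frechet_derivative f (at x) v) T"
      by auto
  qed
  moreover have "f differentiable (at x)" if "x \<in> S" for x using Suc.prems[OF that] by auto
  ultimately show ?case by simp
qed

lemma Ck_on_SucD_less: "Ck_on (Suc k) f S \<Longrightarrow> Ck_on k f S"
proof (induction k arbitrary: f)
  case 0
  then show ?case
    by (auto intro!: continuous_at_imp_continuous_on differentiable_imp_continuous_within)
next
  case (Suc k)
  then have "Ck_on (Suc k) (\<lambda>x. frechet_derivative f (at x) v) S" for v by simp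
  then have "Ck_on k (\<lambda>x. frechet_derivative f (at x) v) S" for v using Suc.IH by blast
  then show ?case using Suc.prems by simp
qed

lemma Ck_on_const: "open S \<Longrightarrow> Ck_on k (\<lambda>x. c) S"
proof (induction k arbitrary: c)
  case (Suc k)
  show ?case by (rule Ck_on_SucI[where f'="\<lambda>x v. 0"]) (use Suc in simp_all)
qed simp

lemma Ck_on_bounded_linear:
  assumes "bounded_linear L" "open S" "Ck_on k f S"
  shows "Ck_on k (\<lambda>x. L (f x)) S"
  using assms(3)
proof (induction k arbitrary: f)
  case 0
  then show ?case using assms(1) by (auto intro: bounded_linear.continuous_on)
next
  case (Suc k)
  show ?case
  proof (rule Ck_on_SucI[OF assms(2)])
    show "((\<lambda>x. L (f x)) has_derivative (\<lambda>v. L (frechet_derivative f (at x) v))) (at x)"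
      if "x \<in> S" for x
      using bounded_linear.has_derivative[OF assms(1) Ck_on_SucD[OF Suc.prems that]] .
    show "Ck_on k (\<lambda>x. L (frechet_derivative f (at x) v)) S" for v
      using Suc by simp
  qed
qed

lemma Ck_on_ident: "open S \<Longrightarrow> Ck_on k (\<lambda>x. x) S"
  by (cases k) (auto intro!: Ck_on_SucI[where f'="\<lambda>x v. v"] Ck_on_const)

lemma Ck_on_add:
  assumes "open S" "Ck_on k f S" "Ck_on k g S"
  shows "Ck_on k (\<lambda>x. f x + g x) S"
  using assms(2,3)
proof (induction k arbitrary: f g)
  case 0
  then show ?case by (auto intro: continuous_intros)
next
  case (Suc k)
  show ?case
    by (rule Ck_on_SucI[OF assms(1) has_derivative_add[OF Ck_on_SucD[OF Suc.prems(1)] Ck_on_SucD[OF Suc.prems(2)]]])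
      (use Suc in auto)
qed

lemma Ck_on_sum:
  assumes "open S" "\<And>i. i \<in> I \<Longrightarrow> Ck_on k (f i) S"
  shows "Ck_on k (\<lambda>x. \<Sum>i\<in>I. f i x) S"
  using assms(2) by (induction I rule: infinite_finite_induct) (auto intro: Ck_on_add Ck_on_const assms(1))

lemma Ck_on_mult:
  fixes f g :: "'a::real_normed_vector \<Rightarrow> real"
  assumes "open S" "Ck_on k f S" "Ck_on k g S"
  shows "Ck_on k (\<lambda>x. f x * g x) S"
  using assms(2,3)
proof (induction k arbitrary: f g)
  case 0
  then show ?case by (auto intro: continuous_intros)
next
  case (Suc k)
  show ?case
  proof (rule Ck_on_SucI[OF assms(1) has_derivative_mult[OF Ck_on_SucD[OF Suc.prems(1)] Ck_on_SucD[OF Suc.prems(2)]]])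
    fix v
    have "Ck_on k f S" "Ck_on k g S" using Suc.prems by (auto intro: Ck_on_SucD_less simp del: Ck_on.simps)
    then show "Ck_on k (\<lambda>x. f x * frechet_derivative g (at x) v + frechet_derivative f (at x) v * g x) S"
      using Suc by (intro Ck_on_add assms(1) Suc.IH) auto
  qed
qed

lemma linear_real_expansion:
  fixes L :: "'a::euclidean_space \<Rightarrow> real"
  assumes "linear L"
  shows "L w = (\<Sum>b\<in>Basis. (w \<bullet> b) * L b)"
proof -
  have "L w = L (\<Sum>b\<in>Basis. (w \<bullet> b) *\<^sub>R b)" by (simp add: euclidean_representation)
  also have "\<dots> = (\<Sum>b\<in>Basis. (w \<bullet> b) * L b)"
    by (simp add: linear_sum[OF assms] linear_cmul[OF assms])
  finally show ?thesis .
qed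

text \<open>The derivative \<open>f'(g x) (g' x v)\<close> applies \<open>f'\<close> to a direction
  that moves with \<open>x\<close>, whereas the induction hypothesis covers fixed directions.
  Expanding the direction in a basis turns it into a sum of products, each within reach of the
  hypothesis.\<close>

lemma Ck_on_compose:
  fixes f :: "'b::euclidean_space \<Rightarrow> real" and g :: "'a::real_normed_vector \<Rightarrow> 'b"
  assumes "open S" "open T" "g ` S \<subseteq> T" "Ck_on k f T" "Ck_on k g S"
  shows "Ck_on k (\<lambda>x. f (g x)) S"
  using assms(4,5)
proof (induction k arbitrary: f)
  case 0
  then show ?case using assms(3) by (auto intro: continuous_on_compose2)
next
  case (Suc k)
  note Df = Ck_on_SucD[OF Suc.prems(1)] and Dg = Ck_on_SucD[OF Suc.prems(2)]
  have gT: "g x \<in> T" if "x \<in> S" for x using assms(3) that by auto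
  have Cg: "Ck_on k g S" using Suc.prems(2) by (rule Ck_on_SucD_less)
  show ?case
  proof (rule Ck_on_SucI[OF assms(1)])
    fix x assume x: "x \<in> S"
    have lin: "linear (frechet_derivative f (at (g x)))"
      using Df[OF gT[OF x]] by (rule has_derivative_linear)
    have "((\<lambda>x. f (g x)) has_derivative (\<lambda>v. frechet_derivative f (at (g x)) (frechet_derivative g (at x) v))) (at x)"
      using has_derivative_compose[OF Dg[OF x] Df[OF gT[OF x]]] .
    moreover have "(\<lambda>v. frechet_derivative f (at (g x)) (frechet_derivative g (at x) v)) =
        (\<lambda>v. \<Sum>b\<in>Basis. (frechet_derivative g (at x) v \<bullet> b) * frechet_derivative f (at (g x)) b)"
      by (rule ext) (rule linear_real_expansion[OF lin])
    ultimately show "((\<lambda>x. f (g x)) has_derivative (\<lambda>v. \<Sum>b\<in>Basis.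
        (frechet_derivative g (at x) v \<bullet> b) * frechet_derivative f (at (g x)) b)) (at x)"
      by (rule subst[rotated])
  next
    fix v
    show "Ck_on k (\<lambda>x. \<Sum>b\<in>Basis. (frechet_derivative g (at x) v \<bullet> b) * frechet_derivative f (at (g x)) b) S"
    proof (intro Ck_on_sum Ck_on_mult assms(1))
      fix b :: 'b
      show "Ck_on k (\<lambda>x. frechet_derivative g (at x) v \<bullet> b) S"
        using Suc.prems(2) by (intro Ck_on_bounded_linear[OF bounded_linear_inner_left] assms(1)) auto
      show "Ck_on k (\<lambda>x. frechet_derivative f (at (g x)) b) S"
        using Suc.prems(1) by (intro Suc.IH Cg) auto
    qed
  qed
qed

section \<open>Smooth functions of one variable: exponential, inverse, logarithm and a smooth
  step\<close>

lemma Ck_on_real_derivative: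
  fixes f :: "real \<Rightarrow> real"
  assumes "open S" "\<And>x. x \<in> S \<Longrightarrow> (f has_real_derivative f' x) (at x)" "Ck_on k f' S"
  shows "Ck_on (Suc k) f S"
  by (rule Ck_on_SucI[where f'="\<lambda>x v. f' x * v"])
    (use assms in \<open>auto simp: has_field_derivative_def intro: Ck_on_mult Ck_on_const\<close>)

lemma smooth_on_exp: "smooth_on (exp :: real \<Rightarrow> real) UNIV"
  unfolding smooth_on_def
proof
  show "Ck_on k (exp :: real \<Rightarrow> real) UNIV" for k
    by (induction k) (auto intro!: continuous_intros Ck_on_real_derivative simp del: Ck_on.simps(2) intro: DERIV_exp)
qed

lemma smooth_on_inverse: "smooth_on (inverse :: real \<Rightarrow> real) (- {0})"
  unfolding smooth_on_def
proof
  have op: "open (- {0::real})" by auto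
  show "Ck_on k (inverse :: real \<Rightarrow> real) (- {0})" for k
  proof (induction k)
    case 0
    then show ?case by (auto intro!: continuous_intros)
  next
    case (Suc k)
    have "Ck_on k (\<lambda>x::real. (-1) * (inverse x * inverse x)) (- {0})"
      using Suc by (intro Ck_on_mult op Ck_on_const)
    then show ?case
      by (intro Ck_on_real_derivative[OF op, where f'="\<lambda>x. (-1) * (inverse x * inverse x)"])
        (auto intro!: derivative_eq_intros)
  qed
qed

lemma smooth_on_ln: "smooth_on (ln :: real \<Rightarrow> real) {0<..}"
  unfolding smooth_on_def
proof
  fix k
  have "Ck_on k (inverse :: real \<Rightarrow> real) {0<..}"
    using smooth_on_inverse by (auto simp: smooth_on_def intro: Ck_on_subset)
  then have "Ck_on (Suc k) (ln :: real \<Rightarrow> real) {0<..}"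
    by (intro Ck_on_real_derivative) (auto intro!: derivative_eq_intros simp: divide_inverse)
  then show "Ck_on k (ln :: real \<Rightarrow> real) {0<..}" by (rule Ck_on_SucD_less)
qed

text \<open>The functions \<open>P(1/t) e^(-1/t)\<close>, extended by 0. The polynomial is carried
  along because this family, unlike the single function \<open>e^(-1/t)\<close>, is closed under
  differentiation.\<close>

definition flat :: "real poly \<Rightarrow> real \<Rightarrow> real" where
  "flat P t = (if t > 0 then poly P (1 / t) * exp (- (1 / t)) else 0)"

lemma poly_over_exp_tendsto_0: "((\<lambda>u. poly P u * exp (- u)) \<longlongrightarrow> (0::real)) at_top"
proof -
  have "((\<lambda>u. \<Sum>i\<le>degree P. coeff P i * (u ^ i / exp u)) \<longlongrightarrow> (\<Sum>i\<le>degree P. coeff P i * 0)) at_top"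
    by (intro tendsto_intros tendsto_power_div_exp_0)
  then show ?thesis by (simp add: poly_altdef exp_minus sum_distrib_right divide_inverse mult.assoc)
qed

text \<open>With \<open>u = 1/t\<close> and \<open>du/dt = -u^2\<close>, the derivative of
  \<open>P(u) e^(-u)\<close> is \<open>u^2 (P - P')(u) e^(-u)\<close>, whence the polynomial on the
  right.\<close>

lemma flat_derivative:
  "(flat P has_real_derivative flat (monom 1 2 * (P - pderiv P)) t) (at t)"
proof -
  consider "t > 0" | "t < 0" | "t = 0" by linarith
  then show ?thesis
  proof cases
    case 1
    have "((\<lambda>t. poly P (1 / t) * exp (- (1 / t))) has_real_derivative
        flat (monom 1 2 * (P - pderiv P)) t) (at t)"
      using 1 by (auto intro!: derivative_eq_intros DERIV_chain'[OF _ poly_DERIV]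
        simp: flat_def poly_monom power2_eq_square field_simps)
    then show ?thesis
      by (rule has_field_derivative_transform_within_open[where S="{0<..}"]) (use 1 in \<open>auto simp: flat_def\<close>)
  next
    case 2
    have "((\<lambda>t. 0) has_real_derivative flat (monom 1 2 * (P - pderiv P)) t) (at t)"
      using 2 by (simp add: flat_def)
    then show ?thesis
      by (rule has_field_derivative_transform_within_open[where S="{..<0}"]) (use 2 in \<open>auto simp: flat_def\<close>)
  next
    case 3
    \<comment> \<open>The difference quotient from the right is \<open>u P(u) e^(-u)\<close> with
      \<open>u = 1/h\<close> tending to infinity; \<open>pCons 0 P\<close> is the polynomial
      \<open>u P\<close>.\<close>
    have "((\<lambda>h. poly (pCons 0 P) (inverse h) * exp (- inverse h)) \<longlongrightarrow> 0) (at_right (0::real))"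
      using filterlim_compose[OF poly_over_exp_tendsto_0 filterlim_inverse_at_top_right] .
    then have "((\<lambda>h. flat P h / h) \<longlongrightarrow> 0) (at_right 0)"
      by (rule Lim_transform_eventually) (auto simp: eventually_at_filter flat_def divide_inverse)
    moreover have "((\<lambda>h. flat P h / h) \<longlongrightarrow> 0) (at_left 0)"
      by (rule Lim_transform_eventually[OF tendsto_const]) (auto simp: eventually_at_filter flat_def)
    ultimately have "((\<lambda>h. flat P h / h) \<longlongrightarrow> 0) (at 0)" by (simp add: filterlim_split_at)
    then show ?thesis using 3 by (simp add: DERIV_def flat_def)
  qed
qed

lemma smooth_on_flat: "smooth_on (flat P) UNIV"
  unfolding smooth_on_def
proof
  show "Ck_on k (flat P) UNIV" for k
  proof (induction k arbitrary: P)
    case 0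
    then show ?case using DERIV_isCont[OF flat_derivative] by (auto intro!: continuous_at_imp_continuous_on)
  next
    case (Suc k)
    show ?case by (rule Ck_on_real_derivative[OF _ flat_derivative Suc]) auto
  qed
qed

lemma exists_smooth_step:
  "\<exists>s :: real \<Rightarrow> real. smooth_on s UNIV \<and> (\<forall>t\<le>1. s t = 1) \<and> (\<forall>t\<ge>2. s t = 0)"
proof -
  \<comment> \<open>In the denominator the first summand is positive exactly for
    \<open>t < 2\<close> and the second exactly for \<open>t > 1\<close>, so it never vanishes, and
    only one of them is left for \<open>t\<close> up to 1 and for \<open>t\<close> from 2
    on.\<close>
  define s where "s = (\<lambda>t. flat 1 (2 - t) * inverse (flat 1 (2 - t) + flat 1 (t - 1)))"
  have nz: "flat 1 (2 - t) + flat 1 (t - 1) \<noteq> 0" for t :: real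
  proof -
    have "flat 1 (2 - t) \<ge> 0" "flat 1 (t - 1) \<ge> 0" "flat 1 (2 - t) > 0 \<or> flat 1 (t - 1) > 0"
      by (auto simp: flat_def)
    then show ?thesis by linarith
  qed
  have "Ck_on k s UNIV" for k
  proof -
    have a: "Ck_on k (\<lambda>t::real. a + b * t) UNIV" for a b
      by (intro Ck_on_add Ck_on_mult Ck_on_const Ck_on_ident) auto
    have fl: "Ck_on k (flat 1) UNIV" using smooth_on_flat by (simp add: smooth_on_def)
    have 1: "Ck_on k (\<lambda>t. flat 1 (2 - t)) UNIV" "Ck_on k (\<lambda>t. flat 1 (t - 1)) UNIV"
      using Ck_on_compose[OF _ _ _ fl a[of 2 "-1"]] Ck_on_compose[OF _ _ _ fl a[of "-1" 1]] by simp_all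
    have "Ck_on k (\<lambda>t. inverse (flat 1 (2 - t) + flat 1 (t - 1))) UNIV"
    proof (rule Ck_on_compose[where f=inverse and T="- {0::real}"])
      show "Ck_on k inverse (- {0::real})" using smooth_on_inverse by (simp add: smooth_on_def)
      show "Ck_on k (\<lambda>t. flat 1 (2 - t) + flat 1 (t - 1)) UNIV" by (intro Ck_on_add 1 open_UNIV)
    qed (use nz in auto)
    then show ?thesis unfolding s_def by (intro Ck_on_mult 1 open_UNIV)
  qed
  moreover have "s t = 1" if "t \<le> 1" for t using that nz[of t] by (simp add: s_def flat_def)
  moreover have "s t = 0" if "t \<ge> 2" for t using that by (simp add: s_def flat_def)
  ultimately show ?thesis unfolding smooth_on_def by blast
qed

text \<open>Differentiation in \<open>y\<close> under the integral pulls a factor \<open>t\<close>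
  out of \<open>y0 + t (y - y0)\<close>. The weight \<open>t ^ j\<close> makes the statement stable
  under this, with \<open>j + 1\<close> in place of \<open>j\<close>.\<close>

lemma Ck_on_integral_segment:
  fixes H :: "'a::euclidean_space \<Rightarrow> real"
  assumes "open B" "convex B" "y0 \<in> B" "Ck_on k H B"
  shows "Ck_on k (\<lambda>y. integral (cbox 0 1) (\<lambda>t. t ^ j * H (y0 + t *\<^sub>R (y - y0)))) B"
  using assms(4)
proof (induction k arbitrary: j H)
  have seg: "y0 + t *\<^sub>R (y - y0) \<in> B" if "y \<in> B" "t \<in> cbox 0 1" for y and t :: real
  proof -
    have "y0 + t *\<^sub>R (y - y0) = (1 - t) *\<^sub>R y0 + t *\<^sub>R y" by (simp add: algebra_simps)
    then show ?thesis using convexD[OF assms(2,3) that(1), of "1 - t" t] that(2) by auto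
  qed
  have cont: "continuous_on (B \<times> cbox 0 1) (\<lambda>(y, t). t ^ j * H (y0 + t *\<^sub>R (y - y0)))"
    if "continuous_on B H" for j H
  proof -
    have "continuous_on (B \<times> cbox 0 1) (\<lambda>z. H (y0 + snd z *\<^sub>R (fst z - y0)))"
      by (rule continuous_on_compose2[OF that]) (use seg in \<open>auto intro!: continuous_intros\<close>)
    then show ?thesis unfolding split_beta by (intro continuous_intros)
  qed
  {
    case 0
    then show ?case using integral_continuous_on_param[OF cont] by simp
  next
    case (Suc k)
    have H0: "Ck_on 0 H B"
      using Suc.prems by (auto intro!: continuous_at_imp_continuous_on differentiable_imp_continuous_within)
    have DH: "(H has_derivative frechet_derivative H (at y)) (at y)" if "y \<in> B" for y
      using Ck_on_SucD[OF Suc.prems that] .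
    have DC: "Ck_on k (\<lambda>y. frechet_derivative H (at y) v) B" for v using Suc.prems by simp
    have DC0: "continuous_on B (\<lambda>y. frechet_derivative H (at y) v)" for v
      using DC[of v] by (cases k) (auto intro!: continuous_at_imp_continuous_on differentiable_imp_continuous_within)
    \<comment> \<open>\<open>leibniz_rule\<close> expects the derivative as a continuous family of
      bounded linear maps.\<close>
    define \<Phi> where "\<Phi> y t = Blinfun (\<lambda>v. t ^ j * (t * frechet_derivative H (at (y0 + t *\<^sub>R (y - y0))) v))"
      for y and t :: real
    have bl: "bounded_linear (\<lambda>v. t ^ j * (t * frechet_derivative H (at (y0 + t *\<^sub>R (y - y0))) v))"
      if "y \<in> B" "t \<in> cbox 0 1" for y and t :: real
      using has_derivative_bounded_linear[OF DH[OF seg[OF that]]]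
      by (intro bounded_linear_const_mult)
    have \<Phi>: "blinfun_apply (\<Phi> y t) v = t ^ Suc j * frechet_derivative H (at (y0 + t *\<^sub>R (y - y0))) v"
      if "y \<in> B" "t \<in> cbox 0 1" for y t v
      unfolding \<Phi>_def using bounded_linear_Blinfun_apply[OF bl[OF that]] by simp
    have contP: "continuous_on (B \<times> cbox 0 1) (\<lambda>(y, t). \<Phi> y t)"
    proof (rule continuous_on_blinfun_componentwise)
      fix i :: 'a
      have "continuous_on (B \<times> cbox 0 1) (\<lambda>(y, t). t ^ Suc j * frechet_derivative H (at (y0 + t *\<^sub>R (y - y0))) i)"
        by (rule cont[OF DC0])
      then show "continuous_on (B \<times> cbox 0 1) (\<lambda>z. blinfun_apply (case z of (y, t) \<Rightarrow> \<Phi> y t) i)"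
        by (rule continuous_on_eq) (auto simp: \<Phi>)
    qed
    have D: "((\<lambda>y. integral (cbox 0 1) (\<lambda>t. t ^ j * H (y0 + t *\<^sub>R (y - y0)))) has_derivative
        blinfun_apply (integral (cbox 0 1) (\<Phi> y))) (at y)" if y: "y \<in> B" for y
    proof -
      have "((\<lambda>y. integral (cbox 0 1) (\<lambda>t. t ^ j * H (y0 + t *\<^sub>R (y - y0)))) has_derivative
          blinfun_apply (integral (cbox 0 1) (\<Phi> y))) (at y within B)"
      proof (rule leibniz_rule[OF _ _ contP y assms(2)])
        fix x and t :: real assume xt: "x \<in> B" "t \<in> cbox 0 1"
        have "((\<lambda>y. y0 + t *\<^sub>R (y - y0)) has_derivative (\<lambda>v. t *\<^sub>R v)) (at x)"
          by (auto intro!: derivative_eq_intros)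
        from has_derivative_compose[OF this DH[OF seg[OF xt]]]
        have "((\<lambda>y. t ^ j * H (y0 + t *\<^sub>R (y - y0))) has_derivative
            (\<lambda>v. t ^ j * frechet_derivative H (at (y0 + t *\<^sub>R (x - y0))) (t *\<^sub>R v))) (at x)"
          by (rule has_derivative_mult_right)
        moreover have "(\<lambda>v. t ^ j * frechet_derivative H (at (y0 + t *\<^sub>R (x - y0))) (t *\<^sub>R v)) = blinfun_apply (\<Phi> x t)"
          using linear_cmul[OF has_derivative_linear[OF DH[OF seg[OF xt]]]] by (auto simp: \<Phi>[OF xt] fun_eq_iff)
        ultimately show "((\<lambda>y. t ^ j * H (y0 + t *\<^sub>R (y - y0))) has_derivative blinfun_apply (\<Phi> x t)) (at x within B)"
          by (auto intro: has_derivative_at_withinI)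
      next
        fix x assume x: "x \<in> B"
        have "continuous_on (cbox 0 1) (\<lambda>t. case (x, t) of (y, t) \<Rightarrow> t ^ j * H (y0 + t *\<^sub>R (y - y0)))"
          by (rule continuous_on_compose2[OF cont[OF H0[unfolded Ck_on.simps(1)]]
                continuous_on_Pair[OF continuous_on_const continuous_on_id]]) (use x in auto)
        then show "(\<lambda>t. t ^ j * H (y0 + t *\<^sub>R (x - y0))) integrable_on cbox 0 1"
          by (simp add: integrable_continuous_interval)
      qed
      then show ?thesis unfolding at_within_open[OF y assms(1)] .
    qed
    have int: "blinfun_apply (integral (cbox 0 1) (\<Phi> y)) v =
        integral (cbox 0 1) (\<lambda>t. t ^ Suc j * frechet_derivative H (at (y0 + t *\<^sub>R (y - y0))) v)"
      if y: "y \<in> B" for y v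
    proof -
      have "continuous_on (cbox 0 1) (\<lambda>t. case (y, t) of (y, t) \<Rightarrow> \<Phi> y t)"
        by (rule continuous_on_compose2[OF contP continuous_on_Pair[OF continuous_on_const continuous_on_id]])
          (use y in auto)
      then have "\<Phi> y integrable_on cbox 0 1" by (simp add: integrable_continuous_interval)
      then have "blinfun_apply (integral (cbox 0 1) (\<Phi> y)) v = integral (cbox 0 1) (\<lambda>t. blinfun_apply (\<Phi> y t) v)"
        by (rule blinfun_apply_integral)
      also have "\<dots> = integral (cbox 0 1) (\<lambda>t. t ^ Suc j * frechet_derivative H (at (y0 + t *\<^sub>R (y - y0))) v)"
        by (intro integral_cong \<Phi>[OF y])
      finally show ?thesis .
    qed
    show ?case
    proof (rule Ck_on_SucI[OF assms(1) D])
      fix v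
      show "Ck_on k (\<lambda>y. blinfun_apply (integral (cbox 0 1) (\<Phi> y)) v) B"
        by (rule Ck_on_cong[OF Suc.IH[OF DC[of v], of "Suc j"] assms(1)]) (rule int[symmetric])
    qed
  }
qed

text \<open>\<open>F y - F y0\<close> is the integral of the derivative along the segment, and the
  coefficients are integrals of partial derivatives. Their smoothness is the point: the product rule
  for a derivation at \<open>y0\<close> then retains only their values at \<open>y0\<close>.\<close>

lemma hadamard:
  fixes F :: "'a::euclidean_space \<Rightarrow> real"
  assumes "open B" "convex B" "y0 \<in> B" "smooth_on F B"
  obtains G where "\<And>b. smooth_on (G b) B"
    and "\<And>y. y \<in> B \<Longrightarrow> F y = F y0 + (\<Sum>b\<in>Basis. ((y - y0) \<bullet> b) * G b y)"
    and "\<And>b. G b y0 = frechet_derivative F (at y0) b"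
proof
  \<comment> \<open>The factor \<open>t ^ 0\<close> is 1 and fits the integrand to
    \<open>Ck_on_integral_segment\<close>.\<close>
  let ?G = "\<lambda>b y. integral (cbox 0 1) (\<lambda>t. t ^ 0 * frechet_derivative F (at (y0 + t *\<^sub>R (y - y0))) b)"
  have C: "Ck_on k F B" for k using assms(4) by (simp add: smooth_on_def)
  have DC: "Ck_on k (\<lambda>y. frechet_derivative F (at y) v) B" for k v using C[of "Suc k"] by simp
  show "smooth_on (?G b) B" for b
    unfolding smooth_on_def by (intro allI Ck_on_integral_segment assms DC)
  show "?G b y0 = frechet_derivative F (at y0) b" for b by simp
  fix y assume y: "y \<in> B"
  have seg: "y0 + t *\<^sub>R (y - y0) \<in> B" if "t \<in> {0..1}" for t :: real
  proof -
    have "y0 + t *\<^sub>R (y - y0) = (1 - t) *\<^sub>R y0 + t *\<^sub>R y" by (simp add: algebra_simps)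
    then show ?thesis using convexD[OF assms(2,3) y, of "1 - t" t] that by auto
  qed
  have D: "(F has_derivative frechet_derivative F (at z)) (at z)" if "z \<in> B" for z
    using Ck_on_SucD[OF C that] .
  have rep: "frechet_derivative F (at z) w = (\<Sum>b\<in>Basis. (w \<bullet> b) * frechet_derivative F (at z) b)"
    if "z \<in> B" for z w
    by (rule linear_real_expansion[OF has_derivative_linear[OF D[OF that]]])
  have "((\<lambda>t. frechet_derivative F (at (y0 + t *\<^sub>R (y - y0))) (y - y0)) has_integral
      (F (y0 + 1 *\<^sub>R (y - y0)) - F (y0 + 0 *\<^sub>R (y - y0)))) {0..1}"
  proof (rule fundamental_theorem_of_calculus)
    fix t :: real assume t: "t \<in> {0..1}"
    have "((\<lambda>t. y0 + t *\<^sub>R (y - y0)) has_derivative (\<lambda>s. s *\<^sub>R (y - y0))) (at t)"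
      by (auto intro!: derivative_eq_intros)
    from has_derivative_compose[OF this D[OF seg[OF t]]]
    show "((\<lambda>t. F (y0 + t *\<^sub>R (y - y0))) has_vector_derivative
        frechet_derivative F (at (y0 + t *\<^sub>R (y - y0))) (y - y0)) (at t within {0..1})"
      using linear_cmul[OF has_derivative_linear[OF D[OF seg[OF t]]]]
      by (auto simp: has_vector_derivative_def intro: has_derivative_at_withinI)
  qed simp
  then have "F y - F y0 = integral {0..1} (\<lambda>t. frechet_derivative F (at (y0 + t *\<^sub>R (y - y0))) (y - y0))"
    by (simp add: integral_unique)
  also have "\<dots> = integral {0..1} (\<lambda>t. \<Sum>b\<in>Basis. ((y - y0) \<bullet> b) * frechet_derivative F (at (y0 + t *\<^sub>R (y - y0))) b)"
    by (intro integral_cong rep seg)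
  also have "\<dots> = (\<Sum>b\<in>Basis. ((y - y0) \<bullet> b) * ?G b y)"
  proof (subst integral_sum)
    fix b :: 'a
    have "continuous_on {0..1} (\<lambda>t. frechet_derivative F (at (y0 + t *\<^sub>R (y - y0))) b)"
      by (rule continuous_on_compose2[OF DC[of 0, unfolded Ck_on.simps(1)]])
        (use seg in \<open>auto intro!: continuous_intros\<close>)
    then show "(\<lambda>t. ((y - y0) \<bullet> b) * frechet_derivative F (at (y0 + t *\<^sub>R (y - y0))) b) integrable_on {0..1}"
      by (intro integrable_continuous_interval continuous_intros)
  qed (auto simp: cbox_interval)
  finally show "F y = F y0 + (\<Sum>b\<in>Basis. ((y - y0) \<bullet> b) * ?G b y)" by simp
qed

section \<open>Smooth functions and tangent vectors\<close>

locale manifold =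
  fixes A :: "('a::t2_space, 'm::finite) chart set"
  assumes atlas: "smooth_atlas A"
begin

abbreviation "C \<equiv> smooth_functions A"
abbreviation "T \<equiv> tangent_space A"

text \<open>Tested in all charts, which makes the case \<open>N = UNIV\<close> literally membership
  in \<open>C\<close>; that a single chart suffices is \<open>smooth_in_chart\<close>.\<close>

definition smooth_in :: "'a set \<Rightarrow> ('a \<Rightarrow> real) \<Rightarrow> bool" where
  "smooth_in N f \<longleftrightarrow> (\<forall>(U, \<phi>)\<in>A. smooth_on (f \<circ> inv_into U \<phi>) (\<phi> ` (U \<inter> N)))"

lemma chart:
  assumes "(U, \<phi>) \<in> A"
  shows "open U" "open (\<phi> ` U)" "continuous_on U \<phi>" "continuous_on (\<phi> ` U) (inv_into U \<phi>)"
    and "\<And>q. q \<in> U \<Longrightarrow> inv_into U \<phi> (\<phi> q) = q"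
    and "\<And>N. open N \<Longrightarrow> open (\<phi> ` (U \<inter> N))"
proof -
  have c: "open U" "open (\<phi> ` U)" "homeomorphism U (\<phi> ` U) \<phi> (inv_into U \<phi>)"
    using atlas assms unfolding smooth_atlas_def is_chart_def by fastforce+
  then show "open U" "open (\<phi> ` U)" "continuous_on U \<phi>" "continuous_on (\<phi> ` U) (inv_into U \<phi>)"
    and "\<And>q. q \<in> U \<Longrightarrow> inv_into U \<phi> (\<phi> q) = q"
    by (auto simp: homeomorphism_def)
  show "open (\<phi> ` (U \<inter> N))" if "open N" for N
  proof -
    have "openin (top_of_set U) (U \<inter> N)" using that by (auto simp: openin_open)
    from homeomorphism_imp_open_map[OF c(3) this] show ?thesis
      using c(2) openin_open_trans by blast
  qed
qed

lemma chart_at: obtains U \<phi> where "(U, \<phi>) \<in> A" "p \<in> U"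
proof -
  have "p \<in> (\<Union>c\<in>A. fst c)" using atlas by (simp add: smooth_atlas_def)
  then obtain c where "c \<in> A" "p \<in> fst c" by blast
  then show thesis using that[of "fst c" "snd c"] by simp
qed

lemma transition:
  assumes "(U, \<phi>) \<in> A" "(V, \<psi>) \<in> A"
  shows "smooth_on (\<psi> \<circ> inv_into U \<phi>) (\<phi> ` (U \<inter> V))"
proof -
  have "\<forall>(U, \<phi>)\<in>A. \<forall>(V, \<psi>)\<in>A. smooth_on (\<psi> \<circ> inv_into U \<phi>) (\<phi> ` (U \<inter> V))"
    using atlas by (simp add: smooth_atlas_def)
  from bspec[OF this assms(1)] have "\<forall>(V, \<psi>)\<in>A. smooth_on (\<psi> \<circ> inv_into U \<phi>) (\<phi> ` (U \<inter> V))"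
    by simp
  from bspec[OF this assms(2)] show ?thesis by simp
qed

lemma smooth_inD: "smooth_in N f \<Longrightarrow> (U, \<phi>) \<in> A \<Longrightarrow> Ck_on k (f \<circ> inv_into U \<phi>) (\<phi> ` (U \<inter> N))"
  unfolding smooth_in_def smooth_on_def by auto

lemma smooth_inI:
  assumes "\<And>U \<phi> k. (U, \<phi>) \<in> A \<Longrightarrow> Ck_on k (f \<circ> inv_into U \<phi>) (\<phi> ` (U \<inter> N))"
  shows "smooth_in N f"
  unfolding smooth_in_def smooth_on_def using assms by auto

lemma C_iff: "f \<in> C \<longleftrightarrow> smooth_in UNIV f"
  by (simp add: smooth_functions_def smooth_in_def)

lemma smooth_in_subset: "smooth_in N f \<Longrightarrow> N' \<subseteq> N \<Longrightarrow> smooth_in N' f"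
  by (rule smooth_inI, rule Ck_on_subset[OF smooth_inD]) auto

lemma C_smooth_in: "f \<in> C \<Longrightarrow> smooth_in N f"
  unfolding C_iff by (erule smooth_in_subset) simp

lemma smooth_in_cong:
  assumes "smooth_in N f" "open N" "\<And>q. q \<in> N \<Longrightarrow> f q = g q"
  shows "smooth_in N g"
proof (rule smooth_inI)
  fix U \<phi> k assume c: "(U, \<phi>) \<in> A"
  show "Ck_on k (g \<circ> inv_into U \<phi>) (\<phi> ` (U \<inter> N))"
    by (rule Ck_on_cong[OF smooth_inD[OF assms(1) c] chart(6)[OF c assms(2)]])
      (auto simp: chart(5)[OF c] assms(3))
qed

text \<open>In any other chart \<open>f\<close> is the given local expression composed with a
  transition map, which is smooth.\<close>

lemma smooth_in_chart:
  assumes c: "(U, \<phi>) \<in> A" and N: "open N" "N \<subseteq> U" and f: "\<And>k. Ck_on k (f \<circ> inv_into U \<phi>) (\<phi> ` N)"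
  shows "smooth_in N f"
proof (rule smooth_inI)
  fix V \<psi> k assume d: "(V, \<psi>) \<in> A"
  have oS: "open (\<psi> ` (V \<inter> N))" by (rule chart(6)[OF d N(1)])
  have "Ck_on k (\<phi> \<circ> inv_into V \<psi>) (\<psi> ` (V \<inter> U))"
    using transition[OF d c] by (simp add: smooth_on_def)
  then have g: "Ck_on k (\<lambda>x. \<phi> (inv_into V \<psi> x)) (\<psi> ` (V \<inter> N))"
    unfolding o_def by (rule Ck_on_subset) (use N in auto)
  have oT: "open (\<phi> ` N)" using chart(6)[OF c N(1)] N(2) by (simp add: Int_absorb1)
  have im: "(\<lambda>x. \<phi> (inv_into V \<psi> x)) ` (\<psi> ` (V \<inter> N)) \<subseteq> \<phi> ` N"
    by (auto simp: chart(5)[OF d])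
  have "Ck_on k (\<lambda>x. (f \<circ> inv_into U \<phi>) (\<phi> (inv_into V \<psi> x))) (\<psi> ` (V \<inter> N))"
    by (rule Ck_on_compose[OF oS oT im f g])
  then show "Ck_on k (f \<circ> inv_into V \<psi>) (\<psi> ` (V \<inter> N))"
  proof (rule Ck_on_cong[OF _ oS])
    fix x assume "x \<in> \<psi> ` (V \<inter> N)"
    then obtain q where q: "q \<in> V" "q \<in> N" "x = \<psi> q" by auto
    then have "q \<in> U" using N(2) by auto
    then show "(f \<circ> inv_into U \<phi>) (\<phi> (inv_into V \<psi> x)) = (f \<circ> inv_into V \<psi>) x"
      using q by (simp add: chart(5)[OF d] chart(5)[OF c])
  qed
qed

lemma smooth_in_local:
  assumes "\<And>p. p \<in> N \<Longrightarrow> \<exists>N'. open N' \<and> p \<in> N' \<and> smooth_in N' f"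
  shows "smooth_in N f"
proof (rule smooth_inI)
  fix U \<phi> k assume c: "(U, \<phi>) \<in> A"
  show "Ck_on k (f \<circ> inv_into U \<phi>) (\<phi> ` (U \<inter> N))"
  proof (rule Ck_on_local)
    fix x assume "x \<in> \<phi> ` (U \<inter> N)"
    then obtain q where q: "q \<in> U" "q \<in> N" "x = \<phi> q" by auto
    from assms[OF q(2)] obtain N' where N': "open N'" "q \<in> N'" "smooth_in N' f" by auto
    show "\<exists>T. open T \<and> x \<in> T \<and> Ck_on k (f \<circ> inv_into U \<phi>) T"
      by (rule exI[of _ "\<phi> ` (U \<inter> N')"])
        (use q N' chart(6)[OF c N'(1)] smooth_inD[OF N'(3) c] in auto)
  qed
qed

lemma C_local:
  assumes "\<And>p. \<exists>N. open N \<and> p \<in> N \<and> smooth_in N f"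
  shows "f \<in> C"
  unfolding C_iff by (rule smooth_in_local) (use assms in auto)

lemma smooth_in_const: "open N \<Longrightarrow> smooth_in N (\<lambda>_. c)"
  by (rule smooth_inI) (auto simp: o_def intro: Ck_on_const chart(6))

lemma smooth_in_add:
  assumes "open N" "smooth_in N f" "smooth_in N g" shows "smooth_in N (\<lambda>q. f q + g q)"
proof (rule smooth_inI)
  fix U \<phi> k assume c: "(U, \<phi>) \<in> A"
  from Ck_on_add[OF chart(6)[OF c assms(1)] smooth_inD[OF assms(2) c] smooth_inD[OF assms(3) c]]
  show "Ck_on k ((\<lambda>q. f q + g q) \<circ> inv_into U \<phi>) (\<phi> ` (U \<inter> N))" by (simp add: o_def)
qed

lemma smooth_in_mult:
  assumes "open N" "smooth_in N f" "smooth_in N g" shows "smooth_in N (\<lambda>q. f q * g q)"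
proof (rule smooth_inI)
  fix U \<phi> k assume c: "(U, \<phi>) \<in> A"
  from Ck_on_mult[OF chart(6)[OF c assms(1)] smooth_inD[OF assms(2) c] smooth_inD[OF assms(3) c]]
  show "Ck_on k ((\<lambda>q. f q * g q) \<circ> inv_into U \<phi>) (\<phi> ` (U \<inter> N))" by (simp add: o_def)
qed

lemma smooth_in_compose:
  assumes "open N" "smooth_in N f" "smooth_on h S" "open S" "\<And>q. q \<in> N \<Longrightarrow> f q \<in> S"
  shows "smooth_in N (\<lambda>q. h (f q))"
proof (rule smooth_inI)
  fix U \<phi> k assume c: "(U, \<phi>) \<in> A"
  have "Ck_on k (\<lambda>x. h ((f \<circ> inv_into U \<phi>) x)) (\<phi> ` (U \<inter> N))"
    by (rule Ck_on_compose[OF chart(6)[OF c assms(1)] assms(4) _ _ smooth_inD[OF assms(2) c]])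
      (use assms(3,5) in \<open>auto simp: smooth_on_def chart(5)[OF c]\<close>)
  then show "Ck_on k ((\<lambda>q. h (f q)) \<circ> inv_into U \<phi>) (\<phi> ` (U \<inter> N))" by (simp add: o_def)
qed

lemma smooth_in_divide:
  assumes "open N" "smooth_in N f" "smooth_in N g" "\<And>q. q \<in> N \<Longrightarrow> g q \<noteq> 0"
  shows "smooth_in N (\<lambda>q. f q / g q)"
  unfolding divide_inverse
  by (intro smooth_in_mult assms smooth_in_compose[where f=g, OF _ _ smooth_on_inverse]) (use assms(4) in auto)

lemma smooth_in_nonzero:
  assumes "open N" "smooth_in N f" "p \<in> N" "f p \<noteq> 0"
  obtains N' where "open N'" "p \<in> N'" "N' \<subseteq> N" "\<And>q. q \<in> N' \<Longrightarrow> f q \<noteq> 0"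
proof -
  obtain U \<phi> where c: "(U, \<phi>) \<in> A" "p \<in> U" by (rule chart_at)
  have "continuous_on (\<phi> ` (U \<inter> N)) (f \<circ> inv_into U \<phi>)"
    using smooth_inD[OF assms(2) c(1), of 0] by simp
  then have "continuous_on (U \<inter> N) (\<lambda>q. (f \<circ> inv_into U \<phi>) (\<phi> q))"
    by (rule continuous_on_compose2) (use chart(3)[OF c(1)] in \<open>auto intro: continuous_on_subset\<close>)
  then have cf: "continuous_on (U \<inter> N) f"
    by (rule continuous_on_eq) (simp add: chart(5)[OF c(1)])
  have o: "open (U \<inter> N)" using assms(1) chart(1)[OF c(1)] by auto
  show thesis
  proof (rule that)
    show "open ((U \<inter> N) \<inter> f -` (- {0}))"
      by (rule continuous_open_preimage[OF cf o]) auto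
  qed (use assms(3,4) c in auto)
qed

section \<open>The ring of global smooth functions and cut-off functions\<close>

lemma C_const: "(\<lambda>_. c) \<in> C" unfolding C_iff by (simp add: smooth_in_const)
lemma C_add: "f \<in> C \<Longrightarrow> g \<in> C \<Longrightarrow> (\<lambda>q. f q + g q) \<in> C"
  unfolding C_iff by (simp add: smooth_in_add)
lemma C_mult: "f \<in> C \<Longrightarrow> g \<in> C \<Longrightarrow> (\<lambda>q. f q * g q) \<in> C"
  unfolding C_iff by (simp add: smooth_in_mult)
lemma C_scale: "f \<in> C \<Longrightarrow> (\<lambda>q. c * f q) \<in> C"
  using C_mult[OF C_const] .
lemma C_lin: "f \<in> C \<Longrightarrow> g \<in> C \<Longrightarrow> (\<lambda>q. a * f q + b * g q) \<in> C"
  by (intro C_add C_mult C_const)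
lemma C_diff: "f \<in> C \<Longrightarrow> g \<in> C \<Longrightarrow> (\<lambda>q. f q - g q) \<in> C"
  using C_lin[of f g 1 "-1"] by simp
lemma C_sum: "(\<And>i. i \<in> I \<Longrightarrow> f i \<in> C) \<Longrightarrow> (\<lambda>q. \<Sum>i\<in>I. f i q) \<in> C"
  by (induction I rule: infinite_finite_induct) (auto intro: C_add C_const)
lemma C_prod: "(\<And>i. i \<in> I \<Longrightarrow> f i \<in> C) \<Longrightarrow> (\<lambda>q. \<Prod>i\<in>I. f i q) \<in> C"
  by (induction I rule: infinite_finite_induct) (auto intro: C_mult C_const)

text \<open>A smooth step applied to the squared distance from \<open>p\<close> in a chart.
  Extending it by 0 beyond the chart is smooth because \<open>K\<close>, the preimage of a closed
  ball, is compact and hence closed in the Hausdorff space.\<close>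

lemma bump:
  assumes "open W" "p \<in> W"
  obtains b N K where "b \<in> C" "open N" "p \<in> N" "N \<subseteq> W" "\<And>q. q \<in> N \<Longrightarrow> b q = 1"
    and "closed K" "K \<subseteq> W" "\<And>q. q \<notin> K \<Longrightarrow> b q = 0"
proof -
  obtain U \<phi> where c: "(U, \<phi>) \<in> A" "p \<in> U" by (rule chart_at)
  obtain s :: "real \<Rightarrow> real" where s: "smooth_on s UNIV" "\<And>t. t \<le> 1 \<Longrightarrow> s t = 1" "\<And>t. t \<ge> 2 \<Longrightarrow> s t = 0"
    using exists_smooth_step by blast
  obtain r where r: "r > 0" "cball (\<phi> p) r \<subseteq> \<phi> ` (U \<inter> W)"
    using chart(6)[OF c(1) assms(1)] assms(2) c(2) by (metis IntI image_eqI open_contains_cball)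
  \<comment> \<open>Scaled so that \<open>d\<close> reaches 2, where the step has dropped to 0, on
    the sphere of radius \<open>r\<close>.\<close>
  define d where "d q = 2 / r\<^sup>2 * ((\<phi> q - \<phi> p) \<bullet> (\<phi> q - \<phi> p))" for q
  define b where "b q = (if q \<in> U then s (d q) else 0)" for q
  define K where "K = inv_into U \<phi> ` cball (\<phi> p) r"
  have dr: "d q = 2 * (dist (\<phi> p) (\<phi> q) / r)\<^sup>2" for q
    by (simp add: d_def dist_norm norm_minus_commute power_divide dot_square_norm)
  have d2: "d q \<ge> 2" if "dist (\<phi> p) (\<phi> q) > r" for q
  proof -
    have "dist (\<phi> p) (\<phi> q) / r \<ge> 1" using that r(1) by simp
    then have "(dist (\<phi> p) (\<phi> q) / r)\<^sup>2 \<ge> 1" by (simp add: one_le_power)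
    then show ?thesis by (simp add: dr)
  qed
  have "compact K" unfolding K_def
    by (rule compact_continuous_image)
      (use r(2) in \<open>auto intro: continuous_on_subset[OF chart(4)[OF c(1)]]\<close>)
  then have K: "closed K" by (rule compact_imp_closed)
  have KW: "K \<subseteq> U \<inter> W"
  proof
    fix q assume "q \<in> K"
    then obtain y where "y \<in> cball (\<phi> p) r" "q = inv_into U \<phi> y" unfolding K_def by blast
    with r(2) have "y \<in> \<phi> ` (U \<inter> W)" "q = inv_into U \<phi> y" by blast+
    then show "q \<in> U \<inter> W" using chart(5)[OF c(1)] by auto
  qed
  have b0: "b q = 0" if "q \<notin> K" for q
  proof (cases "q \<in> U")
    case True
    have "\<phi> q \<notin> cball (\<phi> p) r"
    proof
      assume "\<phi> q \<in> cball (\<phi> p) r"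
      then have "inv_into U \<phi> (\<phi> q) \<in> K" unfolding K_def by (rule imageI)
      then show False using that chart(5)[OF c(1) True] by simp
    qed
    then show ?thesis using True s(3)[OF d2] by (simp add: b_def not_le)
  qed (simp add: b_def)
  have dC: "Ck_on k (\<lambda>y. 2 / r\<^sup>2 * ((y - \<phi> p) \<bullet> (y - \<phi> p))) (\<phi> ` U)" for k
  proof -
    have "Ck_on k (\<lambda>y. 2 / r\<^sup>2 * (\<Sum>i\<in>Basis. (y \<bullet> i + (- (\<phi> p \<bullet> i))) * (y \<bullet> i + (- (\<phi> p \<bullet> i))))) (\<phi> ` U)"
      by (intro Ck_on_mult Ck_on_sum Ck_on_add Ck_on_const chart(2)[OF c(1)]
          Ck_on_bounded_linear[OF bounded_linear_inner_left] Ck_on_ident)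
    moreover have "(\<lambda>y. 2 / r\<^sup>2 * (\<Sum>i\<in>Basis. (y \<bullet> i + (- (\<phi> p \<bullet> i))) * (y \<bullet> i + (- (\<phi> p \<bullet> i))))) =
        (\<lambda>y. 2 / r\<^sup>2 * ((y - \<phi> p) \<bullet> (y - \<phi> p)))"
      by (rule ext, subst euclidean_inner[of "_ - _"]) (simp add: inner_diff_left)
    ultimately show ?thesis by simp
  qed
  have dS: "smooth_in U d"
  proof (rule smooth_in_chart[OF c(1) chart(1)[OF c(1)] order_refl])
    show "Ck_on k (d \<circ> inv_into U \<phi>) (\<phi> ` U)" for k
      by (rule Ck_on_cong[OF dC chart(2)[OF c(1)]]) (auto simp: d_def chart(5)[OF c(1)])
  qed
  have bU: "smooth_in U b"
    by (rule smooth_in_cong[OF smooth_in_compose[OF chart(1)[OF c(1)] dS s(1)] chart(1)[OF c(1)]])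
      (auto simp: b_def)
  have oK: "open (- K)" using K by auto
  have bK: "smooth_in (- K) b"
    by (rule smooth_in_cong[OF smooth_in_const[OF oK, of 0] oK]) (simp add: b0)
  have bC: "b \<in> C"
  proof (rule C_local)
    fix q show "\<exists>N. open N \<and> q \<in> N \<and> smooth_in N b"
    proof (cases "q \<in> U")
      case True then show ?thesis using bU chart(1)[OF c(1)] by blast
    next
      case False then have "q \<in> - K" using KW by auto
      then show ?thesis using bK oK by blast
    qed
  qed
  have dc: "continuous_on U d" unfolding d_def by (intro continuous_intros chart(3)[OF c(1)])
  have oN: "open ((U \<inter> W) \<inter> d -` {..<1})"
    by (rule continuous_open_preimage[OF continuous_on_subset[OF dc]])
      (use assms(1) chart(1)[OF c(1)] in auto)
  show thesis
    by (rule that[OF bC oN _ _ _ K _ b0])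
      (use KW assms(2) c(2) s(2) in \<open>auto simp: b_def d_def\<close>)
qed

text \<open>Tangent vectors act on global functions, so a local function has to be replaced by a
  global one with the same germ at \<open>p\<close>.\<close>

lemma extend_smooth:
  assumes "open W" "p \<in> W" "smooth_in W f"
  obtains g N where "g \<in> C" "open N" "p \<in> N" "N \<subseteq> W" "\<And>q. q \<in> N \<Longrightarrow> g q = f q"
proof -
  obtain b N K where b: "b \<in> C" "open N" "p \<in> N" "N \<subseteq> W" "\<And>q. q \<in> N \<Longrightarrow> b q = 1"
      "closed K" "K \<subseteq> W" "\<And>q. q \<notin> K \<Longrightarrow> b q = 0"
    using bump[OF assms(1,2)] by blast
  have oK: "open (- K)" using b(6) by auto
  have "(\<lambda>q. b q * f q) \<in> C"
  proof (rule C_local)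
    fix q show "\<exists>N. open N \<and> q \<in> N \<and> smooth_in N (\<lambda>q. b q * f q)"
    proof (cases "q \<in> W")
      case True
      then show ?thesis
        using smooth_in_mult[OF assms(1) C_smooth_in[OF b(1)] assms(3)] assms(1) by blast
    next
      case False
      then have "q \<in> - K" using b(7) by auto
      moreover have "smooth_in (- K) (\<lambda>q. b q * f q)"
        by (rule smooth_in_cong[OF smooth_in_const[OF oK, of 0] oK]) (simp add: b(8))
      ultimately show ?thesis using oK by blast
    qed
  qed
  then show thesis by (rule that[OF _ b(2-4)]) (simp add: b(5))
qed

section \<open>Calculus of derivations at a point\<close>

lemma tangentD:
  assumes "v \<in> T p"
  shows "\<And>f g a b. f \<in> C \<Longrightarrow> g \<in> C \<Longrightarrow> v (\<lambda>t. a * f t + b * g t) = a * v f + b * v g"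
    and "\<And>f. f \<notin> C \<Longrightarrow> v f = 0"
    and "\<And>f g. f \<in> C \<Longrightarrow> g \<in> C \<Longrightarrow> v (\<lambda>t. f t * g t) = f p * v g + g p * v f"
  using assms unfolding tangent_space_def linear_dual_def by auto

lemma tangent_const: assumes "v \<in> T p" shows "v (\<lambda>_. c) = 0"
proof -
  have "v (\<lambda>_. 1) = 0"
    using tangentD(3)[OF assms C_const C_const, of 1 1] by simp
  then show ?thesis using tangentD(1)[OF assms C_const C_const, of c 1 0 1] by simp
qed

lemma tangent_add: "v \<in> T p \<Longrightarrow> f \<in> C \<Longrightarrow> g \<in> C \<Longrightarrow> v (\<lambda>t. f t + g t) = v f + v g"
  using tangentD(1)[of v p f g 1 1] by simp

lemma tangent_diff: "v \<in> T p \<Longrightarrow> f \<in> C \<Longrightarrow> g \<in> C \<Longrightarrow> v (\<lambda>t. f t - g t) = v f - v g"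
  using tangentD(1)[of v p f g 1 "-1"] by simp

lemma tangent_scale: "v \<in> T p \<Longrightarrow> f \<in> C \<Longrightarrow> v (\<lambda>t. c * f t) = c * v f"
  using tangentD(1)[of v p f f c 0] by simp

lemma tangent_sum:
  assumes "v \<in> T p" "\<And>i. i \<in> I \<Longrightarrow> f i \<in> C"
  shows "v (\<lambda>t. \<Sum>i\<in>I. f i t) = (\<Sum>i\<in>I. v (f i))"
  using assms(2)
  by (induction I rule: infinite_finite_induct)
    (simp_all add: tangent_const[OF assms(1)] tangent_add[OF assms(1)] C_sum)

text \<open>For a bump function \<open>b\<close> supported where \<open>f\<close> and
  \<open>g\<close> agree, \<open>b (f - g)\<close> is identically 0. Since \<open>b\<close> is 1 and
  \<open>f - g\<close> is 0 at \<open>p\<close>, the product rule leaves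
  \<open>v f - v g\<close>.\<close>

lemma tangent_local:
  assumes v: "v \<in> T p" and C: "f \<in> C" "g \<in> C" and N: "open N" "p \<in> N" "\<And>q. q \<in> N \<Longrightarrow> f q = g q"
  shows "v f = v g"
proof -
  obtain b N' K where b: "b \<in> C" "open N'" "p \<in> N'" "N' \<subseteq> N" "\<And>q. q \<in> N' \<Longrightarrow> b q = 1"
      "closed K" "K \<subseteq> N" "\<And>q. q \<notin> K \<Longrightarrow> b q = 0"
    using bump[OF N(1,2)] by blast
  have "b q * (f q - g q) = 0" for q using b(7,8) N(3) by (cases "q \<in> K") auto
  then have "(\<lambda>q. b q * (f q - g q)) = (\<lambda>_. 0)" by (rule ext)
  then have "v (\<lambda>q. b q * (f q - g q)) = 0" using tangent_const[OF v, of 0] by simp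
  then have "b p * (v f - v g) + (f p - g p) * v b = 0"
    using tangentD(3)[OF v b(1) C_diff[OF C]] tangent_diff[OF v C] by simp
  then show ?thesis using b(3,5) N(2,3) by simp
qed

text \<open>The axioms of a derivation contain a product rule but no chain rule. Hadamard's
  factorisation reduces the one to the other: \<open>exp y - exp (f p)\<close> is
  \<open>y - f p\<close> times a smooth factor whose value at \<open>f p\<close> is the
  derivative.\<close>

lemma tangent_exp:
  assumes v: "v \<in> T p" and f: "f \<in> C"
  shows "v (\<lambda>q. exp (f q)) = exp (f p) * v f" "(\<lambda>q. exp (f q)) \<in> C"
proof -
  obtain G where G: "\<And>b. smooth_on (G b) (UNIV::real set)"
    "\<And>y. exp y = exp (f p) + (\<Sum>b\<in>Basis. ((y - f p) \<bullet> b) * G b y)"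
    "\<And>b. G b (f p) = frechet_derivative exp (at (f p)) b"
    using hadamard[OF open_UNIV convex_UNIV UNIV_I smooth_on_exp, of "f p"] by auto
  have C: "(\<lambda>q. h (f q)) \<in> C" if "smooth_on h UNIV" for h
    using smooth_in_compose[OF open_UNIV _ that] f unfolding C_iff by simp
  show "(\<lambda>q. exp (f q)) \<in> C" by (rule C[OF smooth_on_exp])
  have D: "frechet_derivative exp (at (f p)) = (\<lambda>h. exp (f p) * h)"
    using frechet_derivative_at[of exp "\<lambda>h. exp (f p) * h" "f p"] DERIV_exp[of "f p"]
    by (simp add: has_field_derivative_def)
  have "(\<lambda>q. exp (f q)) = (\<lambda>q. exp (f p) + (f q - f p) * G 1 (f q))"
    by (rule ext, subst G(2)) simp
  then have "v (\<lambda>q. exp (f q)) = v (\<lambda>q. (f q - f p) * G 1 (f q))"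
    using tangent_add[OF v C_const C_mult[OF C_diff[OF f C_const] C[OF G(1)]]] tangent_const[OF v]
    by simp
  also have "\<dots> = G 1 (f p) * v f"
    using tangentD(3)[OF v C_diff[OF f C_const] C[OF G(1)]] tangent_diff[OF v f C_const] tangent_const[OF v]
    by simp
  finally show "v (\<lambda>q. exp (f q)) = exp (f p) * v f" by (simp add: G(3) D)
qed

section \<open>Coordinate functions and coordinate fields\<close>

lemma Basis_vec_real: "(Basis :: (real^'m) set) = (\<lambda>i. axis i 1) ` UNIV"
  by (auto simp: Basis_vec_def)

text \<open>Coordinates and partial derivatives become global by multiplication with a bump
  function, which changes nothing on \<open>N\<close>. The expansion of an arbitrary derivation
  rests on Hadamard's factorisation of \<open>f\<close> around each \<open>q\<close>.\<close>

lemma coordinate_frame: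
  obtains x :: "'m \<Rightarrow> 'a \<Rightarrow> real" and E :: "'m \<Rightarrow> 'a vfield" and N where
    "open N" "p \<in> N" "\<And>i. x i \<in> C" "\<And>i. E i \<in> vector_fields A"
    "\<And>i j q. q \<in> N \<Longrightarrow> E i q (x j) = (if i = j then 1 else 0)"
    "\<And>q v f. q \<in> N \<Longrightarrow> v \<in> T q \<Longrightarrow> f \<in> C \<Longrightarrow> v f = (\<Sum>i\<in>UNIV. v (x i) * E i q f)"
proof -
  obtain U \<phi> where c: "(U, \<phi>) \<in> A" "p \<in> U" by (rule chart_at)
  note oU = chart(1)[OF c(1)] and oP = chart(2)[OF c(1)] and inv = chart(5)[OF c(1)]
  define pd where "pd f i q = frechet_derivative (f \<circ> inv_into U \<phi>) (at (\<phi> q)) (axis i 1)"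
    for f :: "'a \<Rightarrow> real" and i q
  have D: "((f \<circ> inv_into U \<phi>) has_derivative frechet_derivative (f \<circ> inv_into U \<phi>) (at (\<phi> q))) (at (\<phi> q))"
    if "f \<in> C" "q \<in> U" for f q
    using Ck_on_SucD[of 0 "f \<circ> inv_into U \<phi>" "\<phi> ` U" "\<phi> q"] smooth_inD[of UNIV f U \<phi> "Suc 0"] that c(1)
    by (simp add: C_iff)
  have pd_eq: "pd f i q = f' (axis i 1)"
    if "((f \<circ> inv_into U \<phi>) has_derivative f') (at (\<phi> q))" for f i q f'
    unfolding pd_def using frechet_derivative_at[OF that] by simp
  have pd_lin: "pd (\<lambda>t. a * f t + b * g t) i q = a * pd f i q + b * pd g i q"
    if "f \<in> C" "g \<in> C" "q \<in> U" for f g a b i q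
    by (subst pd_eq[where f'="\<lambda>h. a * frechet_derivative (f \<circ> inv_into U \<phi>) (at (\<phi> q)) h
          + b * frechet_derivative (g \<circ> inv_into U \<phi>) (at (\<phi> q)) h"])
      (use has_derivative_add[OF has_derivative_mult_right[OF D[OF that(1,3)], of a]
          has_derivative_mult_right[OF D[OF that(2,3)], of b]] in \<open>simp_all add: o_def pd_def\<close>)
  have pd_mult: "pd (\<lambda>t. f t * g t) i q = f q * pd g i q + g q * pd f i q"
    if "f \<in> C" "g \<in> C" "q \<in> U" for f g i q
    by (subst pd_eq[where f'="\<lambda>h. f q * frechet_derivative (g \<circ> inv_into U \<phi>) (at (\<phi> q)) h
          + frechet_derivative (f \<circ> inv_into U \<phi>) (at (\<phi> q)) h * g q"])
      (use has_derivative_mult[OF D[OF that(1,3)] D[OF that(2,3)]] inv[OF that(3)] in \<open>simp_all add: o_def pd_def\<close>)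
  have pd_smooth: "smooth_in U (pd f i)" if "f \<in> C" for f i
  proof (rule smooth_in_chart[OF c(1) oU order_refl])
    fix k
    have "Ck_on k (\<lambda>y. frechet_derivative (f \<circ> inv_into U \<phi>) (at y) (axis i 1)) (\<phi> ` U)"
      using smooth_inD[of UNIV f U \<phi> "Suc k"] that c(1) by (simp add: C_iff)
    then show "Ck_on k (pd f i \<circ> inv_into U \<phi>) (\<phi> ` U)"
      by (rule Ck_on_cong[OF _ oP]) (auto simp: pd_def inv)
  qed
  have coord: "smooth_in U (\<lambda>q. \<phi> q $ i)" for i
  proof (rule smooth_in_chart[OF c(1) oU order_refl])
    fix k
    have "Ck_on k (\<lambda>y::real^'m. y $ i) (\<phi> ` U)"
      by (rule Ck_on_bounded_linear[OF bounded_linear_vec_nth oP Ck_on_ident[OF oP]])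
    then show "Ck_on k ((\<lambda>q. \<phi> q $ i) \<circ> inv_into U \<phi>) (\<phi> ` U)"
      by (rule Ck_on_cong[OF _ oP]) (auto simp: inv)
  qed
  obtain b N K where b: "b \<in> C" "open N" "p \<in> N" "N \<subseteq> U" "\<And>q. q \<in> N \<Longrightarrow> b q = 1"
      "closed K" "K \<subseteq> U" "\<And>q. q \<notin> K \<Longrightarrow> b q = 0"
    using bump[OF oU c(2)] by blast
  \<comment> \<open>Outside \<open>K\<close> the bump function is 0, so the product extends smoothly
    even though \<open>h\<close> is only known to be smooth on \<open>U\<close>.\<close>
  have cut: "(\<lambda>q. if q \<in> U then b q * h q else 0) \<in> C" if h: "smooth_in U h" for h
  proof (rule C_local)
    fix q
    show "\<exists>N. open N \<and> q \<in> N \<and> smooth_in N (\<lambda>q. if q \<in> U then b q * h q else 0)"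
    proof (cases "q \<in> U")
      case True
      have "smooth_in U (\<lambda>q. if q \<in> U then b q * h q else 0)"
        by (rule smooth_in_cong[OF smooth_in_mult[OF oU C_smooth_in[OF b(1)] h] oU]) auto
      then show ?thesis using True oU by blast
    next
      case False
      have oK: "open (- K)" using b(6) by auto
      have "smooth_in (- K) (\<lambda>q. if q \<in> U then b q * h q else 0)"
        by (rule smooth_in_cong[OF smooth_in_const[OF oK, of 0] oK]) (simp add: b(8))
      then show ?thesis using False b(7) oK by blast
    qed
  qed
  define x where "x i = (\<lambda>q. if q \<in> U then b q * \<phi> q $ i else 0)" for i
  define E where "E i q f = (if f \<in> C then if q \<in> U then b q * pd f i q else 0 else 0)" for i q f
  have xN: "x i q = \<phi> q $ i" if "q \<in> N" for i q using that b(4,5) by (auto simp: x_def)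
  have xC: "x i \<in> C" for i unfolding x_def by (rule cut[OF coord])
  have EC: "E i \<in> vector_fields A" for i
  proof -
    have "(\<lambda>q. E i q f) \<in> C" if "f \<in> C" for f using cut[OF pd_smooth[OF that]] that by (simp add: E_def)
    moreover have "E i q \<in> T q" for q
      unfolding tangent_space_def linear_dual_def
      by (auto simp: E_def C_lin C_mult pd_lin pd_mult algebra_simps)
    ultimately show ?thesis by (auto simp: vector_fields_def)
  qed
  have ET: "E i q \<in> T q" for i q using EC by (auto simp: vector_fields_def)
  have oPN: "open (\<phi> ` N)" using chart(6)[OF c(1) b(2)] b(4) by (simp add: Int_absorb1)
  show thesis
  proof (rule that[of N x E, OF b(2,3) xC EC])
    fix i j q assume q: "q \<in> N"
    then have qU: "q \<in> U" using b(4) by auto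
    have "((\<lambda>y::real^'m. y $ j) has_derivative (\<lambda>h. h $ j)) (at (\<phi> q))"
      by (rule bounded_linear_imp_has_derivative[OF bounded_linear_vec_nth])
    then have "((x j \<circ> inv_into U \<phi>) has_derivative (\<lambda>h. h $ j)) (at (\<phi> q))"
      by (rule has_derivative_transform_within_open[OF _ oPN]) (use q xN inv b(4) in auto)
    then have "pd (x j) i q = axis i 1 $ j" by (rule pd_eq)
    then show "E i q (x j) = (if i = j then 1 else 0)"
      using q qU xC b(5) by (simp add: E_def axis_def)
  next
    fix q v f assume q: "q \<in> N" and v: "v \<in> T q" and f: "f \<in> C"
    have qU: "q \<in> U" using q b(4) by auto
    \<comment> \<open>Hadamard's factorisation needs a convex domain, which the chart image need not
      be.\<close>
    obtain r where r: "r > 0" "ball (\<phi> q) r \<subseteq> \<phi> ` N"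
      using oPN q by (meson imageI open_contains_ball)
    define B where "B = ball (\<phi> q) r"
    have "B \<subseteq> \<phi> ` U" using r(2) b(4) unfolding B_def by blast
    then have fB: "smooth_on (f \<circ> inv_into U \<phi>) B"
      unfolding smooth_on_def
      using smooth_inD[of UNIV f U \<phi>] f c(1) by (auto simp: C_iff intro: Ck_on_subset)
    obtain G where G: "\<And>b. smooth_on (G b) B"
      "\<And>y. y \<in> B \<Longrightarrow> (f \<circ> inv_into U \<phi>) y = (f \<circ> inv_into U \<phi>) (\<phi> q) + (\<Sum>b\<in>Basis. ((y - \<phi> q) \<bullet> b) * G b y)"
      "\<And>b. G b (\<phi> q) = frechet_derivative (f \<circ> inv_into U \<phi>) (at (\<phi> q)) b"
      using hadamard[OF _ _ _ fB, of "\<phi> q"] r(1) unfolding B_def by auto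
    define W where "W = N \<inter> \<phi> -` B"
    have oW: "open W" unfolding W_def B_def
      by (rule continuous_open_preimage[OF continuous_on_subset[OF chart(3)[OF c(1)] b(4)] b(2)]) simp
    have qW: "q \<in> W" using q r(1) by (simp add: W_def B_def)
    have WU: "W \<subseteq> U" using b(4) by (auto simp: W_def)
    have "smooth_in W (\<lambda>t. G (axis i 1) (\<phi> t))" for i
    proof (rule smooth_in_chart[OF c(1) oW WU])
      fix k
      have oPW: "open (\<phi> ` W)" using chart(6)[OF c(1) oW] WU by (simp add: Int_absorb1)
      have "Ck_on k (G (axis i 1)) (\<phi> ` W)"
        using G(1)[of "axis i 1"] unfolding smooth_on_def by (auto intro: Ck_on_subset simp: W_def)
      then show "Ck_on k ((\<lambda>t. G (axis i 1) (\<phi> t)) \<circ> inv_into U \<phi>) (\<phi> ` W)"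
        by (rule Ck_on_cong[OF _ oPW]) (use WU inv in auto)
    qed
    \<comment> \<open>The Hadamard coefficients live near \<open>q\<close> only; global functions
      with the same germs take their place, so that \<open>v\<close> can be applied.\<close>
    then have "\<forall>i. \<exists>g N'. g \<in> C \<and> open N' \<and> q \<in> N' \<and> N' \<subseteq> W \<and> (\<forall>t\<in>N'. g t = G (axis i 1) (\<phi> t))"
      using extend_smooth[OF oW qW] by metis
    then obtain g N' where g: "\<And>i. g i \<in> C" "\<And>i. open (N' i)" "\<And>i. q \<in> N' i" "\<And>i. N' i \<subseteq> W"
      "\<And>i t. t \<in> N' i \<Longrightarrow> g i t = G (axis i 1) (\<phi> t)" by metis
    define M where "M = (\<Inter>i. N' i)"
    have M: "open M" "q \<in> M" "\<And>i t. t \<in> M \<Longrightarrow> g i t = G (axis i 1) (\<phi> t)"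
      using g by (auto simp: M_def)
    \<comment> \<open>Any index would do; the index type is nonempty.\<close>
    have MW: "M \<subseteq> W" using g(4)[of undefined] unfolding M_def by blast
    define F where "F t = f q + (\<Sum>i\<in>UNIV. (x i t - x i q) * g i t)" for t
    have FC: "F \<in> C" unfolding F_def by (intro C_add C_const C_sum C_mult C_diff xC g)
    have "f t = F t" if t: "t \<in> M" for t
    proof -
      have tW: "t \<in> N" "\<phi> t \<in> B" "t \<in> U" using MW t WU by (auto simp: W_def)
      have inj: "inj (\<lambda>i. axis i (1::real) :: real^'m)" by (auto simp: inj_on_def axis_eq_axis)
      have "f t = f q + (\<Sum>b\<in>Basis. ((\<phi> t - \<phi> q) \<bullet> b) * G b (\<phi> t))"
        using G(2)[OF tW(2)] by (simp add: inv tW qU)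
      also have "\<dots> = F t"
        unfolding Basis_vec_real sum.reindex[OF inj] F_def
        by (simp add: inner_axis M(3)[OF t] xN tW(1) q)
      finally show ?thesis .
    qed
    then have "v f = v F" by (rule tangent_local[OF v f FC M(1,2)])
    also have "\<dots> = (\<Sum>i\<in>UNIV. v (\<lambda>t. (x i t - x i q) * g i t))"
      unfolding F_def
      by (simp add: tangent_add[OF v] tangent_const[OF v] tangent_sum[OF v] C_const C_sum C_mult C_diff xC g(1))
    also have "\<dots> = (\<Sum>i\<in>UNIV. v (x i) * E i q f)"
    proof (rule sum.cong[OF refl])
      fix i
      \<comment> \<open>The first factor vanishes at \<open>q\<close>, so the product rule retains
        only the value of \<open>g i\<close> there, which is a partial derivative of
        \<open>f\<close>.\<close>
      have "v (\<lambda>t. (x i t - x i q) * g i t) = g i q * v (x i)"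
        using tangentD(3)[OF v C_diff[OF xC C_const] g(1)] tangent_diff[OF v xC C_const] tangent_const[OF v]
        by simp
      then show "v (\<lambda>t. (x i t - x i q) * g i t) = v (x i) * E i q f"
        using M(2,3) G(3) f qU b(5)[OF q] by (simp add: E_def pd_def)
    qed
    finally show "v f = (\<Sum>i\<in>UNIV. v (x i) * E i q f)" .
  qed
qed

end

section \<open>Alternating maps and contraction\<close>

definition fun_subspace :: "('x \<Rightarrow> real) set \<Rightarrow> bool" where
  "fun_subspace V \<longleftrightarrow> (\<lambda>_. 0) \<in> V \<and> (\<forall>u\<in>V. \<forall>v\<in>V. \<forall>a b. (\<lambda>t. a * u t + b * v t) \<in> V)"

text \<open>The conditions of \<open>alternating_maps\<close> without the convention of vanishing
  outside the domain, so that partially evaluated maps and restrictions to a subspace qualify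
  too.\<close>

definition alternating_on :: "('x \<Rightarrow> real) set \<Rightarrow> nat \<Rightarrow> (('x \<Rightarrow> real) list \<Rightarrow> real) \<Rightarrow> bool" where
  "alternating_on V k P \<longleftrightarrow>
     (\<forall>vs i. \<forall>u\<in>V. \<forall>v\<in>V. \<forall>a b. length vs = k \<and> set vs \<subseteq> V \<and> i < k \<longrightarrow>
        P (vs[i := (\<lambda>t. a * u t + b * v t)]) = a * P (vs[i := u]) + b * P (vs[i := v])) \<and>
     (\<forall>vs i j. length vs = k \<and> set vs \<subseteq> V \<and> i < j \<and> j < k \<and> vs ! i = vs ! j \<longrightarrow> P vs = 0)"

lemma alternating_maps_iff:
  "P \<in> alternating_maps V k \<longleftrightarrow>
     alternating_on V k P \<and> (\<forall>vs. \<not> (length vs = k \<and> set vs \<subseteq> V) \<longrightarrow> P vs = 0)"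
  unfolding alternating_maps_def alternating_on_def by (simp only: mem_Collect_eq conj_ac)

lemma fun_subspaceD:
  assumes "fun_subspace V"
  shows "(\<lambda>_. 0) \<in> V" "u \<in> V \<Longrightarrow> v \<in> V \<Longrightarrow> (\<lambda>t. a * u t + b * v t) \<in> V"
    "u \<in> V \<Longrightarrow> v \<in> V \<Longrightarrow> (\<lambda>t. u t + v t) \<in> V" "u \<in> V \<Longrightarrow> (\<lambda>t. a * u t) \<in> V"
proof -
  show 1: "(\<lambda>_. 0) \<in> V" and 2: "u \<in> V \<Longrightarrow> v \<in> V \<Longrightarrow> (\<lambda>t. a * u t + b * v t) \<in> V" for a b u v
    using assms by (auto simp: fun_subspace_def)
  show "u \<in> V \<Longrightarrow> v \<in> V \<Longrightarrow> (\<lambda>t. u t + v t) \<in> V" using 2[of u v 1 1] by simp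
  show "u \<in> V \<Longrightarrow> (\<lambda>t. a * u t) \<in> V" using 2[of u u a 0] by simp
qed

lemma fun_subspace_sum:
  assumes "fun_subspace V" "\<And>i. i \<in> I \<Longrightarrow> u i \<in> V"
  shows "(\<lambda>t. \<Sum>i\<in>I. c i * u i t) \<in> V"
  using assms(2)
proof (induction I rule: infinite_finite_induct)
  case (insert i I)
  then show ?case
    using fun_subspaceD(2)[OF assms(1), of "u i" "\<lambda>t. \<Sum>i\<in>I. c i * u i t" "c i" 1] by simp
qed (simp_all add: fun_subspaceD(1)[OF assms(1)])

lemma fun_subspace_linear_dual: "fun_subspace (linear_dual V)"
  unfolding fun_subspace_def linear_dual_def by (auto simp: algebra_simps)

lemma linear_dualD:
  assumes "\<alpha> \<in> linear_dual V"
  shows "u \<in> V \<Longrightarrow> v \<in> V \<Longrightarrow> \<alpha> (\<lambda>t. a * u t + b * v t) = a * \<alpha> u + b * \<alpha> v"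
    "u \<notin> V \<Longrightarrow> \<alpha> u = 0"
  using assms by (auto simp: linear_dual_def)

lemma linear_dual_sum:
  assumes "\<alpha> \<in> linear_dual V" "fun_subspace V" "\<And>i. i \<in> I \<Longrightarrow> u i \<in> V"
  shows "\<alpha> (\<lambda>t. \<Sum>i\<in>I. c i * u i t) = (\<Sum>i\<in>I. c i * \<alpha> (u i))"
proof -
  have 0: "\<alpha> (\<lambda>_. 0) = 0"
    using linear_dualD(1)[OF assms(1) fun_subspaceD(1)[OF assms(2)] fun_subspaceD(1)[OF assms(2)], of 0 0] by simp
  show ?thesis using assms(3)
  proof (induction I rule: infinite_finite_induct)
    case (insert i I)
    then have "(\<lambda>t. \<Sum>i\<in>I. c i * u i t) \<in> V" by (intro fun_subspace_sum assms(2)) auto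
    then show ?case
      using linear_dualD(1)[OF assms(1), of "u i" "\<lambda>t. \<Sum>i\<in>I. c i * u i t" "c i" 1] insert by simp
  qed (simp_all add: 0)
qed

lemma alternating_on_lin:
  assumes "alternating_on V k P" "length vs = k" "set vs \<subseteq> V" "i < k" "u \<in> V" "v \<in> V"
  shows "P (vs[i := (\<lambda>t. a * u t + b * v t)]) = a * P (vs[i := u]) + b * P (vs[i := v])"
  using assms unfolding alternating_on_def by blast

lemma alternating_on_eq:
  assumes "alternating_on V k P" "length vs = k" "set vs \<subseteq> V" "i < k" "j < k" "i \<noteq> j" "vs ! i = vs ! j"
  shows "P vs = 0"
proof -
  have 1: "P vs = 0" if "i < j" "j < k" "vs ! i = vs ! j" for i j
    using assms(1) that assms(2,3) unfolding alternating_on_def by blast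
  show ?thesis
  proof (cases "i < j")
    case True
    then show ?thesis using 1 assms(5,7) by blast
  next
    case False
    then have "j < i" using assms(6) by simp
    then show ?thesis using 1[OF _ assms(4)] assms(7) by simp
  qed
qed

lemma alternating_onI:
  assumes "\<And>vs i u v a b. length vs = k \<Longrightarrow> set vs \<subseteq> V \<Longrightarrow> i < k \<Longrightarrow> u \<in> V \<Longrightarrow> v \<in> V \<Longrightarrow>
      P (vs[i := (\<lambda>t. a * u t + b * v t)]) = a * P (vs[i := u]) + b * P (vs[i := v])"
    and "\<And>vs i j. length vs = k \<Longrightarrow> set vs \<subseteq> V \<Longrightarrow> i < j \<Longrightarrow> j < k \<Longrightarrow> vs ! i = vs ! j \<Longrightarrow> P vs = 0"
  shows "alternating_on V k P"
  unfolding alternating_on_def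
  by (intro conjI allI ballI impI; elim conjE) (rule assms; assumption)+

lemma alternating_on_subset:
  assumes "alternating_on V k P" "W \<subseteq> V"
  shows "alternating_on W k P"
proof (rule alternating_onI)
  fix vs i u v a b assume "length vs = k" "set vs \<subseteq> W" "i < k" "u \<in> W" "v \<in> W"
  then show "P (vs[i := (\<lambda>t. a * u t + b * v t)]) = a * P (vs[i := u]) + b * P (vs[i := v])"
    using assms(2) by (intro alternating_on_lin[OF assms(1)]) auto
next
  fix vs i j assume "length vs = k" "set vs \<subseteq> W" "i < j" "j < k" "vs ! i = vs ! j"
  then show "P vs = 0"
    using assms(2) by (intro alternating_on_eq[OF assms(1), of vs i j]) auto
qed

lemma set_list_update_subset: "set vs \<subseteq> V \<Longrightarrow> u \<in> V \<Longrightarrow> set (vs[i := u]) \<subseteq> V"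
  using set_update_subset_insert[of vs i u] by blast

lemma alternating_on_sum:
  assumes "alternating_on V k P" "fun_subspace V" "length vs = k" "set vs \<subseteq> V" "i < k"
    and "\<And>l. l \<in> L \<Longrightarrow> u l \<in> V"
  shows "P (vs[i := (\<lambda>t. \<Sum>l\<in>L. c l * u l t)]) = (\<Sum>l\<in>L. c l * P (vs[i := u l]))"
proof -
  have 0: "P (vs[i := (\<lambda>_. 0)]) = 0"
    using alternating_on_lin[OF assms(1,3,4,5) fun_subspaceD(1)[OF assms(2)] fun_subspaceD(1)[OF assms(2)], of 0 0]
    by simp
  show ?thesis using assms(6)
  proof (induction L rule: infinite_finite_induct)
    case (insert l L)
    then have "(\<lambda>t. \<Sum>l\<in>L. c l * u l t) \<in> V" by (intro fun_subspace_sum assms(2)) auto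
    then show ?case
      using alternating_on_lin[OF assms(1,3,4,5), of "u l" "\<lambda>t. \<Sum>l\<in>L. c l * u l t" "c l" 1] insert
      by simp
  qed (simp_all add: 0)
qed

lemma alternating_on_add:
  assumes "alternating_on V k P" "length vs = k" "set vs \<subseteq> V" "i < k" "u \<in> V" "v \<in> V"
  shows "P (vs[i := (\<lambda>t. u t + v t)]) = P (vs[i := u]) + P (vs[i := v])"
  using alternating_on_lin[OF assms, of 1 1] by simp

lemma alternating_on_swap:
  assumes P: "alternating_on V k P" and V: "fun_subspace V" and vs: "length vs = k" "set vs \<subseteq> V"
    and ij: "i < k" "j < k" "i \<noteq> j" and uv: "u \<in> V" "v \<in> V"
  shows "P (vs[i := u, j := v]) = - P (vs[i := v, j := u])"
proof -
  let ?w = "\<lambda>t. u t + v t"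
  have w: "?w \<in> V" by (rule fun_subspaceD(3)[OF V uv])
  have eq: "P (vs[i := a, j := a]) = 0" if "a \<in> V" for a
    by (rule alternating_on_eq[OF P _ set_list_update_subset[OF set_list_update_subset] ij])
      (use vs ij that in auto)
  have "P (vs[i := ?w, j := ?w]) = P (vs[i := ?w, j := u]) + P (vs[i := ?w, j := v])"
    by (rule alternating_on_add[OF P _ set_list_update_subset]) (use vs ij uv w in auto)
  moreover have "P (vs[j := u, i := ?w]) = P (vs[j := u, i := u]) + P (vs[j := u, i := v])"
    by (rule alternating_on_add[OF P _ set_list_update_subset]) (use vs ij uv w in auto)
  moreover have "P (vs[j := v, i := ?w]) = P (vs[j := v, i := u]) + P (vs[j := v, i := v])"
    by (rule alternating_on_add[OF P _ set_list_update_subset]) (use vs ij uv w in auto)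
  moreover have "vs[j := y, i := x] = vs[i := x, j := y]" for x y
    by (rule list_update_swap) (use ij in auto)
  ultimately show ?thesis using eq[OF w] eq[OF uv(1)] eq[OF uv(2)] by (simp only:)
qed

text \<open>Only vanishing is transported, which avoids tracking the sign of the permutation and is
  enough for moving entries around in proofs that a value is 0.\<close>

lemma alternating_on_permute_list:
  assumes P: "alternating_on V k P" and V: "fun_subspace V" and p: "p permutes {..<k}"
    and "length vs = k" "set vs \<subseteq> V"
  shows "P (permute_list p vs) = 0 \<longleftrightarrow> P vs = 0"
  using p finite_lessThan assms(4,5)
proof (induction arbitrary: vs rule: permutes_induct)
  case id
  then show ?case by simp
next
  case (swap a b p)
  let ?ws = "permute_list (Transposition.transpose a b) vs"
  have t: "Transposition.transpose a b permutes {..<length vs}"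
    using swap.hyps swap.prems by (intro permutes_swap_id) auto
  have ws: "?ws = vs[a := vs ! b, b := vs ! a]"
    using swap.hyps swap.prems(1)
    by (auto intro!: nth_equalityI simp: permute_list_nth[OF t] Transposition.transpose_def nth_list_update)
  have "P ?ws = - P (vs[a := vs ! a, b := vs ! b])"
    unfolding ws using swap.hyps swap.prems by (intro alternating_on_swap[OF P V]) auto
  then have "P ?ws = - P vs" by simp
  moreover have "P (permute_list p ?ws) = 0 \<longleftrightarrow> P ?ws = 0"
    using swap.prems by (intro swap.IH) (auto simp: set_permute_list[OF t])
  moreover have "permute_list (Transposition.transpose a b \<circ> p) vs = permute_list p ?ws"
    using swap.hyps swap.prems by (intro permute_list_compose) auto
  ultimately show ?case by (simp add: o_def)
qed

text \<open>Lets entries be brought to prescribed positions without naming a permutation.\<close>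

lemma alternating_on_mset:
  assumes "alternating_on V k P" "fun_subspace V" "mset xs = mset ys" "length ys = k" "set ys \<subseteq> V" "P ys = 0"
  shows "P xs = 0"
proof -
  obtain p where "p permutes {..<length ys}" "permute_list p ys = xs"
    using mset_eq_permutation[OF assms(3)] .
  then show ?thesis using alternating_on_permute_list[OF assms(1,2), of p ys] assms by auto
qed

section \<open>Vanishing of alternating maps tested on a spanning family\<close>

lemma alternating_on_sorted:
  fixes e :: "nat \<Rightarrow> 'x \<Rightarrow> real"
  assumes P: "alternating_on V k P" and V: "fun_subspace V" and e: "\<And>i. i < r \<Longrightarrow> e i \<in> V"
    and Z: "\<And>I. length I = k \<Longrightarrow> sorted_wrt (<) I \<Longrightarrow> set I \<subseteq> {..<r} \<Longrightarrow> P (map e I) = 0"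
    and I: "length I = k" "set I \<subseteq> {..<r}"
  shows "P (map e I) = 0"
proof (cases "distinct I")
  case True
  have "P (map e (sort I)) = 0"
    using True I by (intro Z) (auto simp: strict_sorted_iff)
  then show ?thesis
    by (rule alternating_on_mset[OF P V, rotated 3]) (use I e in auto)
next
  case False
  then obtain i j where "i < length I" "j < length I" "i \<noteq> j" "I ! i = I ! j"
    by (auto simp: distinct_conv_nth)
  then show ?thesis
    using I e by (intro alternating_on_eq[OF P, of _ i j]) (auto simp: subset_iff)
qed

text \<open>Multilinear expansion modulo a set \<open>Z\<close> of vectors that kill
  \<open>P\<close> in any position. \<open>Z\<close> is \<open>{0}\<close> for a family that spans
  outright; otherwise it is the part that the family misses, such as an annihilator or the span of
  directions already known to kill \<open>P\<close>.\<close>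

lemma alternating_on_eq_zeroI:
  fixes e :: "nat \<Rightarrow> 'x \<Rightarrow> real"
  assumes P: "alternating_on V k P" and V: "fun_subspace V" and e: "\<And>i. i < r \<Longrightarrow> e i \<in> V"
    and rep: "\<And>v. v \<in> V \<Longrightarrow> \<exists>c z. z \<in> Z \<and> v = (\<lambda>t. (\<Sum>i<r. c i * e i t) + z t)"
    and ZV: "Z \<subseteq> V"
    and PZ: "\<And>vs i. length vs = k \<Longrightarrow> set vs \<subseteq> V \<Longrightarrow> i < k \<Longrightarrow> vs ! i \<in> Z \<Longrightarrow> P vs = 0"
    and PI: "\<And>I. length I = k \<Longrightarrow> sorted_wrt (<) I \<Longrightarrow> set I \<subseteq> {..<r} \<Longrightarrow> P (map e I) = 0"
    and vs: "length vs = k" "set vs \<subseteq> V"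
  shows "P vs = 0"
proof -
  \<comment> \<open>\<open>j\<close> counts the leading entries that are still arbitrary; from
    position \<open>j\<close> on all entries are members of the family.\<close>
  have "P vs = 0" if "j \<le> k" "length vs = k" "set vs \<subseteq> V" "\<And>i. j \<le> i \<Longrightarrow> i < k \<Longrightarrow> vs ! i \<in> e ` {..<r}" for j vs
    using that
  proof (induction j arbitrary: vs)
    case 0
    have "set vs \<subseteq> e ` {..<r}" using 0 by (auto simp: set_conv_nth)
    then have I: "vs = map e (map (inv_into {..<r} e) vs)" "set (map (inv_into {..<r} e) vs) \<subseteq> {..<r}"
      using inv_into_into[of _ e "{..<r}"] f_inv_into_f[of _ e "{..<r}"]
      by (auto simp: o_def subset_iff intro!: map_idI[symmetric])
    then show ?case using alternating_on_sorted[OF P V e PI, where I="map (inv_into {..<r} e) vs"] 0 by simp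
  next
    case (Suc j)
    obtain c z where v: "z \<in> Z" "vs ! j = (\<lambda>t. (\<Sum>i<r. c i * e i t) + z t)"
      using rep[of "vs ! j"] Suc.prems by (metis Suc_le_lessD nth_mem subsetD)
    have j: "j < k" using Suc.prems by simp
    have S: "(\<lambda>t. \<Sum>i<r. c i * e i t) \<in> V" by (intro fun_subspace_sum[OF V] e) auto
    have "P vs = P (vs[j := (\<lambda>t. (\<Sum>i<r. c i * e i t) + z t)])" using v(2) by (metis list_update_id)
    also have "\<dots> = P (vs[j := (\<lambda>t. \<Sum>i<r. c i * e i t)]) + P (vs[j := z])"
      using Suc.prems j S v ZV by (intro alternating_on_add[OF P]) auto
    also have "P (vs[j := z]) = 0"
      using Suc.prems j v ZV by (intro PZ[of _ j] set_list_update_subset) auto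
    also have "P (vs[j := (\<lambda>t. \<Sum>i<r. c i * e i t)]) = (\<Sum>i<r. c i * P (vs[j := e i]))"
      using Suc.prems j e by (intro alternating_on_sum[OF P V]) auto
    also have "\<dots> = 0"
    proof (rule sum.neutral, rule ballI)
      fix i assume "i \<in> {..<r}"
      then have "P (vs[j := e i]) = 0"
        using Suc.prems e j by (intro Suc.IH set_list_update_subset) (auto simp: nth_list_update)
      then show "c i * P (vs[j := e i]) = 0" by simp
    qed
    finally show ?case by simp
  qed
  from this[of k vs] show ?thesis using vs by simp
qed

lemma alternating_on_span_eq_zeroI:
  fixes e :: "nat \<Rightarrow> 'x \<Rightarrow> real"
  assumes P: "alternating_on V k P" and V: "fun_subspace V" and e: "\<And>i. i < r \<Longrightarrow> e i \<in> V"
    and rep: "\<And>v. v \<in> V \<Longrightarrow> \<exists>c. v = (\<lambda>t. \<Sum>i<r. c i * e i t)"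
    and PI: "\<And>I. length I = k \<Longrightarrow> sorted_wrt (<) I \<Longrightarrow> set I \<subseteq> {..<r} \<Longrightarrow> P (map e I) = 0"
    and vs: "length vs = k" "set vs \<subseteq> V"
  shows "P vs = 0"
proof (rule alternating_on_eq_zeroI[OF P V e _ _ _ PI vs, where Z="{\<lambda>_. 0}"])
  fix v assume "v \<in> V"
  from rep[OF this] obtain c where "v = (\<lambda>t. \<Sum>i<r. c i * e i t)" ..
  then show "\<exists>c z. z \<in> {\<lambda>_. 0} \<and> v = (\<lambda>t. (\<Sum>i<r. c i * e i t) + z t)"
    by (intro exI[of _ c] exI[of _ "\<lambda>_. 0"]) simp
next
  fix vs i assume vs: "length vs = k" "set vs \<subseteq> V" "i < k" and z: "vs ! i \<in> {\<lambda>_. 0}"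
  have "P (vs[i := \<lambda>_. 0]) = 0"
    using alternating_on_sum[OF P V vs, of "{}" "\<lambda>_ _. 0" "\<lambda>_. 0"] by simp
  moreover have "vs[i := \<lambda>_. 0] = vs" using z list_update_id[of vs i] by simp
  ultimately show "P vs = 0" by simp
qed (use fun_subspaceD(1)[OF V] in auto)

lemma sorted_wrt_less_upt:
  assumes "sorted_wrt (<) I" "set I \<subseteq> {..<r}" "length I = r"
  shows "I = [0..<r]"
proof -
  have d: "distinct I" "sorted I" using assms(1) by (auto simp: strict_sorted_iff)
  have "set I = {..<r}" using card_subset_eq[OF _ assms(2)] d(1) assms(3) by (simp add: distinct_card)
  then show ?thesis using d sorted_distinct_set_unique[of I "[0..<r]"] by (auto simp: atLeast0LessThan)
qed

text \<open>In degree \<open>r\<close> the only increasing list of indices below \<open>r\<close> is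
  \<open>[0..<r]\<close>, so one evaluation decides.\<close>

lemma alternating_on_top_eq_zeroI:
  fixes e :: "nat \<Rightarrow> 'x \<Rightarrow> real"
  assumes "alternating_on V r P" "fun_subspace V" "\<And>i. i < r \<Longrightarrow> e i \<in> V"
    and "\<And>v. v \<in> V \<Longrightarrow> \<exists>c z. z \<in> Z \<and> v = (\<lambda>t. (\<Sum>i<r. c i * e i t) + z t)"
    and "Z \<subseteq> V"
    and "\<And>vs i. length vs = r \<Longrightarrow> set vs \<subseteq> V \<Longrightarrow> i < r \<Longrightarrow> vs ! i \<in> Z \<Longrightarrow> P vs = 0"
    and "P (map e [0..<r]) = 0" and "length vs = r" "set vs \<subseteq> V"
  shows "P vs = 0"
  by (rule alternating_on_eq_zeroI[OF assms(1-6) _ assms(8,9)])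
    (use assms(7) sorted_wrt_less_upt in auto)

section \<open>Operations on alternating maps\<close>

lemma alternating_on_lincomb:
  assumes "alternating_on V k P" "alternating_on V k Q"
  shows "alternating_on V k (\<lambda>vs. a * P vs + b * Q vs)"
  using assms unfolding alternating_on_def by (simp add: algebra_simps)

lemma alternating_on_scale: "alternating_on V k P \<Longrightarrow> alternating_on V k (\<lambda>vs. P vs * c)"
  using alternating_on_lincomb[of V k P P c 0] by (simp add: mult.commute)

lemma alternating_on_diff:
  "alternating_on V k P \<Longrightarrow> alternating_on V k Q \<Longrightarrow> alternating_on V k (\<lambda>vs. P vs - Q vs)"
  using alternating_on_lincomb[of V k P Q 1 "-1"] by simp

lemma alternating_on_sum_fun:
  assumes "\<And>i. i \<in> I \<Longrightarrow> alternating_on V k (P i)"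
  shows "alternating_on V k (\<lambda>vs. \<Sum>i\<in>I. P i vs)"
  using assms
proof (induction I rule: infinite_finite_induct)
  case (insert i I)
  then show ?case using alternating_on_lincomb[of V k "P i" "\<lambda>vs. \<Sum>i\<in>I. P i vs" 1 1] by simp
qed (auto simp: alternating_on_def)

lemma alternating_on_append_right:
  assumes "alternating_on V (k + l) P" "length ws = l" "set ws \<subseteq> V"
  shows "alternating_on V k (\<lambda>vs. P (vs @ ws))"
  unfolding alternating_on_def
proof (intro conjI allI ballI impI)
  fix vs i u v a b assume "u \<in> V" "v \<in> V" "length vs = k \<and> set vs \<subseteq> V \<and> i < k"
  then show "P (vs[i := \<lambda>t. a * u t + b * v t] @ ws) = a * P (vs[i := u] @ ws) + b * P (vs[i := v] @ ws)"
    using alternating_on_lin[OF assms(1), of "vs @ ws" i u v a b] assms(2,3)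
    by (simp add: list_update_append)
next
  fix vs i j assume "length vs = k \<and> set vs \<subseteq> V \<and> i < j \<and> j < k \<and> vs ! i = vs ! j"
  then show "P (vs @ ws) = 0"
    using assms(2,3) by (intro alternating_on_eq[OF assms(1), of _ i j]) (auto simp: nth_append)
qed

lemma alternating_on_append_left:
  assumes "alternating_on V (k + l) P" "length us = k" "set us \<subseteq> V"
  shows "alternating_on V l (\<lambda>vs. P (us @ vs))"
  unfolding alternating_on_def
proof (intro conjI allI ballI impI)
  fix vs i u v a b assume "u \<in> V" "v \<in> V" "length vs = l \<and> set vs \<subseteq> V \<and> i < l"
  then show "P (us @ vs[i := \<lambda>t. a * u t + b * v t]) = a * P (us @ vs[i := u]) + b * P (us @ vs[i := v])"
    using alternating_on_lin[OF assms(1), of "us @ vs" "k + i" u v a b] assms(2,3)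
    by (simp add: list_update_append)
next
  fix vs i j assume "length vs = l \<and> set vs \<subseteq> V \<and> i < j \<and> j < l \<and> vs ! i = vs ! j"
  then show "P (us @ vs) = 0"
    using assms(2,3) by (intro alternating_on_eq[OF assms(1), of _ "k + i" "k + j"]) (auto simp: nth_append)
qed

text \<open>Determinants of families indexed by \<open>nat\<close>, where the size is not a type.\<close>

definition ndet :: "nat \<Rightarrow> (nat \<Rightarrow> nat \<Rightarrow> real) \<Rightarrow> real" where
  "ndet k f = (\<Sum>\<pi> | \<pi> permutes {..<k}. of_int (sign \<pi>) * (\<Prod>i<k. f i (\<pi> i)))"

text \<open>Passes from linearity in the rows to linearity in the columns, that is from the
  covectors of a wedge product to its arguments.\<close>

lemma ndet_transpose: "ndet k (\<lambda>i j. f j i) = ndet k f"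
proof -
  have "ndet k (\<lambda>i j. f j i) = (\<Sum>\<pi> | \<pi> permutes {..<k}. of_int (sign (inv \<pi>)) * (\<Prod>i<k. f (inv \<pi> i) i))"
    unfolding ndet_def by (rule sum_permutations_inverse)
  also have "\<dots> = ndet k f"
    unfolding ndet_def
  proof (rule sum.cong[OF refl], clarify)
    fix \<pi> assume \<pi>: "\<pi> permutes {..<k}"
    have "(\<Prod>i<k. f (inv \<pi> i) i) = (\<Prod>i<k. f (inv \<pi> (\<pi> i)) (\<pi> i))"
      by (rule prod.permute[OF \<pi>, unfolded o_def])
    moreover have "sign (inv \<pi>) = sign \<pi>"
      using \<pi> by (intro sign_inverse) (auto intro: permutes_imp_permutation)
    ultimately show "of_int (sign (inv \<pi>)) * (\<Prod>i<k. f (inv \<pi> i) i) = of_int (sign \<pi>) * (\<Prod>i<k. f i (\<pi> i))"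
      by (simp add: permutes_inverses[OF \<pi>])
  qed
  finally show ?thesis .
qed

lemma ndet_row_lin:
  assumes "i0 < k" "\<And>j. f i0 j = a * g i0 j + b * h i0 j"
    and "\<And>i j. i \<noteq> i0 \<Longrightarrow> f i j = g i j" "\<And>i j. i \<noteq> i0 \<Longrightarrow> f i j = h i j"
  shows "ndet k f = a * ndet k g + b * ndet k h"
proof -
  have "(\<Prod>i<k. f i (\<pi> i)) = a * (\<Prod>i<k. g i (\<pi> i)) + b * (\<Prod>i<k. h i (\<pi> i))" for \<pi>
  proof -
    have r: "(\<Prod>i<k. F i (\<pi> i)) = F i0 (\<pi> i0) * (\<Prod>i\<in>{..<k} - {i0}. F i (\<pi> i))" for F :: "nat \<Rightarrow> nat \<Rightarrow> real"
      using assms(1) by (intro prod.remove) auto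
    have "(\<Prod>i\<in>{..<k} - {i0}. f i (\<pi> i)) = (\<Prod>i\<in>{..<k} - {i0}. g i (\<pi> i))"
      "(\<Prod>i\<in>{..<k} - {i0}. f i (\<pi> i)) = (\<Prod>i\<in>{..<k} - {i0}. h i (\<pi> i))"
      using assms(3,4) by (auto intro!: prod.cong)
    then show ?thesis unfolding r[of f] r[of g] r[of h] assms(2) by (simp add: algebra_simps)
  qed
  then show ?thesis
    unfolding ndet_def by (simp add: algebra_simps sum.distrib sum_distrib_left)
qed

lemma ndet_row_eq:
  assumes "a < k" "b < k" "a \<noteq> b" "\<And>j. f a j = f b j"
  shows "ndet k f = 0"
proof -
  let ?t = "Transposition.transpose a b"
  have t: "?t permutes {..<k}" using assms by (intro permutes_swap_id) auto
  have fab: "f a = f b" using assms(4) by (rule ext)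
  have key: "f (?t i) = f i" for i
    using fab by (cases "i = a"; cases "i = b") (simp_all add: transpose_apply_other)
  have "ndet k f = (\<Sum>\<pi> | \<pi> permutes {..<k}. of_int (sign (\<pi> \<circ> ?t)) * (\<Prod>i<k. f i ((\<pi> \<circ> ?t) i)))"
    unfolding ndet_def by (rule sum_permutations_compose_right[OF t])
  also have "\<dots> = (\<Sum>\<pi> | \<pi> permutes {..<k}. - (of_int (sign \<pi>) * (\<Prod>i<k. f i (\<pi> i))))"
  proof (rule sum.cong[OF refl], clarify)
    fix \<pi> assume \<pi>: "\<pi> permutes {..<k}"
    have "(\<Prod>i<k. f i ((\<pi> \<circ> ?t) i)) = prod ((\<lambda>i. f i ((\<pi> \<circ> ?t) i)) \<circ> ?t) {..<k}"
      by (rule prod.permute[OF t])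
    also have "\<dots> = (\<Prod>i<k. f i (\<pi> i))"
      by (intro prod.cong refl) (simp add: key)
    finally have "(\<Prod>i<k. f i ((\<pi> \<circ> ?t) i)) = (\<Prod>i<k. f i (\<pi> i))" .
    moreover have "sign (\<pi> \<circ> ?t) = - sign \<pi>"
      using \<pi> assms(3) by (subst sign_compose)
        (auto intro: permutes_imp_permutation simp: permutation_swap_id sign_swap_id)
    ultimately show "of_int (sign (\<pi> \<circ> ?t)) * (\<Prod>i<k. f i ((\<pi> \<circ> ?t) i)) = - (of_int (sign \<pi>) * (\<Prod>i<k. f i (\<pi> i)))"
      by simp
  qed
  also have "\<dots> = - ndet k f" by (simp add: ndet_def sum_negf)
  finally show ?thesis by simp
qed

lemma ndet_diagonal:
  assumes "\<And>i j. i < k \<Longrightarrow> j < k \<Longrightarrow> i \<noteq> j \<Longrightarrow> f i j = 0"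
  shows "ndet k f = (\<Prod>i<k. f i i)"
proof -
  have "of_int (sign \<pi>) * (\<Prod>i<k. f i (\<pi> i)) = 0" if \<pi>: "\<pi> permutes {..<k}" and ne: "\<pi> \<noteq> id" for \<pi>
  proof -
    obtain i where i: "\<pi> i \<noteq> i" using ne by (auto simp: fun_eq_iff)
    then have "i < k" "\<pi> i < k"
      using permutes_not_in[OF \<pi>, of i] permutes_in_image[OF \<pi>, of i] by auto
    then have "f i (\<pi> i) = 0" using i assms by auto
    then have "(\<Prod>i<k. f i (\<pi> i)) = 0" using \<open>i < k\<close> by (intro prod_zero) auto
    then show ?thesis by simp
  qed
  then have "ndet k f = (\<Sum>\<pi>\<in>{id}. of_int (sign \<pi>) * (\<Prod>i<k. f i (\<pi> i)))"
    unfolding ndet_def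
    by (intro sum.mono_neutral_right) (auto simp: finite_permutations permutes_id)
  then show ?thesis by simp
qed

lemma ndet_row_zero:
  assumes "i < k" "\<And>j. j < k \<Longrightarrow> f i j = 0"
  shows "ndet k f = 0"
  unfolding ndet_def
proof (rule sum.neutral, clarify)
  fix \<pi> assume "\<pi> permutes {..<k}"
  then have "f i (\<pi> i) = 0" using assms permutes_in_image[of \<pi> "{..<k}" i] by auto
  then have "(\<Prod>i<k. f i (\<pi> i)) = 0" using assms(1) by (intro prod_zero) auto
  then show "of_int (sign \<pi>) * (\<Prod>i<k. f i (\<pi> i)) = 0" by simp
qed

lemma ndet_cong:
  assumes "\<And>i j. i < k \<Longrightarrow> j < k \<Longrightarrow> f i j = g i j"
  shows "ndet k f = ndet k g"
  unfolding ndet_def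
proof (rule sum.cong[OF refl], clarify)
  fix \<pi> assume \<pi>: "\<pi> permutes {..<k}"
  have "(\<Prod>i<k. f i (\<pi> i)) = (\<Prod>i<k. g i (\<pi> i))"
    using permutes_in_image[OF \<pi>] by (intro prod.cong) (auto intro: assms)
  then show "of_int (sign \<pi>) * (\<Prod>i<k. f i (\<pi> i)) = of_int (sign \<pi>) * (\<Prod>i<k. g i (\<pi> i))" by simp
qed

section \<open>Wedge products as alternating maps\<close>

lemma wedge_ndet:
  "wedge V \<alpha>s vs = (if length vs = length \<alpha>s \<and> set vs \<subseteq> V
     then ndet (length \<alpha>s) (\<lambda>i j. (\<alpha>s ! i) (vs ! j)) else 0)"
  by (simp add: wedge_def ndet_def)

text \<open>\<open>W\<close> is arbitrary: the covectors enter through their values only, so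
  combining them is arithmetic of functions.\<close>

lemma wedge_alternating_left:
  assumes "length ws = k" "set ws \<subseteq> V"
  shows "alternating_on W k (\<lambda>\<alpha>s. wedge V \<alpha>s ws)"
  unfolding alternating_on_def
proof (intro conjI allI ballI impI)
  fix \<alpha>s i u v a b assume "length \<alpha>s = k \<and> set \<alpha>s \<subseteq> W \<and> i < k"
  then show "wedge V (\<alpha>s[i := \<lambda>t. a * u t + b * v t]) ws =
      a * wedge V (\<alpha>s[i := u]) ws + b * wedge V (\<alpha>s[i := v]) ws"
    using assms by (simp add: wedge_ndet) (intro ndet_row_lin[of i], auto)
next
  fix \<alpha>s i j assume "length \<alpha>s = k \<and> set \<alpha>s \<subseteq> W \<and> i < j \<and> j < k \<and> \<alpha>s ! i = \<alpha>s ! j"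
  then show "wedge V \<alpha>s ws = 0"
    using assms by (simp add: wedge_ndet) (intro ndet_row_eq[of i _ j], auto)
qed

lemma wedge_alternating:
  assumes V: "fun_subspace V" and \<alpha>s: "length \<alpha>s = k" "set \<alpha>s \<subseteq> linear_dual V"
  shows "wedge V \<alpha>s \<in> alternating_maps V k"
  unfolding alternating_maps_iff
proof
  show "\<forall>vs. \<not> (length vs = k \<and> set vs \<subseteq> V) \<longrightarrow> wedge V \<alpha>s vs = 0"
    using \<alpha>s by (auto simp: wedge_def)
  have t: "wedge V \<alpha>s vs = ndet k (\<lambda>j i. (\<alpha>s ! i) (vs ! j))" if "length vs = k" "set vs \<subseteq> V" for vs
    using that \<alpha>s by (simp add: wedge_ndet) (rule ndet_transpose)
  show "alternating_on V k (wedge V \<alpha>s)"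
    unfolding alternating_on_def
  proof (intro conjI allI ballI impI)
    fix vs i u v a b assume uv: "u \<in> V" "v \<in> V" and vs: "length vs = k \<and> set vs \<subseteq> V \<and> i < k"
    have lin: "(\<alpha>s ! j) (\<lambda>t. a * u t + b * v t) = a * (\<alpha>s ! j) u + b * (\<alpha>s ! j) v" if "j < k" for j
      using \<alpha>s that uv by (intro linear_dualD) (auto simp: subset_iff)
    have "ndet k (\<lambda>j l. (\<alpha>s ! l) (vs[i := \<lambda>t. a * u t + b * v t] ! j)) =
        ndet k (\<lambda>j l. if j = i then a * (\<alpha>s ! l) u + b * (\<alpha>s ! l) v else (\<alpha>s ! l) (vs ! j))"
      using vs by (intro ndet_cong) (auto simp: nth_list_update lin)
    also have "\<dots> = a * ndet k (\<lambda>j l. (\<alpha>s ! l) (vs[i := u] ! j)) + b * ndet k (\<lambda>j l. (\<alpha>s ! l) (vs[i := v] ! j))"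
      using vs by (intro ndet_row_lin[of i]) (auto simp: nth_list_update)
    finally show "wedge V \<alpha>s (vs[i := \<lambda>t. a * u t + b * v t]) =
        a * wedge V \<alpha>s (vs[i := u]) + b * wedge V \<alpha>s (vs[i := v])"
      using vs uv fun_subspaceD(2)[OF V uv] by (simp add: t set_list_update_subset)
  next
    fix vs i j assume "length vs = k \<and> set vs \<subseteq> V \<and> i < j \<and> j < k \<and> vs ! i = vs ! j"
    then show "wedge V \<alpha>s vs = 0"
      by (simp add: t) (intro ndet_row_eq[of i _ j], auto)
  qed
qed

section \<open>Dual bases and the expansion of alternating maps\<close>

definition dual_frames ::
  "('x \<Rightarrow> real) set \<Rightarrow> nat \<Rightarrow> (nat \<Rightarrow> 'x \<Rightarrow> real) \<Rightarrow> (nat \<Rightarrow> ('x \<Rightarrow> real) \<Rightarrow> real) \<Rightarrow> bool" where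
  "dual_frames V m e \<epsilon> \<longleftrightarrow> fun_subspace V \<and> (\<forall>i<m. e i \<in> V) \<and> (\<forall>i<m. \<epsilon> i \<in> linear_dual V) \<and>
     (\<forall>i<m. \<forall>j<m. \<epsilon> i (e j) = (if i = j then 1 else 0)) \<and>
     (\<forall>v\<in>V. v = (\<lambda>t. \<Sum>i<m. \<epsilon> i v * e i t))"

lemma dual_framesD:
  assumes "dual_frames V m e \<epsilon>"
  shows "fun_subspace V" "i < m \<Longrightarrow> e i \<in> V" "i < m \<Longrightarrow> \<epsilon> i \<in> linear_dual V"
    "i < m \<Longrightarrow> j < m \<Longrightarrow> \<epsilon> i (e j) = (if i = j then 1 else 0)"
    "v \<in> V \<Longrightarrow> v = (\<lambda>t. \<Sum>i<m. \<epsilon> i v * e i t)"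
  using assms unfolding dual_frames_def by blast+

lemma dual_frames_dual:
  assumes F: "dual_frames V m e \<epsilon>" and \<alpha>: "\<alpha> \<in> linear_dual V"
  shows "\<alpha> = (\<lambda>v. \<Sum>i<m. \<alpha> (e i) * \<epsilon> i v)"
proof
  fix v
  show "\<alpha> v = (\<Sum>i<m. \<alpha> (e i) * \<epsilon> i v)"
  proof (cases "v \<in> V")
    case True
    have "\<alpha> v = \<alpha> (\<lambda>t. \<Sum>i<m. \<epsilon> i v * e i t)" using dual_framesD(5)[OF F True] by simp
    also have "\<dots> = (\<Sum>i<m. \<epsilon> i v * \<alpha> (e i))"
      by (intro linear_dual_sum[OF \<alpha>] dual_framesD[OF F]) auto
    finally show ?thesis by (simp add: mult.commute)
  next
    case False
    then show ?thesis using linear_dualD(2)[OF \<alpha>] dual_framesD(3)[OF F] by (simp add: linear_dual_def)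
  qed
qed

lemma dual_frames_ext:
  assumes F: "dual_frames V m e \<epsilon>" and "u \<in> V" "v \<in> V" "\<And>\<alpha>. \<alpha> \<in> linear_dual V \<Longrightarrow> \<alpha> u = \<alpha> v"
  shows "u = v"
proof -
  have "u = (\<lambda>t. \<Sum>i<m. \<epsilon> i u * e i t)" by (rule dual_framesD(5)[OF F assms(2)])
  also have "\<dots> = (\<lambda>t. \<Sum>i<m. \<epsilon> i v * e i t)"
    using assms(4) dual_framesD(3)[OF F] by (intro ext sum.cong) auto
  also have "\<dots> = v" by (rule dual_framesD(5)[OF F assms(3), symmetric])
  finally show ?thesis .
qed

text \<open>Index set for a basis of the \<open>k\<close>-forms: each \<open>k\<close>-element set
  of indices is represented by its increasing enumeration.\<close>

definition increasing_lists :: "nat \<Rightarrow> nat \<Rightarrow> nat list set" where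
  "increasing_lists m k = {I. length I = k \<and> sorted_wrt (<) I \<and> set I \<subseteq> {..<m}}"

lemma finite_increasing: "finite (increasing_lists m k)"
  by (rule finite_subset[OF _ finite_lists_length_eq[of "{..<m}" k]]) (auto simp: increasing_lists_def)

lemma wedge_increasing:
  assumes F: "dual_frames V m e \<epsilon>" and "I \<in> increasing_lists m k" "J \<in> increasing_lists m k"
  shows "wedge V (map \<epsilon> J) (map e I) = (if I = J then 1 else 0)"
proof -
  have I: "length I = k" "set I \<subseteq> {..<m}" "distinct I" "sorted I"
    and J: "length J = k" "set J \<subseteq> {..<m}" "distinct J" "sorted J"
    using assms(2,3) by (auto simp: increasing_lists_def strict_sorted_iff)
  have "set (map e I) \<subseteq> V" using I dual_framesD(2)[OF F] by auto
  then have "wedge V (map \<epsilon> J) (map e I) = ndet k (\<lambda>i j. \<epsilon> (J ! i) (e (I ! j)))"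
    using I J by (auto simp: wedge_ndet intro!: ndet_cong)
  also have "\<dots> = ndet k (\<lambda>i j. if J ! i = I ! j then 1 else 0)"
    using I J by (intro ndet_cong dual_framesD(4)[OF F]) (auto simp: subset_iff)
  also have "\<dots> = (if I = J then 1 else 0)"
  proof (cases "I = J")
    case True
    then show ?thesis using I by (subst ndet_diagonal) (auto simp: nth_eq_iff_index_eq)
  next
    case False
    \<comment> \<open>Different increasing lists of equal length have different but equally large
      sets of entries, so some entry of \<open>J\<close> is missing from \<open>I\<close> and
      produces a zero row.\<close>
    have "set I \<noteq> set J" using False I J sorted_distinct_set_unique by blast
    moreover have "card (set I) = card (set J)" using I J by (simp add: distinct_card)
    ultimately have "\<not> set J \<subseteq> set I" using card_subset_eq[of "set I" "set J"] by auto
    then obtain i where "i < k" "J ! i \<notin> set I" using J(1) by (auto simp: set_conv_nth)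
    then have "ndet k (\<lambda>i j. if J ! i = I ! j then 1 else 0) = 0"
      using I(1) by (intro ndet_row_zero[of i]) auto
    then show ?thesis using False by simp
  qed
  finally show ?thesis .
qed

lemma alternating_expand_dual:
  assumes F: "dual_frames V m e \<epsilon>" and P: "alternating_on (linear_dual V) k P"
    and \<alpha>s: "length \<alpha>s = k" "set \<alpha>s \<subseteq> linear_dual V"
  shows "P \<alpha>s = (\<Sum>I\<in>increasing_lists m k. wedge V \<alpha>s (map e I) * P (map \<epsilon> I))"
proof -
  let ?Q = "\<lambda>\<alpha>s. P \<alpha>s - (\<Sum>I\<in>increasing_lists m k. wedge V \<alpha>s (map e I) * P (map \<epsilon> I))"
  have "?Q \<alpha>s = 0"
  proof (rule alternating_on_span_eq_zeroI[where V="linear_dual V" and P="?Q" and r=m and e=\<epsilon> and k=k])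
    show "alternating_on (linear_dual V) k ?Q"
      using dual_framesD(2)[OF F]
      by (intro alternating_on_diff[OF P] alternating_on_sum_fun alternating_on_scale wedge_alternating_left)
        (auto simp: increasing_lists_def)
    show "\<exists>c. v = (\<lambda>t. \<Sum>i<m. c i * \<epsilon> i t)" if "v \<in> linear_dual V" for v
      using dual_frames_dual[OF F that] by (rule exI[of _ "\<lambda>i. v (e i)"])
    show "?Q (map \<epsilon> J) = 0" if "length J = k" "sorted_wrt (<) J" "set J \<subseteq> {..<m}" for J
    proof -
      have J: "J \<in> increasing_lists m k" using that by (simp add: increasing_lists_def)
      have "(\<Sum>I\<in>increasing_lists m k. wedge V (map \<epsilon> J) (map e I) * P (map \<epsilon> I)) =
          (\<Sum>I\<in>increasing_lists m k. if I = J then P (map \<epsilon> I) else 0)"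
        by (intro sum.cong) (simp_all add: wedge_increasing[OF F _ J])
      then show ?thesis using J by (simp add: finite_increasing)
    qed
  qed (use \<alpha>s dual_framesD(3)[OF F] in \<open>auto intro: fun_subspace_linear_dual\<close>)
  then show ?thesis by simp
qed

lemma alternating_expand:
  assumes F: "dual_frames V m e \<epsilon>" and P: "P \<in> alternating_maps V k"
  shows "P vs = (\<Sum>I\<in>increasing_lists m k. P (map e I) * wedge V (map \<epsilon> I) vs)"
proof (cases "length vs = k \<and> set vs \<subseteq> V")
  case False
  then have "wedge V (map \<epsilon> I) vs = 0" if "I \<in> increasing_lists m k" for I
    using that by (auto simp: wedge_def increasing_lists_def)
  then show ?thesis using False P by (simp add: alternating_maps_iff)
next
  case True
  note V = dual_framesD(1)[OF F]
  have PV: "alternating_on V k P" using P by (simp add: alternating_maps_iff)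
  let ?Q = "\<lambda>vs. P vs - (\<Sum>I\<in>increasing_lists m k. wedge V (map \<epsilon> I) vs * P (map e I))"
  have "?Q vs = 0"
  proof (rule alternating_on_span_eq_zeroI[where V=V and P="?Q" and r=m and e=e and k=k])
    have "alternating_on V k (wedge V (map \<epsilon> I))" if "I \<in> increasing_lists m k" for I
    proof -
      have "wedge V (map \<epsilon> I) \<in> alternating_maps V k"
        using that dual_framesD(3)[OF F] by (intro wedge_alternating[OF V]) (auto simp: increasing_lists_def)
      then show ?thesis by (simp add: alternating_maps_iff)
    qed
    then show "alternating_on V k ?Q"
      by (intro alternating_on_diff[OF PV] alternating_on_sum_fun alternating_on_scale)
    show "\<exists>c. v = (\<lambda>t. \<Sum>i<m. c i * e i t)" if "v \<in> V" for v
      using dual_framesD(5)[OF F that] by (rule exI[of _ "\<lambda>i. \<epsilon> i v"])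
    show "?Q (map e J) = 0" if "length J = k" "sorted_wrt (<) J" "set J \<subseteq> {..<m}" for J
    proof -
      have J: "J \<in> increasing_lists m k" using that by (simp add: increasing_lists_def)
      have "(\<Sum>I\<in>increasing_lists m k. wedge V (map \<epsilon> I) (map e J) * P (map e I)) =
          (\<Sum>I\<in>increasing_lists m k. if I = J then P (map e I) else 0)"
        by (intro sum.cong) (auto simp: wedge_increasing[OF F J])
      then show ?thesis using J by (simp add: finite_increasing)
    qed
  qed (use True dual_framesD(2)[OF F] in \<open>auto intro: V\<close>)
  then show ?thesis by (simp add: mult.commute)
qed

section \<open>Contraction in a basis\<close>

lemma sum_list_sum_swap:
  "(\<Sum>x\<leftarrow>xs. \<Sum>i\<in>I. f x i) = (\<Sum>i\<in>I. \<Sum>x\<leftarrow>xs. f x i)" for f :: "'a \<Rightarrow> 'b \<Rightarrow> real"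
  by (induction xs) (simp_all add: sum.distrib)

text \<open>The value is well defined because expanding \<open>P\<close> in the dual basis turns the
  sum over any representing list \<open>L\<close> into one where \<open>L\<close> enters only
  through the coefficients of \<beta>. That some \<open>L\<close> exists is the basis expansion of
  \<beta> itself.\<close>

lemma contraction_eq:
  assumes F: "dual_frames V m e \<epsilon>" and \<beta>: "\<beta> \<in> alternating_maps V k"
    and P: "alternating_on (linear_dual V) k (\<lambda>\<alpha>s. P (\<alpha>s @ \<gamma>s))"
  shows "contraction V k \<beta> P \<gamma>s = (\<Sum>I\<in>increasing_lists m k. \<beta> (map e I) * P (map \<epsilon> I @ \<gamma>s))"
  unfolding contraction_def
proof (rule the_equality)
  let ?r = "\<Sum>I\<in>increasing_lists m k. \<beta> (map e I) * P (map \<epsilon> I @ \<gamma>s)"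
  obtain Is where Is: "set Is = increasing_lists m k" "distinct Is"
    using finite_distinct_list[OF finite_increasing] by blast
  let ?L = "map (\<lambda>I. (\<beta> (map e I), map \<epsilon> I)) Is"
  show "\<exists>L. (\<forall>(c, \<alpha>s)\<in>set L. length \<alpha>s = k \<and> set \<alpha>s \<subseteq> linear_dual V) \<and>
      (\<forall>vs. \<beta> vs = (\<Sum>(c, \<alpha>s)\<leftarrow>L. c * wedge V \<alpha>s vs)) \<and> ?r = (\<Sum>(c, \<alpha>s)\<leftarrow>L. c * P (\<alpha>s @ \<gamma>s))"
  proof (intro exI[of _ ?L] conjI allI)
    show "\<forall>(c, \<alpha>s)\<in>set ?L. length \<alpha>s = k \<and> set \<alpha>s \<subseteq> linear_dual V"
      using Is(1) dual_framesD(3)[OF F] by (auto simp: increasing_lists_def)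
    show "\<beta> vs = (\<Sum>(c, \<alpha>s)\<leftarrow>?L. c * wedge V \<alpha>s vs)" for vs
      using alternating_expand[OF F \<beta>, of vs] Is by (simp add: o_def sum_list_distinct_conv_sum_set)
    show "?r = (\<Sum>(c, \<alpha>s)\<leftarrow>?L. c * P (\<alpha>s @ \<gamma>s))"
      using Is by (simp add: o_def sum_list_distinct_conv_sum_set)
  qed
next
  fix r
  assume "\<exists>L. (\<forall>(c, \<alpha>s)\<in>set L. length \<alpha>s = k \<and> set \<alpha>s \<subseteq> linear_dual V) \<and>
      (\<forall>vs. \<beta> vs = (\<Sum>(c, \<alpha>s)\<leftarrow>L. c * wedge V \<alpha>s vs)) \<and> r = (\<Sum>(c, \<alpha>s)\<leftarrow>L. c * P (\<alpha>s @ \<gamma>s))"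
  then obtain L where L: "\<And>c \<alpha>s. (c, \<alpha>s) \<in> set L \<Longrightarrow> length \<alpha>s = k \<and> set \<alpha>s \<subseteq> linear_dual V"
    "\<And>vs. \<beta> vs = (\<Sum>(c, \<alpha>s)\<leftarrow>L. c * wedge V \<alpha>s vs)" "r = (\<Sum>(c, \<alpha>s)\<leftarrow>L. c * P (\<alpha>s @ \<gamma>s))"
    by blast
  have "r = (\<Sum>(c, \<alpha>s)\<leftarrow>L. \<Sum>I\<in>increasing_lists m k. c * wedge V \<alpha>s (map e I) * P (map \<epsilon> I @ \<gamma>s))"
    unfolding L(3)
  proof (rule arg_cong[where f=sum_list], rule map_cong[OF refl], clarify)
    fix c \<alpha>s assume "(c, \<alpha>s) \<in> set L"
    then have "P (\<alpha>s @ \<gamma>s) = (\<Sum>I\<in>increasing_lists m k. wedge V \<alpha>s (map e I) * P (map \<epsilon> I @ \<gamma>s))"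
      using alternating_expand_dual[OF F P] L(1) by blast
    then show "c * P (\<alpha>s @ \<gamma>s) = (\<Sum>I\<in>increasing_lists m k. c * wedge V \<alpha>s (map e I) * P (map \<epsilon> I @ \<gamma>s))"
      by (simp add: sum_distrib_left mult.assoc)
  qed
  also have "\<dots> = (\<Sum>I\<in>increasing_lists m k. (\<Sum>(c, \<alpha>s)\<leftarrow>L. c * wedge V \<alpha>s (map e I)) * P (map \<epsilon> I @ \<gamma>s))"
    unfolding split_beta sum_list_sum_swap by (simp add: sum_list_mult_const)
  also have "\<dots> = (\<Sum>I\<in>increasing_lists m k. \<beta> (map e I) * P (map \<epsilon> I @ \<gamma>s))"
    by (simp only: L(2)[symmetric])
  finally show "r = (\<Sum>I\<in>increasing_lists m k. \<beta> (map e I) * P (map \<epsilon> I @ \<gamma>s))" .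
qed

lemma contraction_wedge:
  assumes F: "dual_frames V m e \<epsilon>" and \<alpha>s: "length \<alpha>s = k" "set \<alpha>s \<subseteq> linear_dual V"
    and P: "alternating_on (linear_dual V) k (\<lambda>\<alpha>s. P (\<alpha>s @ \<gamma>s))"
  shows "contraction V k (wedge V \<alpha>s) P \<gamma>s = P (\<alpha>s @ \<gamma>s)"
  using contraction_eq[OF F wedge_alternating[OF dual_framesD(1)[OF F] \<alpha>s] P]
    alternating_expand_dual[OF F P \<alpha>s] by simp

section \<open>Decomposability of Nambu tensors\<close>

lemma alternating_on_update_eq:
  assumes "alternating_on V k P" "length vs = k" "set vs \<subseteq> V" "u \<in> V" "i < k" "j < k" "i \<noteq> j" "vs ! j = u"
  shows "P (vs[i := u]) = 0"
  by (rule alternating_on_eq[OF assms(1) _ set_list_update_subset[OF assms(3,4)] assms(5,6,7)])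
    (use assms in auto)

lemma alternating_on_headI:
  assumes P: "alternating_on V k P" and V: "fun_subspace V"
    and 0: "\<And>\<phi>. length \<phi> = k - 1 \<Longrightarrow> set \<phi> \<subseteq> V \<Longrightarrow> P (u # \<phi>) = 0"
    and vs: "length vs = k" "set vs \<subseteq> V" "u \<in> set vs"
  shows "P vs = 0"
proof -
  obtain R where R: "mset vs = add_mset u R" using vs(3) by (metis in_multiset_in_set insert_DiffM)
  obtain \<phi> where \<phi>: "mset \<phi> = R" using ex_mset by blast
  have m: "mset (u # \<phi>) = mset vs" using R \<phi> by simp
  have l: "length (u # \<phi>) = k" using mset_eq_length[OF m] vs(1) by simp
  have s: "set (u # \<phi>) \<subseteq> V" using mset_eq_setD[OF m] vs(2) by simp
  show ?thesis
    by (rule alternating_on_mset[OF P V m[symmetric] l s]) (use 0[of \<phi>] l s in auto)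
qed

text \<open>The shape \<open>u # \<phi> @ [w]\<close> is the one in which the quadratic identity for
  Nambu tensors delivers information; rearrangement frees the two positions.\<close>

lemma alternating_on_pairI:
  assumes P: "alternating_on V k P" and V: "fun_subspace V"
    and 0: "\<And>\<phi>. length \<phi> = k - 2 \<Longrightarrow> set \<phi> \<subseteq> V \<Longrightarrow> P (u # \<phi> @ [w]) = 0"
    and vs: "length vs = k" "set vs \<subseteq> V" "i < k" "j < k" "i \<noteq> j" "vs ! i = u" "vs ! j = w"
  shows "P vs = 0"
proof (cases "u = w")
  case True
  show ?thesis by (rule alternating_on_eq[OF P vs(1,2,3,4,5)]) (use True vs in simp)
next
  case False
  have uw: "u \<in># mset vs" "w \<in># mset vs" using vs by auto
  then obtain R where R: "mset vs = add_mset u R" by (metis insert_DiffM)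
  then obtain S where S: "R = add_mset w S" using uw(2) False by (metis insert_DiffM insert_noteq_member)
  obtain \<phi> where \<phi>: "mset \<phi> = S" using ex_mset by blast
  have m: "mset (u # \<phi> @ [w]) = mset vs" using R S \<phi> by simp
  have l: "length (u # \<phi> @ [w]) = k" using mset_eq_length[OF m] vs(1) by simp
  have s: "set (u # \<phi> @ [w]) \<subseteq> V" using mset_eq_setD[OF m] vs(2) by simp
  show ?thesis
    by (rule alternating_on_mset[OF P V m[symmetric] l s]) (use 0[of \<phi>] l s in auto)
qed

section \<open>Adapted bases and forms of top degree\<close>

lemma alternating_on_diff_arg:
  assumes "alternating_on V k P" "length vs = k" "set vs \<subseteq> V" "i < k" "u \<in> V" "v \<in> V"
  shows "P (vs[i := (\<lambda>t. u t - v t)]) = P (vs[i := u]) - P (vs[i := v])"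
  using alternating_on_lin[OF assms, of 1 "-1"] by simp

text \<open>Steinitz exchange. Independence of the \<open>Y i\<close> is read off from the covectors
  \<open>\<alpha> i\<close>, which separate them up to the common factor \<open>c\<close>. The
  vectors \<open>slot gs i p\<close> and the differentials of \<open>gs\<close> come in this form,
  with the bracket of \<open>gs\<close> as \<open>c\<close>.\<close>

lemma adapted_frame:
  assumes F: "dual_frames V m e \<epsilon>" and c: "c \<noteq> (0::real)"
    and "\<And>i. i < s \<Longrightarrow> Y i \<in> V" "\<And>i. i < s \<Longrightarrow> \<alpha> i \<in> linear_dual V"
    and "\<And>i j. i < s \<Longrightarrow> j < s \<Longrightarrow> \<alpha> i (Y j) = (if i = j then c else 0)"
  obtains e' \<epsilon>' where "dual_frames V m e' \<epsilon>'" "\<And>i. i < s \<Longrightarrow> e' i = Y i" "s \<le> m"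
proof -
  have "\<exists>e' \<epsilon>'. dual_frames V m e' \<epsilon>' \<and> (\<forall>i<s. e' i = Y i) \<and> s \<le> m"
    using assms(3-)
  proof (induction s)
    case 0
    then show ?case using F by auto
  next
    case (Suc s)
    have "\<exists>e' \<epsilon>'. dual_frames V m e' \<epsilon>' \<and> (\<forall>i<s. e' i = Y i) \<and> s \<le> m"
      by (rule Suc.IH) (use Suc.prems in auto)
    then obtain e \<epsilon> where F: "dual_frames V m e \<epsilon>" and eY: "\<And>i. i < s \<Longrightarrow> e i = Y i" and sm: "s \<le> m"
      by blast
    note FD = dual_framesD[OF F]
    have Ys: "Y s \<in> V" "\<alpha> s \<in> linear_dual V" using Suc.prems(1,2) by auto
    \<comment> \<open>Otherwise \<open>Y s\<close> would be a combination of the vectors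
      \<open>Y i\<close> with \<open>i < s\<close>, all of which \<open>\<alpha> s\<close>
      kills.\<close>
    have "\<exists>k. s \<le> k \<and> k < m \<and> \<epsilon> k (Y s) \<noteq> 0"
    proof (rule ccontr)
      assume "\<not> ?thesis"
      then have z: "\<epsilon> k (Y s) = 0" if "s \<le> k" "k < m" for k using that by blast
      have "\<alpha> s (Y s) = \<alpha> s (\<lambda>t. \<Sum>i<m. \<epsilon> i (Y s) * e i t)" using FD(5)[OF Ys(1)] by simp
      also have "\<dots> = (\<Sum>i<m. \<epsilon> i (Y s) * \<alpha> s (e i))"
        by (intro linear_dual_sum[OF Ys(2) FD(1)] FD(2)) auto
      also have "\<dots> = 0"
      proof (rule sum.neutral, rule ballI)
        fix i assume "i \<in> {..<m}"
        then show "\<epsilon> i (Y s) * \<alpha> s (e i) = 0"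
          using z[of i] eY[of i] Suc.prems(3)[of s i] by (cases "i < s") auto
      qed
      finally show False using Suc.prems(3)[of s s] c by simp
    qed
    then obtain k where k: "s \<le> k" "k < m" "\<epsilon> k (Y s) \<noteq> 0" by blast
    \<comment> \<open>Relabelling moves the basis vector that is to be exchanged to position
      \<open>s\<close>.\<close>
    let ?t = "Transposition.transpose s k"
    define e1 where "e1 = e \<circ> ?t"
    define \<epsilon>1 where "\<epsilon>1 = \<epsilon> \<circ> ?t"
    have tm: "?t i < m \<longleftrightarrow> i < m" for i
      using k by (auto simp: Transposition.transpose_def)
    have tp: "?t permutes {..<m}" using k by (intro permutes_swap_id) auto
    have F1: "e1 i \<in> V" "\<epsilon>1 i \<in> linear_dual V" if "i < m" for i
      unfolding e1_def \<epsilon>1_def o_apply by (intro FD(2,3), simp only: tm that)+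
    have F1d: "\<epsilon>1 i (e1 j) = (if i = j then 1 else 0)" if "i < m" "j < m" for i j
    proof -
      have "?t i = ?t j \<longleftrightarrow> i = j" by (metis transpose_involutory)
      moreover have "\<epsilon> (?t i) (e (?t j)) = (if ?t i = ?t j then 1 else 0)"
        by (rule FD(4)) (simp_all only: tm that)
      ultimately show ?thesis by (simp only: e1_def \<epsilon>1_def o_apply)
    qed
    have F1s: "v t = (\<Sum>i<m. \<epsilon>1 i v * e1 i t)" if "v \<in> V" for v t
    proof -
      have "v t = (\<Sum>i<m. \<epsilon> i v * e i t)" by (rule fun_cong[OF FD(5)[OF that]])
      also have "\<dots> = sum ((\<lambda>i. \<epsilon> i v * e i t) \<circ> ?t) {..<m}" by (rule sum.permute[OF tp])
      also have "\<dots> = (\<Sum>i<m. \<epsilon>1 i v * e1 i t)" by (simp add: e1_def \<epsilon>1_def)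
      finally show ?thesis .
    qed
    define d where "d = \<epsilon>1 s (Y s)"
    have d: "d \<noteq> 0" using k by (simp add: d_def \<epsilon>1_def)
    have sm': "s < m" using k by simp
    define e2 where "e2 = e1(s := Y s)"
    \<comment> \<open>The dual basis after the exchange: the covector at \<open>s\<close> is
      rescaled to take the value 1 on \<open>Y s\<close>, and the others are corrected so as to
      vanish there.\<close>
    define \<epsilon>2 where "\<epsilon>2 i = (if i = s then (\<lambda>v. (1 / d) * \<epsilon>1 s v)
        else (\<lambda>v. 1 * \<epsilon>1 i v + (- (\<epsilon>1 i (Y s) / d)) * \<epsilon>1 s v))" for i
    have "dual_frames V m e2 \<epsilon>2"
      unfolding dual_frames_def
    proof (intro conjI allI impI ballI)
      show "fun_subspace V" by (rule FD(1))
      show "e2 i \<in> V" if "i < m" for i using that F1 Ys by (simp add: e2_def)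
      show "\<epsilon>2 i \<in> linear_dual V" if "i < m" for i
        unfolding \<epsilon>2_def
        using fun_subspaceD(4)[OF fun_subspace_linear_dual F1(2)[OF sm'], of "1 / d"]
          fun_subspaceD(2)[OF fun_subspace_linear_dual F1(2)[OF that] F1(2)[OF sm'], of 1 "- (\<epsilon>1 i (Y s) / d)"]
        by simp
      show "\<epsilon>2 i (e2 j) = (if i = j then 1 else 0)" if "i < m" "j < m" for i j
        using that d F1d sm' by (auto simp: \<epsilon>2_def e2_def d_def)
      show "v = (\<lambda>t. \<Sum>i<m. \<epsilon>2 i v * e2 i t)" if v: "v \<in> V" for v
      proof
        fix t
        have r: "(\<Sum>i<m. f i) = f s + (\<Sum>i\<in>{..<m} - {s}. f i)" for f :: "nat \<Rightarrow> real"
          using sm' by (intro sum.remove) auto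
        have vt: "v t = \<epsilon>1 s v * e1 s t + (\<Sum>i\<in>{..<m} - {s}. \<epsilon>1 i v * e1 i t)"
          using F1s[OF v, of t] r[of "\<lambda>i. \<epsilon>1 i v * e1 i t"] by simp
        have Yt: "Y s t = d * e1 s t + (\<Sum>i\<in>{..<m} - {s}. \<epsilon>1 i (Y s) * e1 i t)"
          using F1s[OF Ys(1), of t] r[of "\<lambda>i. \<epsilon>1 i (Y s) * e1 i t"] by (simp add: d_def)
        have "(\<Sum>i\<in>{..<m} - {s}. \<epsilon>2 i v * e2 i t) =
            (\<Sum>i\<in>{..<m} - {s}. \<epsilon>1 i v * e1 i t - (\<epsilon>1 s v / d) * (\<epsilon>1 i (Y s) * e1 i t))"
          by (intro sum.cong) (auto simp: \<epsilon>2_def e2_def algebra_simps)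
        also have "\<dots> = (\<Sum>i\<in>{..<m} - {s}. \<epsilon>1 i v * e1 i t) -
            (\<epsilon>1 s v / d) * (\<Sum>i\<in>{..<m} - {s}. \<epsilon>1 i (Y s) * e1 i t)"
          by (simp add: sum_subtractf sum_distrib_left)
        also have "\<dots> = (v t - \<epsilon>1 s v * e1 s t) - (\<epsilon>1 s v / d) * (Y s t - d * e1 s t)"
          using vt Yt by simp
        also have "\<dots> = v t - \<epsilon>2 s v * e2 s t"
          using d by (simp add: \<epsilon>2_def e2_def field_simps)
        finally show "v t = (\<Sum>i<m. \<epsilon>2 i v * e2 i t)"
          using r[of "\<lambda>i. \<epsilon>2 i v * e2 i t"] by simp
      qed
    qed
    moreover have "e2 i = Y i" if "i < Suc s" for i
      using that eY[of i] k(1) by (auto simp: e2_def e1_def Transposition.transpose_def)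
    ultimately show ?case using sm' by auto
  qed
  then show thesis using that by blast
qed

lemma top_form_nonzero_on_frame:
  assumes F: "dual_frames V m e \<epsilon>" and P: "alternating_on V m P"
    and vs: "length vs = m" "set vs \<subseteq> V" "P vs \<noteq> 0"
  shows "P (map e [0..<m]) \<noteq> 0"
proof
  assume 0: "P (map e [0..<m]) = 0"
  note V = dual_framesD(1)[OF F]
  have "P vs = 0"
  proof (rule alternating_on_span_eq_zeroI[OF P V, where e=e and r=m])
    show "\<exists>c. v = (\<lambda>t. \<Sum>i<m. c i * e i t)" if "v \<in> V" for v
      using dual_framesD(5)[OF F that] by (rule exI[of _ "\<lambda>i. \<epsilon> i v"])
  qed (use 0 vs dual_framesD(2)[OF F] sorted_wrt_less_upt in auto)
  then show False using vs by simp
qed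

text \<open>Forms of top degree make up a line. The cross-multiplied statement also covers forms
  that vanish and needs no quotients.\<close>

lemma top_forms_proportional:
  assumes F: "dual_frames V m e \<epsilon>" and P: "alternating_on V m P" and Q: "alternating_on V m Q"
    and vs: "length vs = m" "set vs \<subseteq> V" and ws: "length ws = m" "set ws \<subseteq> V"
  shows "P vs * Q ws = P ws * Q vs"
proof -
  let ?E = "map e [0..<m]"
  have E: "length ?E = m" "set ?E \<subseteq> V" using dual_framesD(2)[OF F] by auto
  have pr: "P vs * Q ?E = P ?E * Q vs" if "length vs = m" "set vs \<subseteq> V" for vs
  proof -
    have "alternating_on V m (\<lambda>vs. P vs * Q ?E - Q vs * P ?E)"
      by (intro alternating_on_diff alternating_on_scale P Q)
    from top_form_nonzero_on_frame[OF F this that] show ?thesis by (auto simp: mult.commute)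
  qed
  show ?thesis
  proof (cases "Q ?E = 0")
    case True
    then have "Q vs = 0" "Q ws = 0" using top_form_nonzero_on_frame[OF F Q] vs ws by blast+
    then show ?thesis by simp
  next
    case False
    have "(P vs * Q ws) * Q ?E = (P ws * Q vs) * Q ?E"
      using pr[OF vs] pr[OF ws] by algebra
    then show ?thesis using False by simp
  qed
qed

text \<open>The vectors \<open>Y i\<close> extend to a basis, and a nonzero top form does not vanish
  on any basis.\<close>

lemma top_form_nonzero_extend:
  assumes F: "dual_frames V m e \<epsilon>" and P: "alternating_on V m P"
    and vs: "length vs = m" "set vs \<subseteq> V" "P vs \<noteq> 0" and c: "c \<noteq> (0::real)"
    and Y: "\<And>i. i < s \<Longrightarrow> Y i \<in> V" "\<And>i. i < s \<Longrightarrow> \<alpha> i \<in> linear_dual V"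
      "\<And>i j. i < s \<Longrightarrow> j < s \<Longrightarrow> \<alpha> i (Y j) = (if i = j then c else 0)"
  obtains ws where "length ws = m - s" "set ws \<subseteq> V" "P (map Y [0..<s] @ ws) \<noteq> 0" "s \<le> m"
proof -
  obtain e' \<epsilon>' where F': "dual_frames V m e' \<epsilon>'" "\<And>i. i < s \<Longrightarrow> e' i = Y i" "s \<le> m"
    using adapted_frame[OF F c Y] by blast
  have "P (map e' [0..<m]) \<noteq> 0" by (rule top_form_nonzero_on_frame[OF F'(1) P vs])
  moreover have "map e' [0..<m] = map Y [0..<s] @ map e' [s..<m]"
    using F'(2,3) upt_add_eq_append[of 0 s "m - s"] by simp
  ultimately show thesis
    using dual_framesD(2)[OF F'(1)] F'(3) by (intro that[of "map e' [s..<m]"]) auto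
qed

lemma sum_lessThan_add:
  "(\<Sum>i<s + k. f i) = (\<Sum>i<s. f i) + (\<Sum>i<k. f (s + i))" for f :: "nat \<Rightarrow> real"
  by (induction k) simp_all

text \<open>Forms of degree \<open>m - s\<close> killed by \<open>s\<close> independent directions
  descend to top forms on the quotient, and these make up a line. The quotient itself is avoided:
  the last \<open>m - s\<close> vectors of an adapted basis represent it.\<close>

lemma transverse_forms_proportional:
  assumes F: "dual_frames V m e \<epsilon>" and c: "c \<noteq> (0::real)"
    and Y: "\<And>i. i < s \<Longrightarrow> Y i \<in> V" "\<And>i. i < s \<Longrightarrow> \<alpha> i \<in> linear_dual V"
      "\<And>i j. i < s \<Longrightarrow> j < s \<Longrightarrow> \<alpha> i (Y j) = (if i = j then c else 0)"
    and P: "alternating_on V (m - s) P" and Q: "alternating_on V (m - s) Q"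
    and PY: "\<And>i vs. i < s \<Longrightarrow> length vs = m - s - 1 \<Longrightarrow> set vs \<subseteq> V \<Longrightarrow> P (Y i # vs) = 0"
    and QY: "\<And>i vs. i < s \<Longrightarrow> length vs = m - s - 1 \<Longrightarrow> set vs \<subseteq> V \<Longrightarrow> Q (Y i # vs) = 0"
    and vs: "length vs = m - s" "set vs \<subseteq> V" and ws: "length ws = m - s" "set ws \<subseteq> V"
  shows "P vs * Q ws = P ws * Q vs"
proof -
  note V = dual_framesD(1)[OF F]
  obtain e' \<epsilon>' where F': "dual_frames V m e' \<epsilon>'" "\<And>i. i < s \<Longrightarrow> e' i = Y i" "s \<le> m"
    using adapted_frame[OF F c Y] by blast
  define D where "D = {(\<lambda>t. \<Sum>i<s. c i * Y i t) | c. True}"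
  let ?E = "map (\<lambda>i. e' (s + i)) [0..<m - s]"
  have E: "length ?E = m - s" "set ?E \<subseteq> V" using dual_framesD(2)[OF F'(1)] by auto
  have van: "R vs = 0" if R: "alternating_on V (m - s) R"
    and RY: "\<And>i vs. i < s \<Longrightarrow> length vs = m - s - 1 \<Longrightarrow> set vs \<subseteq> V \<Longrightarrow> R (Y i # vs) = 0"
    and RE: "R ?E = 0" and vs: "length vs = m - s" "set vs \<subseteq> V" for R vs
  proof (rule alternating_on_top_eq_zeroI[OF R V, where e="\<lambda>i. e' (s + i)" and Z=D])
    show "e' (s + i) \<in> V" if "i < m - s" for i using dual_framesD(2)[OF F'(1)] that by auto
    show "D \<subseteq> V" by (auto simp: D_def intro!: fun_subspace_sum[OF V] Y(1))
    show "\<exists>c z. z \<in> D \<and> v = (\<lambda>t. (\<Sum>i<m - s. c i * e' (s + i) t) + z t)" if v: "v \<in> V" for v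
    proof (intro exI conjI)
      show "(\<lambda>t. \<Sum>i<s. \<epsilon>' i v * Y i t) \<in> D" by (auto simp: D_def)
      show "v = (\<lambda>t. (\<Sum>i<m - s. \<epsilon>' (s + i) v * e' (s + i) t) + (\<Sum>i<s. \<epsilon>' i v * Y i t))"
      proof
        fix t
        have "v t = (\<Sum>i<m. \<epsilon>' i v * e' i t)" using fun_cong[OF dual_framesD(5)[OF F'(1) v], of t] .
        also have "\<dots> = (\<Sum>i<s. \<epsilon>' i v * e' i t) + (\<Sum>i<m - s. \<epsilon>' (s + i) v * e' (s + i) t)"
          using F'(3) sum_lessThan_add[of "\<lambda>i. \<epsilon>' i v * e' i t" s "m - s"] by simp
        finally show "v t = (\<Sum>i<m - s. \<epsilon>' (s + i) v * e' (s + i) t) + (\<Sum>i<s. \<epsilon>' i v * Y i t)"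
          using F'(2) by simp
      qed
    qed
    show "R vs = 0" if vs: "length vs = m - s" "set vs \<subseteq> V" "i < m - s" "vs ! i \<in> D" for vs i
    proof -
      obtain c where c: "vs ! i = (\<lambda>t. \<Sum>l<s. c l * Y l t)" using vs(4) by (auto simp: D_def)
      have "R vs = R (vs[i := (\<lambda>t. \<Sum>l<s. c l * Y l t)])" using c by (metis list_update_id)
      also have "\<dots> = (\<Sum>l<s. c l * R (vs[i := Y l]))"
        by (rule alternating_on_sum[OF R V vs(1-3)]) (use Y(1) in auto)
      also have "\<dots> = 0"
      proof (rule sum.neutral, rule ballI)
        fix l assume l: "l \<in> {..<s}"
        have "R (vs[i := Y l]) = 0"
        proof (rule alternating_on_headI[OF R V _ _ set_list_update_subset[OF vs(2)]])
          show "Y l \<in> set (vs[i := Y l])" using vs(1,3) by (intro set_update_memI) simp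
        qed (use RY l vs(1) Y(1) in auto)
        then show "c l * R (vs[i := Y l]) = 0" by simp
      qed
      finally show ?thesis .
    qed
  qed (use RE vs in auto)
  have pr: "P vs * Q ?E = P ?E * Q vs" if "length vs = m - s" "set vs \<subseteq> V" for vs
  proof -
    have "alternating_on V (m - s) (\<lambda>vs. P vs * Q ?E - Q vs * P ?E)"
      by (intro alternating_on_diff alternating_on_scale P Q)
    from van[OF this _ _ that] show ?thesis using PY QY by (auto simp: mult.commute)
  qed
  show ?thesis
  proof (cases "Q ?E = 0")
    case True
    then have "Q vs = 0" "Q ws = 0" using van[OF Q QY] vs ws by blast+
    then show ?thesis by simp
  next
    case False
    have "(P vs * Q ws) * Q ?E = (P ws * Q vs) * Q ?E"
      using pr[OF vs] pr[OF ws] by algebra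
    then show ?thesis using False by simp
  qed
qed

text \<open>The algebra at one point: \<open>W\<close> is a cotangent space, and
  \<open>quadratic\<close> is what the fundamental identity leaves over when one of its first
  \<open>n - 1\<close> functions is a product.\<close>

locale nambu_tensor =
  fixes W :: "('x \<Rightarrow> real) set" and n :: nat and L :: "('x \<Rightarrow> real) list \<Rightarrow> real"
  assumes W: "fun_subspace W" and L: "alternating_on W n L" and n3: "n \<ge> 3"
    and quadratic: "\<And>h k \<phi> \<gamma>. h \<in> W \<Longrightarrow> k \<in> W \<Longrightarrow> length \<phi> = n - 2 \<Longrightarrow> set \<phi> \<subseteq> W \<Longrightarrow>
      length \<gamma> = n \<Longrightarrow> set \<gamma> \<subseteq> W \<Longrightarrow>
      (\<Sum>i<n. L (k # \<phi> @ [\<gamma> ! i]) * L (\<gamma>[i := h]) + L (h # \<phi> @ [\<gamma> ! i]) * L (\<gamma>[i := k])) = 0"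
begin

lemma annihilator_pair:
  assumes \<alpha>: "length \<alpha> = n" "set \<alpha> \<subseteq> W" "L \<alpha> \<noteq> 0"
    and \<beta>: "\<beta> \<in> W" "\<And>i. i < n \<Longrightarrow> L (\<alpha>[i := \<beta>]) = 0"
    and j: "j < n" and \<phi>: "length \<phi> = n - 2" "set \<phi> \<subseteq> W"
  shows "L (\<alpha> ! j # \<phi> @ [\<beta>]) = 0"
proof -
  let ?a = "\<alpha> ! j" and ?\<gamma> = "\<alpha>[j := \<beta>]"
  have a: "?a \<in> W" using \<alpha> j by (auto simp: subset_iff)
  \<comment> \<open>The identity with \<open>h = k = \<alpha> ! j\<close>, where \<gamma> is
    \<alpha> with \<beta> in position \<open>j\<close>. After a swap a term with
    \<open>i \<noteq> j\<close> contains \<alpha> with \<beta> in position \<open>i\<close>, hence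
    is 0; the term \<open>i = j\<close> is left, twice.\<close>
  have "0 = (\<Sum>i<n. L (?a # \<phi> @ [?\<gamma> ! i]) * L (?\<gamma>[i := ?a]) + L (?a # \<phi> @ [?\<gamma> ! i]) * L (?\<gamma>[i := ?a]))"
    by (rule quadratic[symmetric, OF a a \<phi> _ set_list_update_subset]) (use \<alpha> \<beta> in auto)
  also have "\<dots> = (\<Sum>i<n. if i = j then 2 * L (?a # \<phi> @ [\<beta>]) * L \<alpha> else 0)"
  proof (rule sum.cong[OF refl])
    fix i assume i: "i \<in> {..<n}"
    show "L (?a # \<phi> @ [?\<gamma> ! i]) * L (?\<gamma>[i := ?a]) + L (?a # \<phi> @ [?\<gamma> ! i]) * L (?\<gamma>[i := ?a]) =
        (if i = j then 2 * L (?a # \<phi> @ [\<beta>]) * L \<alpha> else 0)"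
    proof (cases "i = j")
      case True
      then show ?thesis using \<alpha> j by simp
    next
      case False
      have "L (?\<gamma>[i := ?a]) = - L (\<alpha>[j := ?a, i := \<beta>])"
        by (rule alternating_on_swap[OF L W]) (use \<alpha> \<beta> a i j False in auto)
      then show ?thesis using False \<beta>(2) i by simp
    qed
  qed
  also have "\<dots> = 2 * L (?a # \<phi> @ [\<beta>]) * L \<alpha>" using j by simp
  finally show ?thesis using \<alpha>(3) by simp
qed

text \<open>This is where \<open>n \<ge> 3\<close> enters: it leaves room for an entry of \<open>\<alpha>\<close> in \<open>\<phi>\<close>.\<close>

lemma annihilator:
  assumes \<alpha>: "length \<alpha> = n" "set \<alpha> \<subseteq> W" "L \<alpha> \<noteq> 0"
    and \<beta>: "\<beta> \<in> W" "\<And>i. i < n \<Longrightarrow> L (\<alpha>[i := \<beta>]) = 0"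
    and \<gamma>: "length \<gamma> = n" "set \<gamma> \<subseteq> W" "\<beta> \<in> set \<gamma>"
  shows "L \<gamma> = 0"
proof (rule alternating_on_headI[OF L W _ \<gamma>])
  have pair: "L \<delta> = 0" if "length \<delta> = n" "set \<delta> \<subseteq> W" "i < n" "j < n" "i \<noteq> j" "\<delta> ! i = \<alpha> ! l" "\<delta> ! j = \<beta>" "l < n" for \<delta> i j l
    using that by (intro alternating_on_pairI[OF L W annihilator_pair[OF \<alpha> \<beta> that(8)], of \<delta> i j]) auto
  fix \<delta> assume \<delta>: "length \<delta> = n - 1" "set \<delta> \<subseteq> W"
  \<comment> \<open>\<alpha> is distributed over the identity: its first entry is \<open>k\<close>,
    the middle ones form \<phi>, and the last one heads \<gamma>. With \<open>h = \<beta>\<close>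
    the term \<open>i = 0\<close> contains \<open>L \<alpha> * L (\<beta> # \<delta>)\<close>, and
    in every other product \<beta> meets an entry of \<alpha>, so \<open>pair\<close>
    applies.\<close>
  let ?\<phi> = "map (\<lambda>i. \<alpha> ! i) [1..<n - 1]" and ?k = "\<alpha> ! 0" and ?\<gamma> = "\<alpha> ! (n - 1) # \<delta>"
  have aW: "\<alpha> ! i \<in> W" if "i < n" for i using \<alpha> that by (auto simp: subset_iff)
  have \<alpha>eq: "?k # ?\<phi> @ [\<alpha> ! (n - 1)] = \<alpha>"
  proof (rule nth_equalityI)
    fix i assume i: "i < length (?k # ?\<phi> @ [\<alpha> ! (n - 1)])"
    show "(?k # ?\<phi> @ [\<alpha> ! (n - 1)]) ! i = \<alpha> ! i"
    proof (cases i)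
      case (Suc j)
      show ?thesis
      proof (cases "j < n - 2")
        case False
        then have "j = n - 2" "Suc (n - 2) = n - 1" using i Suc n3 by auto
        then show ?thesis using Suc by (simp add: nth_append)
      next
        case True
        then show ?thesis using Suc by (simp add: nth_append numeral_2_eq_2)
      qed
    qed simp
  qed (use n3 \<alpha>(1) in simp)
  have \<phi>W: "set ?\<phi> \<subseteq> W" using aW by auto
  have "0 = (\<Sum>i<n. L (?k # ?\<phi> @ [?\<gamma> ! i]) * L (?\<gamma>[i := \<beta>]) + L (\<beta> # ?\<phi> @ [?\<gamma> ! i]) * L (?\<gamma>[i := ?k]))"
    by (rule quadratic[symmetric]) (use aW \<phi>W \<delta> \<beta> n3 in auto)
  also have "\<dots> = (\<Sum>i<n. if i = 0 then L \<alpha> * L (\<beta> # \<delta>) else 0)"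
  proof (rule sum.cong[OF refl])
    fix i assume i: "i \<in> {..<n}"
    have \<gamma>i: "?\<gamma> ! i \<in> W" using i \<delta> aW[of "n - 1"] n3 by (cases i) (auto simp: subset_iff)
    have 2: "L (\<beta> # ?\<phi> @ [?\<gamma> ! i]) = 0"
      by (rule pair[of _ 1 0 1]) (use n3 \<phi>W \<gamma>i \<beta>(1) in \<open>auto simp: nth_append\<close>)
    show "L (?k # ?\<phi> @ [?\<gamma> ! i]) * L (?\<gamma>[i := \<beta>]) + L (\<beta> # ?\<phi> @ [?\<gamma> ! i]) * L (?\<gamma>[i := ?k]) =
        (if i = 0 then L \<alpha> * L (\<beta> # \<delta>) else 0)"
    proof (cases "i = 0")
      case True
      then show ?thesis using 2 \<alpha>eq by simp
    next
      case False
      then obtain l where l: "i = Suc l" by (cases i) auto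
      have "L (\<alpha> ! (n - 1) # \<delta>[l := \<beta>]) = 0"
        by (rule pair[of _ 0 i "n - 1"])
          (use l i n3 \<delta> aW[of "n - 1"] set_list_update_subset[OF \<delta>(2) \<beta>(1)] in auto)
      then have "L (?\<gamma>[i := \<beta>]) = 0" using l by simp
      then show ?thesis using 2 False by simp
    qed
  qed
  also have "\<dots> = L \<alpha> * L (\<beta> # \<delta>)" using n3 by simp
  finally show "L (\<beta> # \<delta>) = 0" using \<alpha>(3) by simp
qed

text \<open>The covectors that vanish on the \<open>n\<close> vectors
  \<open>L (\<alpha>[i := _])\<close>; where \<open>L \<alpha>\<close> is nonzero these vectors span
  the characteristic distribution, and \<open>ann \<alpha>\<close> is its conormal space.\<close>

definition ann :: "('x \<Rightarrow> real) list \<Rightarrow> ('x \<Rightarrow> real) set" where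
  "ann \<alpha> = {z \<in> W. \<forall>i<n. L (\<alpha>[i := z]) = 0}"

lemma ann_vanish:
  assumes "length \<alpha> = n" "set \<alpha> \<subseteq> W" "L \<alpha> \<noteq> 0" "length \<gamma> = n" "set \<gamma> \<subseteq> W" "i < n" "\<gamma> ! i \<in> ann \<alpha>"
  shows "L \<gamma> = 0"
  by (rule annihilator[OF assms(1-3), of "\<gamma> ! i"]) (use assms in \<open>auto simp: ann_def\<close>)

text \<open>Cramer's rule with \<open>L\<close> in the role of the determinant. The remainder lies
  in \<open>ann \<alpha>\<close> because a repeated entry kills all coefficients but one.\<close>

lemma decompose:
  assumes \<alpha>: "length \<alpha> = n" "set \<alpha> \<subseteq> W" "L \<alpha> \<noteq> 0" and v: "v \<in> W"
  obtains z where "z \<in> ann \<alpha>" "v = (\<lambda>t. (\<Sum>k<n. (L (\<alpha>[k := v]) / L \<alpha>) * (\<alpha> ! k) t) + z t)"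
proof
  define c where "c k = L (\<alpha>[k := v]) / L \<alpha>" for k
  define S where "S = (\<lambda>t. \<Sum>k<n. c k * (\<alpha> ! k) t)"
  define z where "z = (\<lambda>t. v t - S t)"
  have aW: "\<alpha> ! i \<in> W" if "i < n" for i using \<alpha> that by (auto simp: subset_iff)
  have SW: "S \<in> W" unfolding S_def by (rule fun_subspace_sum[OF W]) (use aW in auto)
  have zW: "z \<in> W" using fun_subspaceD(2)[OF W v SW, of 1 "-1"] by (simp add: z_def)
  have "L (\<alpha>[i := z]) = 0" if i: "i < n" for i
  proof -
    have "L (\<alpha>[i := z]) = L (\<alpha>[i := v]) - L (\<alpha>[i := S])"
      unfolding z_def by (rule alternating_on_diff_arg[OF L \<alpha>(1,2) i v SW])
    also have "L (\<alpha>[i := S]) = (\<Sum>k<n. c k * L (\<alpha>[i := \<alpha> ! k]))"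
      unfolding S_def by (rule alternating_on_sum[OF L W \<alpha>(1,2) i]) (use aW in auto)
    also have "\<dots> = (\<Sum>k<n. if k = i then c k * L \<alpha> else 0)"
    proof (rule sum.cong[OF refl])
      fix k assume k: "k \<in> {..<n}"
      have "L (\<alpha>[i := \<alpha> ! k]) = 0" if "k \<noteq> i"
        by (rule alternating_on_update_eq[OF L \<alpha>(1,2), of _ i k]) (use aW i k that in auto)
      then show "c k * L (\<alpha>[i := \<alpha> ! k]) = (if k = i then c k * L \<alpha> else 0)" by simp
    qed
    also have "\<dots> = L (\<alpha>[i := v])" using i \<alpha>(3) by (simp add: c_def)
    finally show ?thesis by simp
  qed
  then show "z \<in> ann \<alpha>" using zW by (simp add: ann_def)
  show "v = (\<lambda>t. (\<Sum>k<n. (L (\<alpha>[k := v]) / L \<alpha>) * (\<alpha> ! k) t) + z t)"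
    by (simp add: z_def S_def c_def)
qed

text \<open>The Pluecker relations, as an exchange between the tuples \<delta> and \<alpha>: by
  \<open>annihilator\<close> the remainder of Cramer's rule drops out of every tuple, not only of
  those built from \<alpha>.\<close>

lemma expand:
  assumes \<alpha>: "length \<alpha> = n" "set \<alpha> \<subseteq> W" "L \<alpha> \<noteq> 0" and v: "v \<in> W"
    and \<delta>: "length \<delta> = n" "set \<delta> \<subseteq> W" "j < n"
  shows "L (\<delta>[j := v]) = (\<Sum>k<n. (L (\<alpha>[k := v]) / L \<alpha>) * L (\<delta>[j := \<alpha> ! k]))"
proof -
  obtain z where z: "z \<in> ann \<alpha>" and veq: "v = (\<lambda>t. (\<Sum>k<n. (L (\<alpha>[k := v]) / L \<alpha>) * (\<alpha> ! k) t) + z t)"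
    by (rule decompose[OF \<alpha> v])
  let ?S = "\<lambda>t. \<Sum>k<n. (L (\<alpha>[k := v]) / L \<alpha>) * (\<alpha> ! k) t"
  have aW: "\<alpha> ! i \<in> W" if "i < n" for i using \<alpha> that by (auto simp: subset_iff)
  have SW: "?S \<in> W" by (rule fun_subspace_sum[OF W]) (use aW in auto)
  have zW: "z \<in> W" using z by (simp add: ann_def)
  have "L (\<delta>[j := v]) = L (\<delta>[j := (\<lambda>t. ?S t + z t)])" by (rule arg_cong[OF veq, of "\<lambda>v. L (\<delta>[j := v])"])
  also have "\<dots> = L (\<delta>[j := ?S]) + L (\<delta>[j := z])"
    by (rule alternating_on_add[OF L \<delta> SW zW])
  also have "L (\<delta>[j := z]) = 0"
    by (rule ann_vanish[OF \<alpha> _ set_list_update_subset[OF \<delta>(2) zW] \<delta>(3)]) (use \<delta> z in auto)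
  also have "L (\<delta>[j := ?S]) = (\<Sum>k<n. (L (\<alpha>[k := v]) / L \<alpha>) * L (\<delta>[j := \<alpha> ! k]))"
    by (rule alternating_on_sum[OF L W \<delta>]) (use aW in auto)
  finally show ?thesis by simp
qed

text \<open>The three-term Pluecker relation. When \<open>v\<close> is expanded, the indices other
  than \<open>i\<close> and \<open>j\<close> produce tuples with a repeated entry.\<close>

lemma two_entries:
  assumes \<alpha>: "length \<alpha> = n" "set \<alpha> \<subseteq> W" and u: "u \<in> W" and v: "v \<in> W"
    and ij: "i < n" "j < n" "i \<noteq> j" and nz: "L \<alpha> \<noteq> 0"
  shows "L \<alpha> * L (\<alpha>[i := u, j := v]) = L (\<alpha>[i := u]) * L (\<alpha>[j := v]) - L (\<alpha>[j := u]) * L (\<alpha>[i := v])"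
proof -
  let ?\<delta> = "\<alpha>[i := u]"
  let ?f = "\<lambda>k. (L (\<alpha>[k := v]) / L \<alpha>) * L (?\<delta>[j := \<alpha> ! k])"
  have aW: "\<alpha> ! i \<in> W" if "i < n" for i using \<alpha> that by (auto simp: subset_iff)
  have \<delta>: "length ?\<delta> = n" "set ?\<delta> \<subseteq> W" using \<alpha> set_list_update_subset[OF \<alpha>(2) u] by auto
  have "L (?\<delta>[j := v]) = sum ?f {..<n}" by (rule expand[OF \<alpha> nz v \<delta> ij(2)])
  also have "\<dots> = sum ?f {i, j}"
  proof (rule sum.mono_neutral_right)
    show "\<forall>k\<in>{..<n} - {i, j}. ?f k = 0"
    proof
      fix k assume k: "k \<in> {..<n} - {i, j}"
      have "L (?\<delta>[j := \<alpha> ! k]) = 0"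
        by (rule alternating_on_update_eq[OF L \<delta>, of _ j k]) (use aW ij k in auto)
      then show "?f k = 0" by simp
    qed
  qed (use ij in auto)
  also have "\<dots> = ?f i + ?f j" using ij by simp
  also have "L (?\<delta>[j := \<alpha> ! i]) = - L (\<alpha>[i := \<alpha> ! i, j := u])"
    by (rule alternating_on_swap[OF L W \<alpha> ij u]) (use aW ij in auto)
  also have "\<dots> = - L (\<alpha>[j := u])" by simp
  also have "?\<delta>[j := \<alpha> ! j] = ?\<delta>"
    using ij by (metis list_update_id list_update_swap)
  finally show ?thesis using nz by (simp add: field_simps)
qed

end

text \<open>The vectors \<open>X' i\<close> lie in the span of the \<open>X i\<close>, on which
  \<nu> and the wedge product of \<alpha>' are proportional. The latter takes the value
  \<open>L \<alpha>' ^ n\<close> on \<open>X'\<close> but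
  \<open>L \<alpha>' * L \<alpha> ^ (n - 1)\<close> on \<open>X\<close>; this is where the powers
  come from.\<close>

lemma interior_power_independent:
  assumes nt: "nambu_tensor (linear_dual V) n L" and F: "dual_frames V m e \<epsilon>"
    and \<alpha>: "length \<alpha> = n" "set \<alpha> \<subseteq> linear_dual V" "L \<alpha> \<noteq> 0"
    and \<alpha>': "length \<alpha>' = n" "set \<alpha>' \<subseteq> linear_dual V" "L \<alpha>' \<noteq> 0"
    and X: "\<And>i. i < n \<Longrightarrow> X i \<in> V" "\<And>i \<beta>. i < n \<Longrightarrow> \<beta> \<in> linear_dual V \<Longrightarrow> \<beta> (X i) = L (\<alpha>[i := \<beta>])"
    and X': "\<And>i. i < n \<Longrightarrow> X' i \<in> V" "\<And>i \<beta>. i < n \<Longrightarrow> \<beta> \<in> linear_dual V \<Longrightarrow> \<beta> (X' i) = L (\<alpha>'[i := \<beta>])"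
    and \<nu>: "alternating_on V n \<nu>"
  shows "\<nu> (map X' [0..<n]) * L \<alpha> ^ (n - 1) = \<nu> (map X [0..<n]) * L \<alpha>' ^ (n - 1)"
proof -
  interpret nambu_tensor "linear_dual V" n L by (rule nt)
  note V = dual_framesD(1)[OF F]
  let ?X = "map X [0..<n]" and ?X' = "map X' [0..<n]"
  have XV: "set ?X \<subseteq> V" "set ?X' \<subseteq> V" using X(1) X'(1) by auto
  have aW: "\<alpha> ! i \<in> linear_dual V" if "i < n" for i using \<alpha> that by (auto simp: subset_iff)
  have aW': "\<alpha>' ! i \<in> linear_dual V" if "i < n" for i using \<alpha>' that by (auto simp: subset_iff)
  \<comment> \<open>The matrix is diagonal with all diagonal entries equal to
    \<open>L \<gamma>\<close>, since putting one entry of \<gamma> into another position makes two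
    entries equal.\<close>
  have diag: "wedge V \<gamma> (map Y [0..<n]) = L \<gamma> ^ n"
    if \<gamma>: "length \<gamma> = n" "set \<gamma> \<subseteq> linear_dual V"
      and Y: "\<And>i. i < n \<Longrightarrow> Y i \<in> V" "\<And>i \<beta>. i < n \<Longrightarrow> \<beta> \<in> linear_dual V \<Longrightarrow> \<beta> (Y i) = L (\<gamma>[i := \<beta>])" for \<gamma> Y
  proof -
    have gW: "\<gamma> ! i \<in> linear_dual V" if "i < n" for i using \<gamma> that by (auto simp: subset_iff)
    have "wedge V \<gamma> (map Y [0..<n]) = ndet n (\<lambda>i j. (\<gamma> ! i) (map Y [0..<n] ! j))"
      using \<gamma> Y(1) by (auto simp: wedge_ndet)
    also have "\<dots> = (\<Prod>i<n. (\<gamma> ! i) (map Y [0..<n] ! i))"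
    proof (rule ndet_diagonal)
      fix i j assume ij: "i < n" "j < n" "i \<noteq> j"
      have "L (\<gamma>[j := \<gamma> ! i]) = 0"
        by (rule alternating_on_update_eq[OF L \<gamma>, of _ j i]) (use gW ij in auto)
      then show "(\<gamma> ! i) (map Y [0..<n] ! j) = 0" using Y(2)[OF ij(2) gW[OF ij(1)]] ij by simp
    qed
    also have "\<dots> = (\<Prod>i<n. L \<gamma>)"
      using Y(2)[OF _ gW] by (intro prod.cong refl) simp
    finally show ?thesis by simp
  qed
  define D where "D = {(\<lambda>t. \<Sum>i<n. c i * X i t) | c. True}"
  have D: "fun_subspace D"
    unfolding fun_subspace_def
  proof (intro conjI ballI allI)
    show "(\<lambda>_. 0) \<in> D" unfolding D_def by (rule CollectI, rule exI[of _ "\<lambda>_. 0"]) simp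
    fix u v a b assume "u \<in> D" "v \<in> D"
    then obtain c d where "u = (\<lambda>t. \<Sum>i<n. c i * X i t)" "v = (\<lambda>t. \<Sum>i<n. d i * X i t)"
      unfolding D_def by blast
    then have "(\<lambda>t. a * u t + b * v t) = (\<lambda>t. \<Sum>i<n. (a * c i + b * d i) * X i t)"
      by (simp add: sum_distrib_left sum.distrib algebra_simps)
    then show "(\<lambda>t. a * u t + b * v t) \<in> D" by (auto simp: D_def)
  qed
  have DV: "D \<subseteq> V" by (auto simp: D_def intro!: fun_subspace_sum[OF V] X(1))
  have XD: "X i \<in> D" if "i < n" for i
  proof -
    have "(\<Sum>j<n. (if j = i then 1 else 0) * X j t) = (\<Sum>j<n. if j = i then X j t else 0)" for t
      by (rule sum.cong) auto
    then have "X i = (\<lambda>t. \<Sum>j<n. (if j = i then 1 else 0) * X j t)" using that by simp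
    then show ?thesis
      unfolding D_def by (intro CollectI exI[of _ "\<lambda>j. if j = i then 1 else 0"] conjI TrueI)
  qed
  have X'D: "X' i \<in> D" if i: "i < n" for i
  proof -
    define c where "c k = L (\<alpha>'[i := \<alpha> ! k]) / L \<alpha>" for k
    have "X' i = (\<lambda>t. \<Sum>k<n. c k * X k t)"
    proof (rule dual_frames_ext[OF F X'(1)[OF i]])
      show "(\<lambda>t. \<Sum>k<n. c k * X k t) \<in> V" by (rule fun_subspace_sum[OF V]) (use X(1) in auto)
      fix \<beta> assume \<beta>: "\<beta> \<in> linear_dual V"
      have "\<beta> (\<lambda>t. \<Sum>k<n. c k * X k t) = (\<Sum>k<n. c k * \<beta> (X k))"
        by (rule linear_dual_sum[OF \<beta> V]) (use X(1) in auto)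
      also have "\<dots> = (\<Sum>k<n. (L (\<alpha>[k := \<beta>]) / L \<alpha>) * L (\<alpha>'[i := \<alpha> ! k]))"
        using X(2)[OF _ \<beta>] by (intro sum.cong) (auto simp: c_def)
      also have "\<dots> = L (\<alpha>'[i := \<beta>])" by (rule expand[OF \<alpha> \<beta> \<alpha>'(1,2) i, symmetric])
      finally show "\<beta> (X' i) = \<beta> (\<lambda>t. \<Sum>k<n. c k * X k t)" using X'(2)[OF i \<beta>] by simp
    qed
    then show ?thesis by (auto simp: D_def)
  qed
  have wD: "alternating_on D n (wedge V \<alpha>')"
    using wedge_alternating[OF V \<alpha>'(1,2)] DV by (auto simp: alternating_maps_iff intro: alternating_on_subset)
  \<comment> \<open>A form of top degree on the span \<open>D\<close> that vanishes on
    \<open>X\<close>, hence also on \<open>X'\<close>.\<close>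
  let ?H = "\<lambda>Ys. \<nu> Ys * wedge V \<alpha>' ?X - wedge V \<alpha>' Ys * \<nu> ?X"
  have H: "alternating_on D n ?H"
    by (intro alternating_on_diff alternating_on_scale wD alternating_on_subset[OF \<nu> DV])
  have "?H ?X' = 0"
  proof (rule alternating_on_span_eq_zeroI[OF H D, where e=X and r=n])
    show "\<exists>c. v = (\<lambda>t. \<Sum>i<n. c i * X i t)" if "v \<in> D" for v
      using that by (auto simp: D_def)
  qed (use XD X'D sorted_wrt_less_upt in auto)
  then have 1: "\<nu> ?X' * wedge V \<alpha>' ?X = L \<alpha>' ^ n * \<nu> ?X"
    using diag[OF \<alpha>'(1,2) X'] by simp
  \<comment> \<open>Both terms are alternating in \<gamma>, vanish when an entry lies in
    \<open>ann \<alpha>\<close>, and agree for \<open>\<gamma> = \<alpha>\<close>; hence they agree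
    throughout.\<close>
  let ?K = "\<lambda>\<gamma>. wedge V \<gamma> ?X * L \<alpha> - L \<gamma> * wedge V \<alpha> ?X"
  have "?K \<alpha>' = 0"
  proof (rule alternating_on_top_eq_zeroI[OF _ W, where P="?K" and e="\<lambda>i. \<alpha> ! i" and Z="ann \<alpha>"])
    show "alternating_on (linear_dual V) n ?K"
      by (intro alternating_on_diff alternating_on_scale L wedge_alternating_left) (use XV in auto)
    show "\<exists>c z. z \<in> ann \<alpha> \<and> v = (\<lambda>t. (\<Sum>i<n. c i * (\<alpha> ! i) t) + z t)" if v: "v \<in> linear_dual V" for v
    proof -
      obtain z where "z \<in> ann \<alpha>" "v = (\<lambda>t. (\<Sum>k<n. (L (\<alpha>[k := v]) / L \<alpha>) * (\<alpha> ! k) t) + z t)"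
        by (rule decompose[OF \<alpha> v])
      then show ?thesis by (intro exI[of _ "\<lambda>k. L (\<alpha>[k := v]) / L \<alpha>"] exI[of _ z] conjI)
    qed
    show "ann \<alpha> \<subseteq> linear_dual V" by (auto simp: ann_def)
    show "?K vs = 0" if vs: "length vs = n" "set vs \<subseteq> linear_dual V" "i < n" "vs ! i \<in> ann \<alpha>" for vs i
    proof -
      have vi: "vs ! i \<in> linear_dual V" using vs(4) by (simp add: ann_def)
      have "(vs ! i) (?X ! j) = 0" if "j < n" for j
        using X(2)[OF that vi] vs(4) that by (simp add: ann_def)
      then have "ndet n (\<lambda>i j. (vs ! i) (?X ! j)) = 0"
        by (rule ndet_row_zero[OF vs(3)])
      then have "wedge V vs ?X = 0"
        using vs(1) XV by (simp add: wedge_ndet)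
      moreover have "L vs = 0" by (rule ann_vanish[OF \<alpha> vs])
      ultimately show ?thesis by simp
    qed
    have "map (\<lambda>i. \<alpha> ! i) [0..<n] = \<alpha>" using \<alpha>(1) map_nth by blast
    then show "?K (map (\<lambda>i. \<alpha> ! i) [0..<n]) = 0" by simp
  qed (use aW \<alpha>' in auto)
  then have 2: "wedge V \<alpha>' ?X * L \<alpha> = L \<alpha>' * L \<alpha> ^ n"
    using diag[OF \<alpha>(1,2) X] by simp
  have n: "L \<gamma> ^ n = L \<gamma> * L \<gamma> ^ (n - 1)" for \<gamma>
    using n3 by (cases n) auto
  have "wedge V \<alpha>' ?X = L \<alpha>' * L \<alpha> ^ (n - 1)" using 2 \<alpha>(3) by (simp add: n[of \<alpha>])
  then show ?thesis using 1 \<alpha>'(3) by (simp add: n[of \<alpha>'])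
qed

section \<open>Vector fields and Lie derivatives\<close>

context manifold
begin

abbreviation "V \<equiv> vector_fields A"
abbreviation "d \<equiv> differential A"
abbreviation "T' p \<equiv> linear_dual (T p)"

lemma V_D: "X \<in> V \<Longrightarrow> X p \<in> T p" "X \<in> V \<Longrightarrow> f \<in> C \<Longrightarrow> (\<lambda>p. X p f) \<in> C"
  by (auto simp: vector_fields_def)

lemma V_list: "set Xs \<subseteq> V \<Longrightarrow> set (map (\<lambda>X. X p) Xs) \<subseteq> T p"
  using V_D(1) by auto

lemma tangentI:
  assumes "\<And>f g a b. f \<in> C \<Longrightarrow> g \<in> C \<Longrightarrow> v (\<lambda>t. a * f t + b * g t) = a * v f + b * v g"
    and "\<And>f. f \<notin> C \<Longrightarrow> v f = 0"
    and "\<And>f g. f \<in> C \<Longrightarrow> g \<in> C \<Longrightarrow> v (\<lambda>t. f t * g t) = f p * v g + g p * v f"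
  shows "v \<in> T p"
  using assms unfolding tangent_space_def linear_dual_def by simp

lemma T_subspace: "fun_subspace (T p)"
  unfolding fun_subspace_def
proof (intro conjI ballI allI)
  show "(\<lambda>_. 0) \<in> T p" by (rule tangentI) auto
  fix u v a b assume uv: "u \<in> T p" "v \<in> T p"
  show "(\<lambda>t. a * u t + b * v t) \<in> T p"
    by (rule tangentI)
      (simp_all add: tangentD[OF uv(1)] tangentD[OF uv(2)] algebra_simps)
qed

lemma V_lin:
  assumes "X \<in> V" "Y \<in> V" "a \<in> C" "b \<in> C"
  shows "(\<lambda>p f. a p * X p f + b p * Y p f) \<in> V"
  unfolding vector_fields_def
proof (intro CollectI conjI allI ballI)
  show "(\<lambda>f. a p * X p f + b p * Y p f) \<in> T p" for p
    using fun_subspaceD(2)[OF T_subspace V_D(1)[OF assms(1)] V_D(1)[OF assms(2)]] .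
  show "(\<lambda>p. a p * X p f + b p * Y p f) \<in> C" if "f \<in> C" for f
    by (intro C_add C_mult assms(3,4) V_D(2)[OF assms(1) that] V_D(2)[OF assms(2) that])
qed

lemma V_zero: "(\<lambda>p f. 0) \<in> V"
  using fun_subspaceD(1)[OF T_subspace] C_const[of 0] by (simp add: vector_fields_def)

lemma V_sum:
  assumes "\<And>i. i \<in> I \<Longrightarrow> X i \<in> V" "\<And>i. i \<in> I \<Longrightarrow> a i \<in> C"
  shows "(\<lambda>p f. \<Sum>i\<in>I. a i p * X i p f) \<in> V"
  using assms
proof (induction I rule: infinite_finite_induct)
  case (insert i I)
  then show ?case
    using V_lin[of "X i" "\<lambda>p f. \<Sum>i\<in>I. a i p * X i p f" "a i" "\<lambda>_. 1"] C_const by simp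
qed (simp_all add: V_zero)

lemma d_dual: "d f p \<in> T' p"
  unfolding linear_dual_def mem_Collect_eq
  by (intro conjI ballI allI impI) (simp_all add: differential_def fun_subspaceD(2)[OF T_subspace])

lemma d_apply: "v \<in> T p \<Longrightarrow> d f p v = v f"
  by (simp add: differential_def)

lemma d_list: "set (map (\<lambda>f. d f p) fs) \<subseteq> T' p"
  using d_dual by auto

lemma d_lin: "f \<in> C \<Longrightarrow> g \<in> C \<Longrightarrow> d (\<lambda>t. a * f t + b * g t) p = (\<lambda>v. a * d f p v + b * d g p v)"
  by (rule ext) (simp add: differential_def tangentD(1))

lemma d_mult: "f \<in> C \<Longrightarrow> g \<in> C \<Longrightarrow> d (\<lambda>t. f t * g t) p = (\<lambda>v. f p * d g p v + g p * d f p v)"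
  by (rule ext) (simp add: differential_def tangentD(3))

lemma d_sum:
  assumes "\<And>i. i \<in> I \<Longrightarrow> f i \<in> C"
  shows "d (\<lambda>t. \<Sum>i\<in>I. c i * f i t) p = (\<lambda>v. \<Sum>i\<in>I. c i * d (f i) p v)"
proof
  fix v
  show "d (\<lambda>t. \<Sum>i\<in>I. c i * f i t) p v = (\<Sum>i\<in>I. c i * d (f i) p v)"
  proof (cases "v \<in> T p")
    case True
    have "v (\<lambda>t. \<Sum>i\<in>I. c i * f i t) = (\<Sum>i\<in>I. v (\<lambda>t. c i * f i t))"
      by (rule tangent_sum[OF True C_scale[OF assms]])
    also have "\<dots> = (\<Sum>i\<in>I. c i * v (f i))"
      by (intro sum.cong refl tangent_scale[OF True assms])
    finally show ?thesis using True by (simp add: d_apply)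
  qed (simp add: differential_def)
qed

lemma d_one_form: "f \<in> C \<Longrightarrow> d f \<in> one_forms A"
  unfolding one_forms_def mem_Collect_eq
proof (intro conjI allI ballI)
  fix X assume "f \<in> C" and X: "X \<in> V"
  then show "(\<lambda>p. d f p (X p)) \<in> C" using V_D(2)[OF X] by (simp only: d_apply[OF V_D(1)[OF X]])
qed (rule d_dual)

section \<open>Local frames and extension of pointwise data\<close>

lemma local_frame:
  obtains x :: "nat \<Rightarrow> 'a \<Rightarrow> real" and E :: "nat \<Rightarrow> 'a vfield" and N where
    "open N" "p \<in> N" "\<And>i. x i \<in> C" "\<And>i. E i \<in> V"
    "\<And>q. q \<in> N \<Longrightarrow> dual_frames (T q) CARD('m) (\<lambda>i. E i q) (\<lambda>i. d (x i) q)"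
proof -
  obtain x E N where N: "open N" "p \<in> N" and x: "\<And>i::'m. x i \<in> C" and E: "\<And>i. E i \<in> V"
    and dual: "\<And>i j q. q \<in> N \<Longrightarrow> E i q (x j) = (if i = j then 1 else 0)"
    and span: "\<And>q v f. q \<in> N \<Longrightarrow> v \<in> T q \<Longrightarrow> f \<in> C \<Longrightarrow> v f = (\<Sum>i\<in>UNIV. v (x i) * E i q f)"
    by (rule coordinate_frame[of p]) (rule that)
  obtain h :: "nat \<Rightarrow> 'm" where h: "bij_betw h {..<CARD('m)} UNIV"
    using ex_bij_betw_nat_finite[of "UNIV :: 'm set"] by (auto simp: atLeast0LessThan)
  show thesis
  proof (rule that[OF N, of "\<lambda>i. x (h i)" "\<lambda>i. E (h i)"])
    fix q assume q: "q \<in> N"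
    show "dual_frames (T q) CARD('m) (\<lambda>i. E (h i) q) (\<lambda>i. d (x (h i)) q)"
      unfolding dual_frames_def
    proof (intro conjI allI impI ballI)
      show "d (x (h i)) q (E (h j) q) = (if i = j then 1 else 0)" if "i < CARD('m)" "j < CARD('m)" for i j
        using that h V_D(1)[OF E] by (auto simp: d_apply dual[OF q] bij_betw_def inj_on_def)
      show "v = (\<lambda>f. \<Sum>i<CARD('m). d (x (h i)) q v * E (h i) q f)" if v: "v \<in> T q" for v
      proof
        fix f
        show "v f = (\<Sum>i<CARD('m). d (x (h i)) q v * E (h i) q f)"
        proof (cases "f \<in> C")
          case True
          have "(\<Sum>i<CARD('m). d (x (h i)) q v * E (h i) q f) = (\<Sum>i\<in>UNIV. d (x i) q v * E i q f)"
            by (rule sum.reindex_bij_betw[OF h])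
          then show ?thesis using span[OF q v True] v by (simp add: d_apply)
        next
          case False
          then show ?thesis using tangentD(2)[OF v] tangentD(2)[OF V_D(1)[OF E]] by simp
        qed
      qed
    qed (simp_all add: T_subspace V_D(1)[OF E] d_dual)
  qed (use x E in auto)
qed

lemma frame_at: obtains e \<epsilon> where "dual_frames (T p) CARD('m) e \<epsilon>"
proof -
  obtain x :: "nat \<Rightarrow> 'a \<Rightarrow> real" and E N where "p \<in> N"
    and "\<And>q. q \<in> N \<Longrightarrow> dual_frames (T q) CARD('m) (\<lambda>i. E i q) (\<lambda>i. d (x i) q)"
    by (rule local_frame[of p]) (rule that)
  then show thesis using that by blast
qed

text \<open>A linear combination of coordinate functions does it. Pointwise statements about
  \<Lambda> thereby become statements about brackets of global functions, and conversely.\<close>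

lemma covector_differential:
  assumes "\<alpha> \<in> T' p" obtains f where "f \<in> C" "\<alpha> = d f p"
proof -
  obtain x E N where N: "p \<in> N" and x: "\<And>i::nat. x i \<in> C"
    and F: "\<And>q. q \<in> N \<Longrightarrow> dual_frames (T q) CARD('m) (\<lambda>i. E i q) (\<lambda>i. d (x i) q)"
    by (rule local_frame[of p]) (rule that)
  show thesis
  proof (rule that)
    show "(\<lambda>t. \<Sum>i<CARD('m). \<alpha> (E i p) * x i t) \<in> C" by (intro C_sum C_scale x)
    show "\<alpha> = d (\<lambda>t. \<Sum>i<CARD('m). \<alpha> (E i p) * x i t) p"
      using dual_frames_dual[OF F[OF N] assms] by (simp add: d_sum x)
  qed
qed

lemma covectors_differentials:
  assumes "set \<alpha>s \<subseteq> T' p"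
  obtains fs where "set fs \<subseteq> C" "length fs = length \<alpha>s" "\<alpha>s = map (\<lambda>f. d f p) fs"
proof -
  have "\<exists>fs. set fs \<subseteq> C \<and> length fs = length \<alpha>s \<and> \<alpha>s = map (\<lambda>f. d f p) fs"
    using assms
  proof (induction \<alpha>s)
    case (Cons \<alpha> \<alpha>s)
    then obtain fs where "set fs \<subseteq> C" "length fs = length \<alpha>s" "\<alpha>s = map (\<lambda>f. d f p) fs" by auto
    moreover obtain f where "f \<in> C" "\<alpha> = d f p" using Cons.prems covector_differential[of \<alpha> p] by auto
    ultimately show ?case by (intro exI[of _ "f # fs"]) simp
  qed simp
  then show thesis using that by blast
qed

text \<open>Constant coefficients with respect to a frame; the fields of the frame are global
  because they were cut off.\<close>

lemma vectors_fields:
  assumes "set vs \<subseteq> T p"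
  obtains Xs where "set Xs \<subseteq> V" "length Xs = length vs" "vs = map (\<lambda>X. X p) Xs"
proof -
  obtain x E N where N: "p \<in> N" and E: "\<And>i::nat. E i \<in> V"
    and F: "\<And>q. q \<in> N \<Longrightarrow> dual_frames (T q) CARD('m) (\<lambda>i. E i q) (\<lambda>i. d (x i) q)"
    by (rule local_frame[of p]) (rule that)
  define X where "X v = (\<lambda>q f. \<Sum>i<CARD('m). d (x i) p v * E i q f)" for v
  have XV: "X v \<in> V" for v
    unfolding X_def using V_sum[of "{..<CARD('m)}" E "\<lambda>i _. d (x i) p v"] E C_const by simp
  have "vs = map (\<lambda>X. X p) (map X vs)"
    using assms dual_framesD(5)[OF F[OF N]] by (auto simp: o_def X_def intro!: map_idI[symmetric])
  then show thesis using XV by (intro that[of "map X vs"]) auto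
qed

section \<open>Lie brackets and Lie derivatives of forms\<close>

lemma form_alternating: "\<omega> \<in> forms A k \<Longrightarrow> alternating_on (T p) k (\<omega> p)"
  by (simp add: forms_def alternating_maps_iff)

lemma form_outside: "\<omega> \<in> forms A k \<Longrightarrow> \<not> (length vs = k \<and> set vs \<subseteq> T p) \<Longrightarrow> \<omega> p vs = 0"
  by (simp add: forms_def alternating_maps_iff)

lemma form_smooth:
  "\<omega> \<in> forms A k \<Longrightarrow> length Xs = k \<Longrightarrow> set Xs \<subseteq> V \<Longrightarrow> (\<lambda>p. \<omega> p (map (\<lambda>X. X p) Xs)) \<in> C"
  by (simp add: forms_def)

lemma bracket_vf:
  assumes "X \<in> V" "Y \<in> V"
  shows "lie_bracket X Y \<in> V"
  unfolding vector_fields_def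
proof (intro CollectI conjI allI ballI)
  fix p
  have X: "X p \<in> T p" "\<And>q. X q \<in> T q" and Y: "Y p \<in> T p" "\<And>q. Y q \<in> T q" using V_D assms by auto
  show "lie_bracket X Y p \<in> T p"
  proof (rule tangentI)
    fix f g assume fg: "f \<in> C" "g \<in> C"
    note S = V_D(2)[OF assms(1)] V_D(2)[OF assms(2)]
    show "lie_bracket X Y p (\<lambda>t. a * f t + b * g t) = a * lie_bracket X Y p f + b * lie_bracket X Y p g" for a b
      using fg by (simp add: lie_bracket_def tangentD(1)[OF X(2)] tangentD(1)[OF Y(2)] S algebra_simps)
    show "lie_bracket X Y p (\<lambda>t. f t * g t) = f p * lie_bracket X Y p g + g p * lie_bracket X Y p f"
      using fg by (simp add: lie_bracket_def tangentD(3)[OF X(2)] tangentD(3)[OF Y(2)]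
          tangent_add[OF X(1)] tangent_add[OF Y(1)] S C_mult algebra_simps)
  next
    fix f assume "f \<notin> C"
    then show "lie_bracket X Y p f = 0"
      using tangentD(2)[OF X(2)] tangentD(2)[OF Y(2)] tangent_const[OF X(1)] tangent_const[OF Y(1)]
      by (simp add: lie_bracket_def)
  qed
  show "(\<lambda>p. lie_bracket X Y p f) \<in> C" if "f \<in> C" for f
    unfolding lie_bracket_def
    by (intro C_diff V_D(2)[OF assms(1)] V_D(2)[OF assms(2)] that)
qed

text \<open>The factors \<open>1\<close> put the right-hand side into the shape
  \<open>a * u + b * v\<close> of the multilinearity rule.\<close>

lemma bracket_lin:
  assumes X: "X \<in> V" and UW: "U \<in> V" "W \<in> V" and ab: "a \<in> C" "b \<in> C"
  shows "lie_bracket X (\<lambda>p f. a p * U p f + b p * W p f) p =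
    (\<lambda>f. 1 * (X p a * U p f + a p * lie_bracket X U p f) + 1 * (X p b * W p f + b p * lie_bracket X W p f))"
proof
  fix f
  show "lie_bracket X (\<lambda>p f. a p * U p f + b p * W p f) p f =
    1 * (X p a * U p f + a p * lie_bracket X U p f) + 1 * (X p b * W p f + b p * lie_bracket X W p f)"
  proof (cases "f \<in> C")
    case True
    note S = V_D(2)[OF X True] V_D(2)[OF UW(1) True] V_D(2)[OF UW(2) True]
    show ?thesis
      by (simp add: lie_bracket_def tangent_add[OF V_D(1)[OF X]] tangentD(3)[OF V_D(1)[OF X]] S ab C_mult
          algebra_simps)
  next
    case False
    have z: "Y p f = 0" if "Y \<in> V" for Y p using tangentD(2)[OF V_D(1)[OF that] False] .
    show ?thesis
      by (simp add: z[OF bracket_vf[OF X V_lin[OF UW ab]]] z[OF bracket_vf[OF X UW(1)]]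
          z[OF bracket_vf[OF X UW(2)]] z[OF UW(1)] z[OF UW(2)])
  qed
qed

lemma lie_derivative_update:
  assumes "length Ys = k" "i < k"
  shows "lie_derivative X \<omega> (Ys[i := Z]) p =
    X p (\<lambda>q. \<omega> q ((map (\<lambda>Y. Y q) Ys)[i := Z q])) -
    (\<omega> p ((map (\<lambda>Y. Y p) Ys)[i := lie_bracket X Z p]) +
     (\<Sum>l\<in>{..<k} - {i}. \<omega> p ((map (\<lambda>Y. Y p) Ys)[l := lie_bracket X (Ys ! l) p, i := Z p])))"
proof -
  have "(\<Sum>l<k. \<omega> p (map (\<lambda>Y. Y p) (Ys[i := Z, l := lie_bracket X (Ys[i := Z] ! l)]))) =
      \<omega> p ((map (\<lambda>Y. Y p) Ys)[i := lie_bracket X Z p]) +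
      (\<Sum>l\<in>{..<k} - {i}. \<omega> p (map (\<lambda>Y. Y p) (Ys[i := Z, l := lie_bracket X (Ys[i := Z] ! l)])))"
    using assms by (subst sum.remove[of _ i]) (auto simp: map_update)
  also have "(\<Sum>l\<in>{..<k} - {i}. \<omega> p (map (\<lambda>Y. Y p) (Ys[i := Z, l := lie_bracket X (Ys[i := Z] ! l)]))) =
      (\<Sum>l\<in>{..<k} - {i}. \<omega> p ((map (\<lambda>Y. Y p) Ys)[l := lie_bracket X (Ys ! l) p, i := Z p]))"
  proof (rule sum.cong[OF refl])
    fix l assume "l \<in> {..<k} - {i}"
    then have "l \<noteq> i" by simp
    then show "\<omega> p (map (\<lambda>Y. Y p) (Ys[i := Z, l := lie_bracket X (Ys[i := Z] ! l)])) =
        \<omega> p ((map (\<lambda>Y. Y p) Ys)[l := lie_bracket X (Ys ! l) p, i := Z p])"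
      by (simp add: map_update list_update_swap[of l i])
  qed
  finally show ?thesis unfolding lie_derivative_def using assms by (simp add: map_update)
qed

text \<open>Linearity over functions: the terms with \<open>X p a\<close> and \<open>X p b\<close>
  that come from differentiating the value of the form cancel those that come from the
  bracket.\<close>

lemma lie_derivative_lin:
  assumes X: "X \<in> V" and \<omega>: "\<omega> \<in> forms A k" and Ys: "length Ys = k" "set Ys \<subseteq> V" and i: "i < k"
    and UW: "U \<in> V" "W \<in> V" and ab: "a \<in> C" "b \<in> C"
  shows "lie_derivative X \<omega> (Ys[i := (\<lambda>p f. a p * U p f + b p * W p f)]) p =
    a p * lie_derivative X \<omega> (Ys[i := U]) p + b p * lie_derivative X \<omega> (Ys[i := W]) p"
proof -
  let ?vs = "\<lambda>q. map (\<lambda>Y. Y q) Ys"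
  have vs: "length (?vs q) = k" "set (?vs q) \<subseteq> T q" for q using Ys V_list by auto
  note alt = alternating_on_lin[OF form_alternating[OF \<omega>]]
  note XT = V_D(1)[OF X]
  have F: "(\<lambda>q. \<omega> q ((?vs q)[i := Z q])) \<in> C" if "Z \<in> V" for Z
    using form_smooth[OF \<omega>, of "Ys[i := Z]"] Ys that by (simp add: map_update set_list_update_subset)
  have 1: "X p (\<lambda>q. \<omega> q ((?vs q)[i := (\<lambda>f. a q * U q f + b q * W q f)])) =
      a p * X p (\<lambda>q. \<omega> q ((?vs q)[i := U q])) + X p a * \<omega> p ((?vs p)[i := U p]) +
      (b p * X p (\<lambda>q. \<omega> q ((?vs q)[i := W q])) + X p b * \<omega> p ((?vs p)[i := W p]))"
    by (subst alt[OF vs i V_D(1)[OF UW(1)] V_D(1)[OF UW(2)]])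
      (simp add: tangent_add[OF XT] tangentD(3)[OF XT] F UW ab C_mult)
  have B: "lie_bracket X U p \<in> T p" "lie_bracket X W p \<in> T p" "U p \<in> T p" "W p \<in> T p"
    using bracket_vf[OF X] UW V_D(1) by auto
  have 2: "\<omega> p ((?vs p)[i := lie_bracket X (\<lambda>p f. a p * U p f + b p * W p f) p]) =
      X p a * \<omega> p ((?vs p)[i := U p]) + a p * \<omega> p ((?vs p)[i := lie_bracket X U p]) +
      (X p b * \<omega> p ((?vs p)[i := W p]) + b p * \<omega> p ((?vs p)[i := lie_bracket X W p]))"
    unfolding bracket_lin[OF X UW ab]
    by (subst alt[OF vs i fun_subspaceD(2)[OF T_subspace] fun_subspaceD(2)[OF T_subspace]])
      (simp_all add: B alt[OF vs i])
  have 3: "\<omega> p ((?vs p)[l := lie_bracket X (Ys ! l) p, i := (\<lambda>f. a p * U p f + b p * W p f)]) =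
      a p * \<omega> p ((?vs p)[l := lie_bracket X (Ys ! l) p, i := U p]) +
      b p * \<omega> p ((?vs p)[l := lie_bracket X (Ys ! l) p, i := W p])" if l: "l \<in> {..<k} - {i}" for l
  proof (rule alt[OF _ set_list_update_subset i B(3,4)])
    have "Ys ! l \<in> V" using Ys l by (auto simp: subset_iff)
    then show "lie_bracket X (Ys ! l) p \<in> T p" using bracket_vf[OF X] V_D(1) by blast
  qed (use vs in auto)
  show ?thesis
    unfolding lie_derivative_update[OF Ys(1) i] 1 2
    by (simp add: 3 sum.distrib sum_distrib_left algebra_simps)
qed

text \<open>Bracket terms away from \<open>i\<close> and \<open>j\<close> vanish by repetition, and
  the remaining two cancel by antisymmetry.\<close>

lemma lie_derivative_eq_args:
  assumes X: "X \<in> V" and \<omega>: "\<omega> \<in> forms A k" and Ys: "length Ys = k" "set Ys \<subseteq> V"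
    and ij: "i < j" "j < k" "Ys ! i = Ys ! j"
  shows "lie_derivative X \<omega> Ys p = 0"
proof -
  let ?vs = "\<lambda>q. map (\<lambda>Y. Y q) Ys"
  let ?b = "lie_bracket X (Ys ! i) p" and ?y = "(Ys ! i) p"
  have vs: "length (?vs q) = k" "set (?vs q) \<subseteq> T q" for q using Ys V_list by auto
  have YV: "Ys ! l \<in> V" if "l < k" for l using Ys that by (auto simp: subset_iff)
  have BT: "lie_bracket X (Ys ! l) p \<in> T p" if "l < k" for l
    using bracket_vf[OF X YV[OF that]] V_D(1) by blast
  note alt = form_alternating[OF \<omega>]
  have "\<omega> q (?vs q) = 0" for q
    by (rule alternating_on_eq[OF alt vs, of i j]) (use ij Ys in auto)
  then have 1: "X p (\<lambda>q. \<omega> q (?vs q)) = 0" using tangent_const[OF V_D(1)[OF X], of p 0] by simp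
  have "(\<Sum>l<k. \<omega> p ((?vs p)[l := lie_bracket X (Ys ! l) p])) =
      (\<Sum>l\<in>{i, j}. \<omega> p ((?vs p)[l := lie_bracket X (Ys ! l) p]))"
  proof (rule sum.mono_neutral_right)
    show "\<forall>l\<in>{..<k} - {i, j}. \<omega> p ((?vs p)[l := lie_bracket X (Ys ! l) p]) = 0"
    proof
      fix l assume l: "l \<in> {..<k} - {i, j}"
      show "\<omega> p ((?vs p)[l := lie_bracket X (Ys ! l) p]) = 0"
        by (rule alternating_on_eq[where i=i and j=j, OF alt _ set_list_update_subset[OF vs(2) BT]])
          (use l ij Ys in auto)
    qed
  qed (use ij in auto)
  also have "\<dots> = \<omega> p ((?vs p)[i := ?b]) + \<omega> p ((?vs p)[j := ?b])" using ij by simp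
  also have "(?vs p)[i := ?b] = (?vs p)[i := ?b, j := ?y]"
    using ij Ys(1) by (intro nth_equalityI) (auto simp: nth_list_update)
  also have "(?vs p)[j := ?b] = (?vs p)[i := ?y, j := ?b]"
    using ij Ys(1) by (intro nth_equalityI) (auto simp: nth_list_update)
  also have "\<omega> p ((?vs p)[i := ?b, j := ?y]) = - \<omega> p ((?vs p)[i := ?y, j := ?b])"
    by (rule alternating_on_swap[OF alt T_subspace vs]) (use ij BT V_D(1)[OF YV] in auto)
  finally have 2: "(\<Sum>l<k. \<omega> p ((?vs p)[l := lie_bracket X (Ys ! l) p])) = 0" by simp
  show ?thesis using 1 2 Ys(1) by (simp add: lie_derivative_def map_update)
qed

lemma lie_derivative_sum:
  assumes X: "X \<in> V" and \<omega>: "\<omega> \<in> forms A k" and Ys: "length Ys = k" "set Ys \<subseteq> V" and i: "i < k"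
    and "\<And>l. l \<in> I \<Longrightarrow> U l \<in> V" "\<And>l. l \<in> I \<Longrightarrow> a l \<in> C"
  shows "lie_derivative X \<omega> (Ys[i := (\<lambda>p f. \<Sum>l\<in>I. a l p * U l p f)]) p =
    (\<Sum>l\<in>I. a l p * lie_derivative X \<omega> (Ys[i := U l]) p)"
  using assms(6,7)
proof (induction I rule: infinite_finite_induct)
  case (insert l I)
  have "(\<lambda>p f. \<Sum>l\<in>I. a l p * U l p f) \<in> V" by (rule V_sum) (use insert in auto)
  then show ?case
    using lie_derivative_lin[OF X \<omega> Ys i, of "U l" "\<lambda>p f. \<Sum>l\<in>I. a l p * U l p f" "a l" "\<lambda>_. 1" p]
      insert C_const by simp
qed (use lie_derivative_lin[OF X \<omega> Ys i V_zero V_zero C_const C_const, of 0 0] in simp_all)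

text \<open>Multiplied by a bump function, \<open>W\<close> is globally a combination of frame
  fields with coefficients that vanish at \<open>p\<close>; linearity over functions pulls these
  coefficients out.\<close>

lemma lie_derivative_zero_arg:
  assumes X: "X \<in> V" and \<omega>: "\<omega> \<in> forms A k" and Ys: "length Ys = k" "set Ys \<subseteq> V" and i: "i < k"
    and W: "W \<in> V" "W p = (\<lambda>_. 0)"
  shows "lie_derivative X \<omega> (Ys[i := W]) p = 0"
proof -
  obtain x E N where N: "open N" "p \<in> N" and x: "\<And>i::nat. x i \<in> C" and E: "\<And>i. E i \<in> V"
    and F: "\<And>q. q \<in> N \<Longrightarrow> dual_frames (T q) CARD('m) (\<lambda>i. E i q) (\<lambda>i. d (x i) q)"
    by (rule local_frame[of p]) (rule that)
  obtain b N' K where b: "b \<in> C" "p \<in> N'" "\<And>q. q \<in> N' \<Longrightarrow> b q = 1" "K \<subseteq> N" "\<And>q. q \<notin> K \<Longrightarrow> b q = 0"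
    by (rule bump[OF N]) (rule that)
  have bp: "b p = 1" using b by blast
  let ?a = "\<lambda>l q. b q * W q (x l)"
  \<comment> \<open>The summand \<open>0 * W q f\<close> gives the left-hand side the two-term shape
    of \<open>lie_derivative_lin\<close>.\<close>
  have eq: "(\<lambda>q f. b q * W q f + 0 * W q f) = (\<lambda>q f. \<Sum>l<CARD('m). ?a l q * E l q f)"
  proof (intro ext)
    fix q f
    show "b q * W q f + 0 * W q f = (\<Sum>l<CARD('m). ?a l q * E l q f)"
    proof (cases "q \<in> N")
      case True
      note WT = V_D(1)[OF W(1), of q]
      have "W q f = (\<Sum>l<CARD('m). d (x l) q (W q) * E l q f)"
        by (rule fun_cong[OF dual_framesD(5)[OF F[OF True] WT]])
      then have "W q f = (\<Sum>l<CARD('m). W q (x l) * E l q f)" by (simp only: d_apply[OF WT])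
      then show ?thesis by (simp add: sum_distrib_left mult.assoc)
    next
      case False
      then have "q \<notin> K" using b(4) by blast
      then show ?thesis by (simp add: b(5))
    qed
  qed
  have "lie_derivative X \<omega> (Ys[i := W]) p =
      lie_derivative X \<omega> (Ys[i := (\<lambda>q f. b q * W q f + 0 * W q f)]) p"
    using lie_derivative_lin[OF X \<omega> Ys i W(1) W(1) b(1) C_const[of 0], of p] bp by simp
  also have "\<dots> = (\<Sum>l<CARD('m). ?a l p * lie_derivative X \<omega> (Ys[i := E l]) p)"
    unfolding eq by (rule lie_derivative_sum[OF X \<omega> Ys i]) (use E x W b C_mult V_D(2) in auto)
  also have "\<dots> = 0" using W(2) by simp
  finally show ?thesis .
qed

text \<open>The fields are exchanged one at a time; each exchange costs a term with a difference of
  fields that vanishes at \<open>p\<close>.\<close>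

lemma lie_derivative_pointwise:
  assumes X: "X \<in> V" and \<omega>: "\<omega> \<in> forms A k" and Ys: "length Ys = k" "set Ys \<subseteq> V"
    and Zs: "length Zs = k" "set Zs \<subseteq> V" and eq: "map (\<lambda>Y. Y p) Ys = map (\<lambda>Y. Y p) Zs"
  shows "lie_derivative X \<omega> Ys p = lie_derivative X \<omega> Zs p"
proof -
  have "lie_derivative X \<omega> Ys p = lie_derivative X \<omega> (take j Zs @ drop j Ys) p" if "j \<le> k" for j
    using that
  proof (induction j)
    case (Suc j)
    let ?Us = "take j Zs @ drop j Ys"
    have U: "length ?Us = k" "set ?Us \<subseteq> V"
      using Ys Zs Suc.prems set_take_subset[of j Zs] set_drop_subset[of j Ys] by auto
    have jV: "Ys ! j \<in> V" "Zs ! j \<in> V" using Ys Zs Suc.prems by (auto simp: subset_iff)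
    have up: "take (Suc j) Zs @ drop (Suc j) Ys = ?Us[j := Zs ! j]" "?Us = ?Us[j := Ys ! j]"
      using Suc.prems Ys(1) Zs(1)
      by (auto intro!: nth_equalityI simp: nth_append nth_list_update less_Suc_eq)
    let ?W = "\<lambda>q f. 1 * (Ys ! j) q f + (- 1) * (Zs ! j) q f"
    have "(Ys ! j) p = (Zs ! j) p" using eq Suc.prems Ys(1) Zs(1) by (auto dest: map_eq_imp_length_eq simp: list_eq_iff_nth_eq)
    then have "lie_derivative X \<omega> (?Us[j := ?W]) p = 0"
      using Suc.prems by (intro lie_derivative_zero_arg[OF X \<omega> U] V_lin jV C_const) auto
    moreover have "lie_derivative X \<omega> (?Us[j := ?W]) p =
        1 * lie_derivative X \<omega> (?Us[j := Ys ! j]) p + (- 1) * lie_derivative X \<omega> (?Us[j := Zs ! j]) p"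
      using Suc.prems by (intro lie_derivative_lin[OF X \<omega> U] jV C_const) auto
    ultimately have "lie_derivative X \<omega> (?Us[j := Ys ! j]) p = lie_derivative X \<omega> (?Us[j := Zs ! j]) p" by simp
    then show ?case using Suc.IH Suc.prems up by simp
  qed simp
  from this[of k] show ?thesis using Ys Zs by simp
qed

text \<open>\<open>\<L>\<^sub>X \<nu>\<close> is a multiple of \<open>\<nu>\<close> at each point, so a single test tuple decides whether it vanishes.\<close>

lemma lie_derivative_top_zero:
  assumes X: "X \<in> V" and \<nu>: "\<nu> \<in> forms A CARD('m)" and Zs: "length Zs = CARD('m)" "set Zs \<subseteq> V"
    and nz: "\<nu> p (map (\<lambda>Z. Z p) Zs) \<noteq> 0" and 0: "lie_derivative X \<nu> Zs p = 0"
    and Ys: "length Ys = CARD('m)" "set Ys \<subseteq> V"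
  shows "lie_derivative X \<nu> Ys p = 0"
proof -
  obtain x E N where N: "p \<in> N" and E: "\<And>i::nat. E i \<in> V"
    and F: "\<And>q. q \<in> N \<Longrightarrow> dual_frames (T q) CARD('m) (\<lambda>i. E i q) (\<lambda>i. d (x i) q)"
    by (rule local_frame[of p]) (rule that)
  \<comment> \<open>Extending tangent vectors linearly to fields turns the Lie derivative at
    \<open>p\<close> into an alternating map on the tangent space, to which the algebra of top forms
    applies.\<close>
  define ext where "ext v = (\<lambda>q f. \<Sum>i<CARD('m). d (x i) p v * E i q f)" for v
  have extV: "ext v \<in> V" for v
    unfolding ext_def using V_sum[of "{..<CARD('m)}" E "\<lambda>i _. d (x i) p v"] E C_const by simp
  have extp: "ext v p = v" if "v \<in> T p" for v
    using dual_framesD(5)[OF F[OF N] that] by (simp add: ext_def)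
  have ext_lin: "ext (\<lambda>t. a * u t + b * v t) = (\<lambda>q f. a * ext u q f + b * ext v q f)"
    if "u \<in> T p" "v \<in> T p" for u v a b
    by (intro HOL.ext) (simp add: ext_def linear_dualD(1)[OF d_dual that] sum.distrib sum_distrib_left algebra_simps)
  let ?P = "\<lambda>vs. lie_derivative X \<nu> (map ext vs) p"
  have P: "alternating_on (T p) CARD('m) ?P"
  proof (rule alternating_onI)
    fix vs i u v a b assume vs: "length vs = CARD('m)" "set vs \<subseteq> T p" "i < CARD('m)" "u \<in> T p" "v \<in> T p"
    have "lie_derivative X \<nu> ((map ext vs)[i := (\<lambda>q f. a * ext u q f + b * ext v q f)]) p =
        a * lie_derivative X \<nu> ((map ext vs)[i := ext u]) p + b * lie_derivative X \<nu> ((map ext vs)[i := ext v]) p"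
      by (rule lie_derivative_lin[OF X \<nu> _ _ vs(3) extV extV C_const C_const]) (use vs extV in auto)
    then show "?P (vs[i := (\<lambda>t. a * u t + b * v t)]) = a * ?P (vs[i := u]) + b * ?P (vs[i := v])"
      using vs by (simp add: map_update ext_lin)
  next
    fix vs i j assume "length vs = CARD('m)" "set vs \<subseteq> T p" "i < j" "j < CARD('m)" "vs ! i = vs ! j"
    then show "?P vs = 0"
      using extV by (intro lie_derivative_eq_args[OF X \<nu>, of _ i j]) auto
  qed
  have red: "lie_derivative X \<nu> Us p = ?P (map (\<lambda>U. U p) Us)" if "length Us = CARD('m)" "set Us \<subseteq> V" for Us
  proof (rule lie_derivative_pointwise[OF X \<nu> that])
    show "map (\<lambda>Y. Y p) Us = map (\<lambda>Y. Y p) (map ext (map (\<lambda>U. U p) Us))"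
      using that extp V_D(1) by (auto simp: subset_iff)
  qed (use that extV in auto)
  have "?P (map (\<lambda>Y. Y p) Ys) * \<nu> p (map (\<lambda>Z. Z p) Zs) = ?P (map (\<lambda>Z. Z p) Zs) * \<nu> p (map (\<lambda>Y. Y p) Ys)"
    by (rule top_forms_proportional[OF F[OF N] P form_alternating[OF \<nu>]])
      (use Ys Zs V_list in auto)
  then show ?thesis using red[OF Ys] red[OF Zs] 0 nz by simp
qed

lemma form_scale:
  assumes "h \<in> C" "\<omega> \<in> forms A k"
  shows "(\<lambda>p vs. h p * \<omega> p vs) \<in> forms A k"
  unfolding forms_def
proof (intro CollectI conjI allI impI)
  fix p
  show "(\<lambda>vs. h p * \<omega> p vs) \<in> alternating_maps (T p) k"
    using form_outside[OF assms(2)] alternating_on_scale[OF form_alternating[OF assms(2)], where c="h p"]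
    by (auto simp: alternating_maps_iff mult.commute)
next
  fix Xs assume "length Xs = k \<and> set Xs \<subseteq> V"
  then show "(\<lambda>p. h p * \<omega> p (map (\<lambda>X. X p) Xs)) \<in> C"
    by (intro C_mult assms form_smooth[OF assms(2)]) auto
qed

lemma lie_derivative_scale:
  assumes X: "X \<in> V" and h: "h \<in> C" and \<omega>: "\<omega> \<in> forms A k" and Ys: "length Ys = k" "set Ys \<subseteq> V"
  shows "lie_derivative X (\<lambda>p vs. h p * \<omega> p vs) Ys p =
    X p h * \<omega> p (map (\<lambda>Y. Y p) Ys) + h p * lie_derivative X \<omega> Ys p"
  using tangentD(3)[OF V_D(1)[OF X] h form_smooth[OF \<omega> Ys]]
  by (simp add: lie_derivative_def sum_distrib_left algebra_simps)

lemma tangent_power: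
  assumes "v \<in> T p" "f \<in> C"
  shows "v (\<lambda>q. f q ^ Suc k) = real (Suc k) * f p ^ k * v f" "(\<lambda>q. f q ^ k) \<in> C"
proof -
  show C: "(\<lambda>q. f q ^ k) \<in> C" for k
  proof (induction k)
    case (Suc k)
    then show ?case using C_mult[OF assms(2) Suc] by simp
  qed (simp add: C_const)
  show "v (\<lambda>q. f q ^ Suc k) = real (Suc k) * f p ^ k * v f"
  proof (induction k)
    case (Suc k)
    have "v (\<lambda>q. f q ^ Suc (Suc k)) = f p * v (\<lambda>q. f q ^ Suc k) + f p ^ Suc k * v f"
      unfolding power_Suc[of _ "Suc k"] by (rule tangentD(3)[OF assms C])
    also have "\<dots> = f p * (real (Suc k) * f p ^ k * v f) + f p ^ Suc k * v f"
      by (simp only: Suc)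
    also have "\<dots> = real (Suc (Suc k)) * f p ^ Suc k * v f"
      by (simp add: algebra_simps)
    finally show ?case .
  qed simp
qed

end

section \<open>Regular Nambu-Poisson manifolds\<close>

locale nambu_manifold = manifold A for A :: "('a::t2_space, 'm::finite) chart set" +
  fixes n :: nat and \<Lambda> :: "'a mvfield"
  assumes nambu: "nambu_poisson A n \<Lambda>" and n3: "n \<ge> 3" and regular: "nowhere_zero \<Lambda>"
begin

abbreviation "br \<equiv> nambu_bracket A \<Lambda>"
abbreviation "ham \<equiv> hamiltonian A \<Lambda>"

lemma n_le: "n \<le> CARD('m)"
  using nambu by (simp add: nambu_poisson_def)

lemma tensor_alternating: "alternating_on (T' p) n (\<Lambda> p)"
  using nambu by (simp add: nambu_poisson_def multivector_fields_def alternating_maps_iff)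

lemma tensor_outside: "\<not> (length \<alpha>s = n \<and> set \<alpha>s \<subseteq> T' p) \<Longrightarrow> \<Lambda> p \<alpha>s = 0"
  using nambu by (simp add: nambu_poisson_def multivector_fields_def alternating_maps_iff)

lemma br_eq: "br fs p = \<Lambda> p (map (\<lambda>f. d f p) fs)"
  by (simp add: nambu_bracket_def)

lemma br_C:
  assumes "length fs = n" "set fs \<subseteq> C"
  shows "br fs \<in> C"
proof -
  have "\<forall>\<alpha>s. length \<alpha>s = n \<and> set \<alpha>s \<subseteq> one_forms A \<longrightarrow> (\<lambda>p. \<Lambda> p (map (\<lambda>\<alpha>. \<alpha> p) \<alpha>s)) \<in> C"
    using nambu by (simp add: nambu_poisson_def multivector_fields_def)
  from this[rule_format, of "map d fs"] have "(\<lambda>p. \<Lambda> p (map (\<lambda>\<alpha>. \<alpha> p) (map d fs))) \<in> C"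
    using assms d_one_form by auto
  then show ?thesis by (simp add: nambu_bracket_def o_def)
qed

lemma fundamental:
  assumes "length fs = n - 1" "set fs \<subseteq> C" "length gs = n" "set gs \<subseteq> C"
  shows "br (fs @ [br gs]) p = (\<Sum>i<n. br (gs[i := br (fs @ [gs ! i])]) p)"
proof -
  have "br (fs @ [br gs]) = (\<lambda>p. \<Sum>i<n. br (gs[i := br (fs @ [gs ! i])]) p)"
    using nambu assms by (simp add: nambu_poisson_def)
  then show ?thesis by (rule fun_cong)
qed

lemma br_update: "br (gs[i := f]) p = \<Lambda> p ((map (\<lambda>f. d f p) gs)[i := d f p])"
  by (simp add: br_eq map_update)

section \<open>The bracket as a derivation in each argument\<close>

lemma br_lin_slot:
  assumes "length gs = n" "i < n" "f \<in> C" "g \<in> C"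
  shows "br (gs[i := (\<lambda>t. a * f t + b * g t)]) p = a * br (gs[i := f]) p + b * br (gs[i := g]) p"
  unfolding br_update d_lin[OF assms(3,4)]
  by (rule alternating_on_lin[OF tensor_alternating _ d_list assms(2) d_dual d_dual]) (simp add: assms(1))

lemma br_mult_slot:
  assumes "length gs = n" "i < n" "f \<in> C" "g \<in> C"
  shows "br (gs[i := (\<lambda>t. f t * g t)]) p = f p * br (gs[i := g]) p + g p * br (gs[i := f]) p"
  unfolding br_update d_mult[OF assms(3,4)]
  by (rule alternating_on_lin[OF tensor_alternating _ d_list assms(2) d_dual d_dual]) (simp add: assms(1))

lemma br_two_products_slot:
  assumes "length gs = n" "i < n" "f \<in> C" "u \<in> C" "g \<in> C" "w \<in> C"
  shows "br (gs[i := (\<lambda>t. f t * u t + g t * w t)]) p =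
    f p * br (gs[i := u]) p + u p * br (gs[i := f]) p + (g p * br (gs[i := w]) p + w p * br (gs[i := g]) p)"
  using br_lin_slot[OF assms(1,2) C_mult[OF assms(3,4)] C_mult[OF assms(5,6)], of 1 1]
  by (simp add: br_mult_slot[OF assms(1,2)] assms)

text \<open>Substituting a product into the fundamental identity and cancelling all terms in which
  the derivation property is not used leaves an identity quadratic in \<open>\<Lambda>\<close>.\<close>

lemma tensor_quadratic: "nambu_tensor (T' p) n (\<Lambda> p)"
proof
  show "fun_subspace (T' p)" by (rule fun_subspace_linear_dual)
  show "alternating_on (T' p) n (\<Lambda> p)" by (rule tensor_alternating)
  show "n \<ge> 3" by (rule n3)
  fix h k \<phi> \<gamma> assume h: "h \<in> T' p" and k: "k \<in> T' p" and \<phi>: "length \<phi> = n - 2" "set \<phi> \<subseteq> T' p"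
    and \<gamma>: "length \<gamma> = n" "set \<gamma> \<subseteq> T' p"
  obtain fh where fh: "fh \<in> C" "h = d fh p" by (rule covector_differential[OF h])
  obtain fk where fk: "fk \<in> C" "k = d fk p" by (rule covector_differential[OF k])
  obtain \<phi>s where \<phi>s: "set \<phi>s \<subseteq> C" "length \<phi>s = n - 2" "\<phi> = map (\<lambda>f. d f p) \<phi>s"
    using covectors_differentials[OF \<phi>(2)] \<phi>(1) by metis
  obtain gs where gs: "set gs \<subseteq> C" "length gs = n" "\<gamma> = map (\<lambda>f. d f p) gs"
    using covectors_differentials[OF \<gamma>(2)] \<gamma>(1) by metis
  define Bh where "Bh i = br (fh # \<phi>s @ [gs ! i])" for i
  define Bk where "Bk i = br (fk # \<phi>s @ [gs ! i])" for i
  have giC: "gs ! i \<in> C" if "i < n" for i using gs that by (auto simp: subset_iff)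
  have BC: "Bh i \<in> C" "Bk i \<in> C" if "i < n" for i
    unfolding Bh_def Bk_def using \<phi>s fh fk giC[OF that] n3 by (auto intro!: br_C)
  have fund: "br (f # \<phi>s @ [br gs]) p = (\<Sum>i<n. br (gs[i := br (f # \<phi>s @ [gs ! i])]) p)" if "f \<in> C" for f
    using fundamental[of "f # \<phi>s" gs p] that \<phi>s gs n3 by simp
  have hk: "br ((\<lambda>t. fh t * fk t) # \<phi>s @ [g]) q = fh q * br (fk # \<phi>s @ [g]) q + fk q * br (fh # \<phi>s @ [g]) q" for g q
    using br_mult_slot[of "fh # \<phi>s @ [g]" 0 fh fk q] \<phi>s fh fk n3 by simp
  have hk_fun: "br ((\<lambda>t. fh t * fk t) # \<phi>s @ [g]) =
      (\<lambda>q. fh q * br (fk # \<phi>s @ [g]) q + fk q * br (fh # \<phi>s @ [g]) q)" for g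
    by (rule ext) (rule hk)
  have "br ((\<lambda>t. fh t * fk t) # \<phi>s @ [br gs]) p =
      (\<Sum>i<n. br (gs[i := br ((\<lambda>t. fh t * fk t) # \<phi>s @ [gs ! i])]) p)"
    by (rule fund[OF C_mult[OF fh(1) fk(1)]])
  also have "\<dots> = (\<Sum>i<n. br (gs[i := (\<lambda>t. fh t * Bk i t + fk t * Bh i t)]) p)"
    by (simp only: hk_fun Bh_def Bk_def)
  also have "\<dots> = (\<Sum>i<n. fh p * br (gs[i := Bk i]) p + Bk i p * br (gs[i := fh]) p +
      (fk p * br (gs[i := Bh i]) p + Bh i p * br (gs[i := fk]) p))"
    by (intro sum.cong refl br_two_products_slot gs fh fk BC) auto
  \<comment> \<open>The terms in which \<open>fh\<close> or \<open>fk\<close> is not differentiated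
    add up to the fundamental identity for \<open>fk\<close> and \<open>fh\<close> alone, and they
    cancel against the product rule on the left.\<close>
  also have "\<dots> = fh p * br (fk # \<phi>s @ [br gs]) p + fk p * br (fh # \<phi>s @ [br gs]) p +
      (\<Sum>i<n. Bk i p * br (gs[i := fh]) p + Bh i p * br (gs[i := fk]) p)"
    unfolding fund[OF fh(1)] fund[OF fk(1)] Bh_def[symmetric] Bk_def[symmetric]
    by (simp add: sum.distrib sum_distrib_left)
  finally have "(\<Sum>i<n. Bk i p * br (gs[i := fh]) p + Bh i p * br (gs[i := fk]) p) = 0"
    using hk[of "br gs" p] by simp
  moreover have "Bk i p * br (gs[i := fh]) p + Bh i p * br (gs[i := fk]) p =
      \<Lambda> p (k # \<phi> @ [\<gamma> ! i]) * \<Lambda> p (\<gamma>[i := h]) + \<Lambda> p (h # \<phi> @ [\<gamma> ! i]) * \<Lambda> p (\<gamma>[i := k])" if "i < n" for i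
    using that gs(2) by (simp add: Bk_def Bh_def br_eq map_update fh fk \<phi>s(3) gs(3))
  ultimately show "(\<Sum>i<n. \<Lambda> p (k # \<phi> @ [\<gamma> ! i]) * \<Lambda> p (\<gamma>[i := h]) + \<Lambda> p (h # \<phi> @ [\<gamma> ! i]) * \<Lambda> p (\<gamma>[i := k])) = 0"
    by simp
qed

section \<open>Fields spanning the characteristic foliation\<close>

definition slot :: "('a \<Rightarrow> real) list \<Rightarrow> nat \<Rightarrow> 'a vfield" where
  "slot gs i = (\<lambda>p f. if f \<in> C then br (gs[i := f]) p else 0)"

lemma slot_V:
  assumes gs: "length gs = n" "set gs \<subseteq> C" and i: "i < n"
  shows "slot gs i \<in> V"
  unfolding vector_fields_def mem_Collect_eq
proof (intro conjI allI ballI)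
  fix p show "slot gs i p \<in> T p"
  proof (rule tangentI)
    fix f g assume fg: "f \<in> C" "g \<in> C"
    show "slot gs i p (\<lambda>t. a * f t + b * g t) = a * slot gs i p f + b * slot gs i p g" for a b
      using fg by (simp add: slot_def C_lin br_lin_slot[OF gs(1) i])
    show "slot gs i p (\<lambda>t. f t * g t) = f p * slot gs i p g + g p * slot gs i p f"
      using fg by (simp add: slot_def C_mult br_mult_slot[OF gs(1) i])
  qed (simp add: slot_def)
next
  fix f assume f: "f \<in> C"
  have "br (gs[i := f]) \<in> C" by (intro br_C set_list_update_subset) (use gs f in auto)
  then show "(\<lambda>p. slot gs i p f) \<in> C" using f by (simp add: slot_def)
qed

lemma slot_apply:
  assumes gs: "length gs = n" "set gs \<subseteq> C" and i: "i < n" and \<beta>: "\<beta> \<in> T' p"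
  shows "\<beta> (slot gs i p) = \<Lambda> p ((map (\<lambda>f. d f p) gs)[i := \<beta>])"
proof -
  obtain f where f: "f \<in> C" "\<beta> = d f p" by (rule covector_differential[OF \<beta>])
  then show ?thesis
    using d_apply[OF V_D(1)[OF slot_V[OF gs i]]] by (simp add: slot_def br_update)
qed

text \<open>Supplies the dual families that \<open>adapted_frame\<close> asks for, scaled by the
  bracket of \<open>gs\<close>.\<close>

lemma slot_dual:
  assumes gs: "length gs = n" "set gs \<subseteq> C" and ij: "i < n" "j < n"
  shows "d (gs ! i) p (slot gs j p) = (if i = j then br gs p else 0)"
proof -
  have l: "length (map (\<lambda>f. d f p) gs) = n" using gs by simp
  have "d (gs ! i) p (slot gs j p) = \<Lambda> p ((map (\<lambda>f. d f p) gs)[j := d (gs ! i) p])"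
    by (rule slot_apply[OF gs ij(2) d_dual])
  also have "\<dots> = (if i = j then br gs p else 0)"
  proof (cases "i = j")
    case True
    then have "(map (\<lambda>f. d f p) gs)[j := d (gs ! i) p] = map (\<lambda>f. d f p) gs"
      using ij gs list_update_id[of "map (\<lambda>f. d f p) gs" j] by simp
    then show ?thesis using True by (simp add: br_eq)
  next
    case False
    then show ?thesis
      using alternating_on_update_eq[OF tensor_alternating l d_list d_dual ij(2,1), of "gs ! i"] gs ij by simp
  qed
  finally show ?thesis .
qed

lemma regular_functions:
  obtains gs where "length gs = n" "set gs \<subseteq> C" "br gs p \<noteq> 0"
proof -
  have "\<Lambda> p \<noteq> (\<lambda>_. 0)" using regular by (simp add: nowhere_zero_def)
  then obtain \<alpha>s where \<alpha>s: "\<Lambda> p \<alpha>s \<noteq> 0" by auto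
  then have l: "length \<alpha>s = n" and s: "set \<alpha>s \<subseteq> T' p" using tensor_outside by blast+
  obtain gs where gs: "set gs \<subseteq> C" "length gs = length \<alpha>s" "\<alpha>s = map (\<lambda>f. d f p) gs"
    by (rule covectors_differentials[OF s])
  have "br gs p \<noteq> 0" using \<alpha>s unfolding gs(3) br_eq .
  then show thesis by (rule that[rotated 2]) (use l gs(1,2) in simp_all)
qed

text \<open>\<open>expand\<close> applied to differentials: where the bracket of \<open>gs\<close>
  is nonzero, its \<open>n\<close> fields span the characteristic distribution.\<close>

lemma slot_span:
  assumes gs: "length gs = n" "set gs \<subseteq> C" "br gs p \<noteq> 0" and hs: "length hs = n" "set hs \<subseteq> C" "j < n"
  obtains c where "slot hs j p = (\<lambda>f. \<Sum>k<n. c k * slot gs k p f)"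
proof
  interpret nambu_tensor "T' p" n "\<Lambda> p" by (rule tensor_quadratic)
  let ?\<alpha> = "map (\<lambda>f. d f p) gs" and ?\<delta> = "map (\<lambda>f. d f p) hs"
  show "slot hs j p = (\<lambda>f. \<Sum>k<n. (\<Lambda> p (?\<delta>[j := ?\<alpha> ! k]) / \<Lambda> p ?\<alpha>) * slot gs k p f)"
  proof
    fix f
    show "slot hs j p f = (\<Sum>k<n. (\<Lambda> p (?\<delta>[j := ?\<alpha> ! k]) / \<Lambda> p ?\<alpha>) * slot gs k p f)"
    proof (cases "f \<in> C")
      case True
      have "\<Lambda> p (?\<delta>[j := d f p]) = (\<Sum>k<n. (\<Lambda> p (?\<alpha>[k := d f p]) / \<Lambda> p ?\<alpha>) * \<Lambda> p (?\<delta>[j := ?\<alpha> ! k]))"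
        by (rule expand) (use gs hs d_list d_dual in \<open>auto simp: br_eq\<close>)
      then show ?thesis using True by (simp add: slot_def br_update mult.commute)
    qed (simp add: slot_def)
  qed
qed

section \<open>Hamiltonian fields\<close>

lemma contraction_differentials:
  assumes fs: "length fs = k" and \<gamma>s: "set \<gamma>s \<subseteq> T' p" and P: "alternating_on (T' p) (k + length \<gamma>s) P"
  shows "contraction (T p) k (wedge (T p) (map (\<lambda>f. d f p) fs)) P \<gamma>s = P (map (\<lambda>f. d f p) fs @ \<gamma>s)"
proof -
  obtain e \<epsilon> where F: "dual_frames (T p) CARD('m) e \<epsilon>" by (rule frame_at)
  show ?thesis
    by (rule contraction_wedge[OF F _ d_list alternating_on_append_right[OF P refl \<gamma>s]]) (simp add: fs)
qed

lemma ham_apply: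
  assumes "length fs = n - 1" "f \<in> C"
  shows "ham fs p f = br (fs @ [f]) p"
proof -
  have "contraction (T p) (n - 1) (wedge (T p) (map (\<lambda>f. d f p) fs)) (\<Lambda> p) [d f p] =
      \<Lambda> p (map (\<lambda>f. d f p) fs @ [d f p])"
    by (rule contraction_differentials[OF assms(1)]) (use d_dual tensor_alternating n3 in auto)
  then show ?thesis
    using assms by (simp add: hamiltonian_def vfield_of_def sharp_def br_eq)
qed

lemma ham_slot:
  assumes "length fs = n - 1"
  shows "ham fs = slot (fs @ [g]) (n - 1)"
proof (intro ext)
  fix p f
  show "ham fs p f = slot (fs @ [g]) (n - 1) p f"
  proof (cases "f \<in> C")
    case True
    have "(fs @ [g])[n - 1 := f] = fs @ [f]" using list_update_length[of fs g "[]" f] assms by simp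
    then show ?thesis using True by (simp only: slot_def ham_apply[OF assms] if_True)
  qed (simp add: hamiltonian_def vfield_of_def slot_def)
qed

lemma ham_V:
  assumes "length fs = n - 1" "set fs \<subseteq> C"
  shows "ham fs \<in> V"
  unfolding ham_slot[OF assms(1), of "\<lambda>_. 0"]
  by (rule slot_V) (use assms n3 C_const in auto)

text \<open>Moving position \<open>i\<close> to the end changes the bracket at most by a sign. The
  witness \<open>fs\<close> drops \<open>gs ! i\<close> and puts the last function in its
  place.\<close>

lemma slot_ham:
  assumes gs: "length gs = n" "set gs \<subseteq> C" and i: "i < n"
  obtains fs c where "length fs = n - 1" "set fs \<subseteq> C" "\<And>p. slot gs i p = (\<lambda>f. c * ham fs p f)"
proof -
  define hs where "hs = gs[i := gs ! (n - 1)]"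
  have last: "gs ! (n - 1) \<in> C" using gs n3 by (auto simp: subset_iff)
  have hs: "length hs = n" "set hs \<subseteq> C" using gs set_list_update_subset[OF gs(2) last] by (auto simp: hs_def)
  define fs where "fs = butlast hs"
  have fs: "length fs = n - 1" "set fs \<subseteq> C" using hs in_set_butlastD by (fastforce simp: fs_def)+
  have up: "hs[n - 1 := f] = fs @ [f]" for f
  proof -
    have "hs \<noteq> []" using hs(1) n3 by auto
    then have "hs = fs @ [last hs]" by (simp add: fs_def)
    then show ?thesis using fs(1) by (metis list_update_length)
  qed
  have sgn: "br (gs[i := f]) p = (if i = n - 1 then 1 else - 1) * br (fs @ [f]) p" for f p
  proof (cases "i = n - 1")
    case True
    then show ?thesis using up[of f] by (simp add: hs_def)
  next
    case False
    let ?\<alpha> = "map (\<lambda>f. d f p) gs"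
    have "\<Lambda> p (?\<alpha>[i := d f p, n - 1 := d (gs ! (n - 1)) p]) = - \<Lambda> p (?\<alpha>[i := d (gs ! (n - 1)) p, n - 1 := d f p])"
      by (rule alternating_on_swap[OF tensor_alternating fun_subspace_linear_dual _ d_list i _ False d_dual d_dual])
        (use gs n3 in auto)
    moreover have "?\<alpha>[i := d f p, n - 1 := d (gs ! (n - 1)) p] = ?\<alpha>[i := d f p]"
      using False gs i by (intro nth_equalityI) (auto simp: nth_list_update)
    ultimately show ?thesis
      using False by (simp add: br_update up[symmetric] hs_def map_update)
  qed
  show thesis
  proof (rule that[OF fs, of "if i = n - 1 then 1 else - 1"])
    fix p
    show "slot gs i p = (\<lambda>f. (if i = n - 1 then 1 else - 1) * ham fs p f)"
    proof
      fix f
      show "slot gs i p f = (if i = n - 1 then 1 else - 1) * ham fs p f"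
      proof (cases "f \<in> C")
        case True
        then show ?thesis using sgn[of f p] by (simp add: slot_def ham_apply[OF fs(1)])
      next
        case False
        then show ?thesis using tangentD(2)[OF V_D(1)[OF ham_V[OF fs]]] by (simp add: slot_def)
      qed
    qed
  qed
qed

section \<open>Contraction of a volume form with the Nambu tensor\<close>

abbreviation "slots gs p \<equiv> map (\<lambda>i. slot gs i p) [0..<n]"

lemma slots_T: "length gs = n \<Longrightarrow> set gs \<subseteq> C \<Longrightarrow> set (slots gs p) \<subseteq> T p"
  using V_D(1)[OF slot_V] by auto

text \<open>\<open>transverse \<nu>\<close> is \<open>i(\<Lambda>)\<nu>\<close> up to normalisation: since \<open>\<Lambda>\<close> is decomposable, it is
  \<open>{g\<^sub>1, \<dots>, g\<^sub>n}\<^sup>1\<^sup>-\<^sup>n\<close> times the wedge product of the fields \<open>slot gs i\<close>.\<close>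

definition transverse :: "'a form \<Rightarrow> 'a form" where
  "transverse \<nu> p vs =
     (if length vs = CARD('m) - n \<and> set vs \<subseteq> T p
      then let gs = SOME gs. length gs = n \<and> set gs \<subseteq> C \<and> br gs p \<noteq> 0
           in \<nu> p (slots gs p @ vs) / br gs p ^ (n - 1)
      else 0)"

text \<open>\<open>interior_power_independent\<close> at the point \<open>p\<close>: the tuple
  picked by \<open>SOME\<close> may be replaced by any other one with nonzero bracket.\<close>

lemma transverse_eq:
  assumes \<nu>: "\<nu> \<in> forms A CARD('m)" and gs: "length gs = n" "set gs \<subseteq> C" "br gs p \<noteq> 0"
    and vs: "length vs = CARD('m) - n" "set vs \<subseteq> T p"
  shows "\<nu> p (slots gs p @ vs) = br gs p ^ (n - 1) * transverse \<nu> p vs"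
proof -
  define hs where "hs = (SOME gs. length gs = n \<and> set gs \<subseteq> C \<and> br gs p \<noteq> 0)"
  have "\<exists>gs. length gs = n \<and> set gs \<subseteq> C \<and> br gs p \<noteq> 0" using gs by blast
  from someI_ex[OF this] have hs: "length hs = n" "set hs \<subseteq> C" "br hs p \<noteq> 0" by (auto simp: hs_def)
  obtain e \<epsilon> where F: "dual_frames (T p) CARD('m) e \<epsilon>" by (rule frame_at)
  have alt: "alternating_on (T p) n (\<lambda>Ys. \<nu> p (Ys @ vs))"
    by (rule alternating_on_append_right[OF _ vs]) (use form_alternating[OF \<nu>] n_le in simp)
  let ?a = "br gs p ^ (n - 1)" and ?b = "br hs p ^ (n - 1)"
  have "\<nu> p (slots hs p @ vs) * ?a = \<nu> p (slots gs p @ vs) * ?b"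
    unfolding br_eq
    by (rule interior_power_independent[OF tensor_quadratic F _ d_list _ _ d_list _ _ _ _ _ alt])
      (use gs hs V_D(1)[OF slot_V] slot_apply in \<open>auto simp: br_eq\<close>)
  moreover have "?b \<noteq> 0" using hs(3) by simp
  ultimately have "\<nu> p (slots gs p @ vs) = ?a * (\<nu> p (slots hs p @ vs) / ?b)"
    by (simp add: nonzero_eq_divide_eq mult.commute)
  moreover have "transverse \<nu> p vs = \<nu> p (slots hs p @ vs) / ?b"
    using vs by (simp add: transverse_def hs_def Let_def)
  ultimately show ?thesis by simp
qed

lemma regular_neighbourhood:
  obtains gs N where "length gs = n" "set gs \<subseteq> C" "open N" "p \<in> N" "\<And>q. q \<in> N \<Longrightarrow> br gs q \<noteq> 0"
proof -
  obtain gs where gs: "length gs = n" "set gs \<subseteq> C" "br gs p \<noteq> 0" by (rule regular_functions)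
  have sm: "smooth_in UNIV (br gs)" using br_C[OF gs(1,2)] by (simp add: C_iff)
  obtain N where "open N" "p \<in> N" "\<And>q. q \<in> N \<Longrightarrow> br gs q \<noteq> 0"
    by (rule smooth_in_nonzero[OF open_UNIV sm UNIV_I gs(3)]) (rule that)
  then show thesis by (rule that[OF gs(1,2)])
qed

text \<open>Smoothness needs one tuple of functions for a whole neighbourhood, and
  \<open>transverse_eq\<close> permits it although the definition chooses anew at each
  point.\<close>

lemma transverse_forms:
  assumes \<nu>: "\<nu> \<in> forms A CARD('m)"
  shows "transverse \<nu> \<in> forms A (CARD('m) - n)"
  unfolding forms_def mem_Collect_eq
proof (intro conjI allI impI)
  fix p
  obtain gs where gs: "length gs = n" "set gs \<subseteq> C" "br gs p \<noteq> 0" by (rule regular_functions)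
  have eq: "transverse \<nu> p vs = \<nu> p (slots gs p @ vs) * (1 / br gs p ^ (n - 1))"
    if "length vs = CARD('m) - n" "set vs \<subseteq> T p" for vs
    using transverse_eq[OF \<nu> gs that] gs(3) by simp
  have alt: "alternating_on (T p) (CARD('m) - n) (\<lambda>vs. \<nu> p (slots gs p @ vs) * (1 / br gs p ^ (n - 1)))"
    by (intro alternating_on_scale alternating_on_append_left[where k=n] slots_T gs)
      (use form_alternating[OF \<nu>] n_le in auto)
  have "alternating_on (T p) (CARD('m) - n) (transverse \<nu> p)"
  proof (rule alternating_onI)
    fix vs i u v a b
    assume vs: "length vs = CARD('m) - n" "set vs \<subseteq> T p" "i < CARD('m) - n" and uv: "u \<in> T p" "v \<in> T p"
    show "transverse \<nu> p (vs[i := (\<lambda>t. a * u t + b * v t)]) =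
        a * transverse \<nu> p (vs[i := u]) + b * transverse \<nu> p (vs[i := v])"
      using alternating_on_lin[OF alt vs uv, of a b] vs uv fun_subspaceD(2)[OF T_subspace uv]
      by (simp add: eq set_list_update_subset)
  next
    fix vs i j
    assume vs: "length vs = CARD('m) - n" "set vs \<subseteq> T p" "i < j" "j < CARD('m) - n" "vs ! i = vs ! j"
    show "transverse \<nu> p vs = 0"
      using alternating_on_eq[OF alt vs(1,2), of i j] vs by (simp add: eq)
  qed
  then show "transverse \<nu> p \<in> alternating_maps (T p) (CARD('m) - n)"
    by (auto simp: alternating_maps_iff transverse_def)
next
  fix Ys assume Ys: "length Ys = CARD('m) - n \<and> set Ys \<subseteq> V"
  show "(\<lambda>p. transverse \<nu> p (map (\<lambda>X. X p) Ys)) \<in> C"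
  proof (rule C_local)
    fix p
    obtain gs N where gs: "length gs = n" "set gs \<subseteq> C" and N: "open N" "p \<in> N"
      and nz: "\<And>q. q \<in> N \<Longrightarrow> br gs q \<noteq> 0" by (rule regular_neighbourhood[of p]) (rule that)
    let ?Zs = "map (slot gs) [0..<n] @ Ys"
    have "(\<lambda>q. \<nu> q (map (\<lambda>X. X q) ?Zs)) \<in> C"
      using Ys n_le slot_V[OF gs] by (intro form_smooth[OF \<nu>]) auto
    then have num: "smooth_in N (\<lambda>q. \<nu> q (map (\<lambda>X. X q) ?Zs))" by (rule C_smooth_in)
    \<comment> \<open>\<open>tangent_power\<close> is stated for a tangent vector; for the
      smoothness of powers any one will do.\<close>
    obtain X0 where X0: "X0 \<in> T p" using fun_subspaceD(1)[OF T_subspace] by blast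
    have den: "smooth_in N (\<lambda>q. br gs q ^ (n - 1))"
      by (rule C_smooth_in[OF tangent_power(2)[OF X0 br_C[OF gs]]])
    have "smooth_in N (\<lambda>q. \<nu> q (map (\<lambda>X. X q) ?Zs) / br gs q ^ (n - 1))"
      by (rule smooth_in_divide[OF N(1) num den]) (use nz in simp)
    then have "smooth_in N (\<lambda>p. transverse \<nu> p (map (\<lambda>X. X p) Ys))"
    proof (rule smooth_in_cong[OF _ N(1)])
      fix q assume q: "q \<in> N"
      have "\<nu> q (slots gs q @ map (\<lambda>X. X q) Ys) = br gs q ^ (n - 1) * transverse \<nu> q (map (\<lambda>X. X q) Ys)"
        using Ys V_list by (intro transverse_eq[OF \<nu> gs nz[OF q]]) auto
      then show "\<nu> q (map (\<lambda>X. X q) ?Zs) / br gs q ^ (n - 1) = transverse \<nu> q (map (\<lambda>X. X q) Ys)"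
        using nz[OF q] by (simp add: o_def)
    qed
    then show "\<exists>N. open N \<and> p \<in> N \<and> smooth_in N (\<lambda>p. transverse \<nu> p (map (\<lambda>X. X p) Ys))"
      using N by blast
  qed
qed

text \<open>The Hamiltonian vector is a combination of the vectors \<open>slot gs k p\<close>, which
  already occupy the first \<open>n\<close> arguments of \<nu>.\<close>

lemma transverse_kill:
  assumes \<nu>: "\<nu> \<in> forms A CARD('m)" and fs: "length fs = n - 1" "set fs \<subseteq> C"
  shows "transverse \<nu> p (ham fs p # vs) = 0"
proof (cases "length (ham fs p # vs) = CARD('m) - n \<and> set (ham fs p # vs) \<subseteq> T p")
  case True
  obtain gs where gs: "length gs = n" "set gs \<subseteq> C" "br gs p \<noteq> 0" by (rule regular_functions)
  have hs: "length (fs @ [\<lambda>_. 0]) = n" "set (fs @ [\<lambda>_. 0]) \<subseteq> C" "n - 1 < n"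
    using fs n3 C_const by auto
  obtain c where c: "ham fs p = (\<lambda>f. \<Sum>k<n. c k * slot gs k p f)"
    unfolding ham_slot[OF fs(1), of "\<lambda>_. 0"] by (rule slot_span[OF gs hs])
  let ?vs = "slots gs p @ ham fs p # vs"
  have vs: "length ?vs = CARD('m)" "set ?vs \<subseteq> T p" "n < CARD('m)"
    using True slots_T[OF gs(1,2)] n_le by auto
  have "\<nu> p ?vs = \<nu> p (?vs[n := (\<lambda>f. \<Sum>k<n. c k * slot gs k p f)])"
    unfolding c by (simp add: list_update_append)
  also have "\<dots> = (\<Sum>k<n. c k * \<nu> p (?vs[n := slot gs k p]))"
    by (rule alternating_on_sum[OF form_alternating[OF \<nu>] T_subspace vs])
      (use V_D(1)[OF slot_V[OF gs(1,2)]] in auto)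
  also have "\<dots> = 0"
  proof (rule sum.neutral, rule ballI)
    fix k assume k: "k \<in> {..<n}"
    have "\<nu> p (?vs[n := slot gs k p]) = 0"
      by (rule alternating_on_update_eq[OF form_alternating[OF \<nu>] vs(1,2) _ vs(3), of _ k])
        (use k n_le V_D(1)[OF slot_V[OF gs(1,2)]] in \<open>auto simp: nth_append\<close>)
    then show "c k * \<nu> p (?vs[n := slot gs k p]) = 0" by simp
  qed
  finally show ?thesis using transverse_eq[OF \<nu> gs, of "ham fs p # vs"] True gs(3) by simp
next
  case False
  then show ?thesis by (simp only: transverse_def if_False)
qed

lemma transverse_nonzero:
  assumes \<nu>: "\<nu> \<in> forms A CARD('m)" and nz: "\<nu> p us \<noteq> 0"
  obtains vs where "length vs = CARD('m) - n" "set vs \<subseteq> T p" "transverse \<nu> p vs \<noteq> 0"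
proof -
  obtain gs where gs: "length gs = n" "set gs \<subseteq> C" "br gs p \<noteq> 0" by (rule regular_functions)
  obtain e \<epsilon> where F: "dual_frames (T p) CARD('m) e \<epsilon>" by (rule frame_at)
  have us: "length us = CARD('m)" "set us \<subseteq> T p" using nz form_outside[OF \<nu>] by blast+
  obtain vs where vs: "length vs = CARD('m) - n" "set vs \<subseteq> T p" "\<nu> p (slots gs p @ vs) \<noteq> 0" "n \<le> CARD('m)"
  proof (rule top_form_nonzero_extend[where s=n and Y="\<lambda>i. slot gs i p" and \<alpha>="\<lambda>i. d (gs ! i) p",
        OF F form_alternating[OF \<nu>] us nz gs(3)])
    show "slot gs i p \<in> T p" if "i < n" for i using V_D(1)[OF slot_V[OF gs(1,2) that]] .
    show "d (gs ! i) p (slot gs j p) = (if i = j then br gs p else 0)" if "i < n" "j < n" for i j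
      by (rule slot_dual[OF gs(1,2) that])
  qed (rule d_dual, rule that)
  then have "transverse \<nu> p vs \<noteq> 0" using transverse_eq[OF \<nu> gs vs(1,2)] by auto
  then show thesis by (rule that[OF vs(1,2)])
qed

section \<open>Forms killed by the Hamiltonian fields\<close>

lemma killed_slot:
  assumes \<mu>: "\<mu> \<in> forms A (CARD('m) - n)" and k: "\<And>fs vs. length fs = n - 1 \<Longrightarrow> set fs \<subseteq> C \<Longrightarrow> \<mu> p (ham fs p # vs) = 0"
    and gs: "length gs = n" "set gs \<subseteq> C" and i: "i < n"
  shows "\<mu> p (slot gs i p # vs) = 0"
proof (cases "length (slot gs i p # vs) = CARD('m) - n \<and> set (slot gs i p # vs) \<subseteq> T p")
  case True
  obtain fs c where fs: "length fs = n - 1" "set fs \<subseteq> C" and c: "\<And>p. slot gs i p = (\<lambda>f. c * ham fs p f)"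
    by (rule slot_ham[OF gs i]) (rule that)
  have h: "ham fs p \<in> T p" by (rule V_D(1)[OF ham_V[OF fs]])
  have "\<mu> p ((ham fs p # vs)[0 := (\<lambda>f. c * ham fs p f + 0 * ham fs p f)]) =
      c * \<mu> p ((ham fs p # vs)[0 := ham fs p]) + 0 * \<mu> p ((ham fs p # vs)[0 := ham fs p])"
    by (rule alternating_on_lin[OF form_alternating[OF \<mu>] _ _ _ h h]) (use True h in auto)
  then show ?thesis using c[of p] k[OF fs] by simp
qed (rule form_outside[OF \<mu>])

text \<open>Makes a given basic volume comparable with the contraction of an auxiliary local
  volume.\<close>

lemma killed_proportional:
  assumes P: "P \<in> forms A (CARD('m) - n)" "\<And>fs vs. length fs = n - 1 \<Longrightarrow> set fs \<subseteq> C \<Longrightarrow> P p (ham fs p # vs) = 0"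
    and Q: "Q \<in> forms A (CARD('m) - n)" "\<And>fs vs. length fs = n - 1 \<Longrightarrow> set fs \<subseteq> C \<Longrightarrow> Q p (ham fs p # vs) = 0"
    and vs: "length vs = CARD('m) - n" "set vs \<subseteq> T p" and ws: "length ws = CARD('m) - n" "set ws \<subseteq> T p"
  shows "P p vs * Q p ws = P p ws * Q p vs"
proof -
  obtain gs where gs: "length gs = n" "set gs \<subseteq> C" "br gs p \<noteq> 0" by (rule regular_functions)
  obtain e \<epsilon> where F: "dual_frames (T p) CARD('m) e \<epsilon>" by (rule frame_at)
  show ?thesis
  proof (rule transverse_forms_proportional[where Y="\<lambda>i. slot gs i p" and \<alpha>="\<lambda>i. d (gs ! i) p",
        OF F gs(3) _ _ _ form_alternating[OF P(1)] form_alternating[OF Q(1)] _ _ vs ws])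
    show "slot gs i p \<in> T p" if "i < n" for i using V_D(1)[OF slot_V[OF gs(1,2) that]] .
    show "d (gs ! i) p (slot gs j p) = (if i = j then br gs p else 0)" if "i < n" "j < n" for i j
      by (rule slot_dual[OF gs(1,2) that])
    show "P p (slot gs i p # vs) = 0" if "i < n" for i vs by (rule killed_slot[OF P gs(1,2) that])
    show "Q p (slot gs i p # vs) = 0" if "i < n" for i vs by (rule killed_slot[OF Q gs(1,2) that])
  qed (rule d_dual)
qed

text \<open>In the fundamental identity for \<open>gs\<close> with \<open>f\<close> in position
  \<open>i\<close>, the term of position \<open>i\<close> is \<open>slot gs i\<close> applied to
  \<open>X f\<close> and drops out of the commutator. The other terms have two altered entries,
  which \<open>two_entries\<close> separates. The number \<open>a k l\<close> is
  \<open>slot gs k\<close> applied to \<open>X (gs ! l)\<close>, at \<open>p\<close>.\<close>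

lemma ham_bracket:
  assumes fs: "length fs = n - 1" "set fs \<subseteq> C" and gs: "length gs = n" "set gs \<subseteq> C" "br gs p \<noteq> 0" and i: "i < n"
  defines "a \<equiv> \<lambda>k l. br (gs[k := br (fs @ [gs ! l])]) p"
  shows "lie_bracket (ham fs) (slot gs i) p =
    (\<lambda>f. ((\<Sum>j\<in>{..<n} - {i}. a j j) / br gs p) * slot gs i p f +
      1 * (\<Sum>j\<in>{..<n} - {i}. (- a i j / br gs p) * slot gs j p f))"
proof
  interpret nambu_tensor "T' p" n "\<Lambda> p" by (rule tensor_quadratic)
  let ?X = "ham fs" and ?\<alpha> = "map (\<lambda>f. d f p) gs"
  fix f
  show "lie_bracket ?X (slot gs i) p f =
    ((\<Sum>j\<in>{..<n} - {i}. a j j) / br gs p) * slot gs i p f +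
      1 * (\<Sum>j\<in>{..<n} - {i}. (- a i j / br gs p) * slot gs j p f)"
  proof (cases "f \<in> C")
    case False
    have "lie_bracket ?X (slot gs i) p f = 0"
      by (rule tangentD(2)[OF V_D(1)[OF bracket_vf[OF ham_V[OF fs] slot_V[OF gs(1,2) i]]] False])
    then show ?thesis using False by (simp add: slot_def)
  next
    case True
    let ?gs = "gs[i := f]"
    have gsC: "set ?gs \<subseteq> C" "length ?gs = n" using set_list_update_subset[OF gs(2) True] gs(1) by auto
    have gjC: "gs ! j \<in> C" if "j < n" for j using gs that by (auto simp: subset_iff)
    have XC: "br (fs @ [g]) \<in> C" if "g \<in> C" for g by (rule br_C) (use fs that n3 in auto)
    have X1: "?X p (\<lambda>q. slot gs i q f) = br (fs @ [br ?gs]) p"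
      using True by (simp add: slot_def ham_apply[OF fs(1) br_C[OF gsC(2,1)]])
    have X2: "slot gs i p (\<lambda>q. ?X q f) = br (gs[i := br (fs @ [f])]) p"
      using XC[OF True] True by (simp add: slot_def ham_apply[OF fs(1)])
    have "br (fs @ [br ?gs]) p = (\<Sum>j<n. br (?gs[j := br (fs @ [?gs ! j])]) p)"
      by (rule fundamental[OF fs gsC(2,1)])
    also have "\<dots> = br (gs[i := br (fs @ [f])]) p + (\<Sum>j\<in>{..<n} - {i}. br (?gs[j := br (fs @ [?gs ! j])]) p)"
      using i gs(1) by (subst sum.remove[of _ i]) auto
    also have "(\<Sum>j\<in>{..<n} - {i}. br (?gs[j := br (fs @ [?gs ! j])]) p) =
        (\<Sum>j\<in>{..<n} - {i}. (slot gs i p f * a j j - slot gs j p f * a i j) / br gs p)"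
    proof (rule sum.cong[OF refl])
      fix j assume j: "j \<in> {..<n} - {i}"
      have "\<Lambda> p ?\<alpha> * \<Lambda> p (?\<alpha>[i := d f p, j := d (br (fs @ [gs ! j])) p]) =
          \<Lambda> p (?\<alpha>[i := d f p]) * \<Lambda> p (?\<alpha>[j := d (br (fs @ [gs ! j])) p]) -
          \<Lambda> p (?\<alpha>[j := d f p]) * \<Lambda> p (?\<alpha>[i := d (br (fs @ [gs ! j])) p])"
        by (rule two_entries[OF _ d_list d_dual d_dual]) (use gs i j in \<open>auto simp: br_eq\<close>)
      then have "br gs p * br (?gs[j := br (fs @ [gs ! j])]) p = slot gs i p f * a j j - slot gs j p f * a i j"
        using True by (simp add: slot_def a_def br_eq map_update)
      then show "br (?gs[j := br (fs @ [?gs ! j])]) p = (slot gs i p f * a j j - slot gs j p f * a i j) / br gs p"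
        using j gs(3) by (simp add: field_simps)
    qed
    finally have "lie_bracket ?X (slot gs i) p f =
        (\<Sum>j\<in>{..<n} - {i}. (slot gs i p f * a j j - slot gs j p f * a i j) / br gs p)"
      by (simp add: lie_bracket_def X1 X2)
    also have "\<dots> = ((\<Sum>j\<in>{..<n} - {i}. a j j) / br gs p) * slot gs i p f +
      1 * (\<Sum>j\<in>{..<n} - {i}. (- a i j / br gs p) * slot gs j p f)"
      by (simp add: sum_distrib_left sum_distrib_right sum_divide_distrib sum_subtractf sum_negf diff_divide_distrib mult.commute)
    finally show ?thesis .
  qed
qed

text \<open>The factor on the right is not differentiated because the fundamental identity says that
  Hamiltonian fields preserve \<open>\<Lambda>\<close>.\<close>

lemma lie_derivative_transverse:
  assumes fs: "length fs = n - 1" "set fs \<subseteq> C"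
    and gs: "length gs = n" "set gs \<subseteq> C" "br gs p \<noteq> 0"
    and \<nu>: "\<nu> \<in> forms A CARD('m)" and \<mu>: "\<mu> \<in> forms A (CARD('m) - n)"
    and N: "open N" "p \<in> N"
    and rel: "\<And>q vs. q \<in> N \<Longrightarrow> length vs = CARD('m) - n \<Longrightarrow> set vs \<subseteq> T q \<Longrightarrow>
      \<nu> q (slots gs q @ vs) = br gs q ^ (n - 1) * \<mu> q vs"
    and Ys: "length Ys = CARD('m) - n" "set Ys \<subseteq> V"
  shows "lie_derivative (ham fs) \<nu> (map (slot gs) [0..<n] @ Ys) p =
    br gs p ^ (n - 1) * lie_derivative (ham fs) \<mu> Ys p"
proof -
  let ?X = "ham fs" and ?Zs = "map (slot gs) [0..<n] @ Ys" and ?G = "br gs"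
  let ?ys = "\<lambda>q. map (\<lambda>Y. Y q) Ys"
  have XV: "?X \<in> V" by (rule ham_V[OF fs])
  note XT = V_D(1)[OF XV, of p]
  have Zs: "length ?Zs = CARD('m)" "set ?Zs \<subseteq> V" using Ys n_le slot_V[OF gs(1,2)] by auto
  have ys: "length (?ys q) = CARD('m) - n" "set (?ys q) \<subseteq> T q" for q using Ys V_list by auto
  have zs: "map (\<lambda>Y. Y q) ?Zs = slots gs q @ ?ys q" for q by simp
  have GC: "?G \<in> C" by (rule br_C[OF gs(1,2)])
  have \<mu>C: "(\<lambda>q. \<mu> q (?ys q)) \<in> C" by (rule form_smooth[OF \<mu> Ys])
  have PC: "(\<lambda>q. ?G q ^ (n - 1)) \<in> C" by (rule tangent_power(2)[OF XT GC])
  have "n - 1 = Suc (n - 2)" using n3 by simp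
  then have XP: "?X p (\<lambda>q. ?G q ^ (n - 1)) = real (n - 1) * ?G p ^ (n - 2) * ?X p ?G"
    using tangent_power(1)[OF XT GC, of "n - 2"] by simp
  have "?X p (\<lambda>q. \<nu> q (map (\<lambda>Y. Y q) ?Zs)) = ?X p (\<lambda>q. ?G q ^ (n - 1) * \<mu> q (?ys q))"
  proof (rule tangent_local[OF XT form_smooth[OF \<nu> Zs] C_mult[OF PC \<mu>C] N])
    show "\<nu> q (map (\<lambda>Y. Y q) ?Zs) = ?G q ^ (n - 1) * \<mu> q (?ys q)" if "q \<in> N" for q
      unfolding zs by (rule rel[OF that ys])
  qed
  also have "\<dots> = ?G p ^ (n - 1) * ?X p (\<lambda>q. \<mu> q (?ys q)) + \<mu> p (?ys p) * (real (n - 1) * ?G p ^ (n - 2) * ?X p ?G)"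
    using tangentD(3)[OF XT PC \<mu>C] XP by simp
  finally have 1: "?X p (\<lambda>q. \<nu> q (map (\<lambda>Y. Y q) ?Zs)) =
      ?G p ^ (n - 1) * ?X p (\<lambda>q. \<mu> q (?ys q)) + \<mu> p (?ys p) * (real (n - 1) * ?G p ^ (n - 2) * ?X p ?G)" .
  define a where "a k l = br (gs[k := br (fs @ [gs ! l])]) p" for k l
  \<comment> \<open>The fundamental identity for \<open>gs\<close> itself: the derivative of the
    bracket is the trace of \<open>a\<close>.\<close>
  have XG: "?X p ?G = (\<Sum>j<n. a j j)"
    unfolding a_def ham_apply[OF fs(1) GC] by (rule fundamental[OF fs gs(1,2)])
  have sT: "slot gs j p \<in> T p" if "j < n" for j using V_D(1)[OF slot_V[OF gs(1,2) that]] .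
  have vs: "length (slots gs p @ ?ys p) = CARD('m)" "set (slots gs p @ ?ys p) \<subseteq> T p"
    using ys slots_T[OF gs(1,2)] n_le by auto
  let ?t = "\<lambda>i. \<nu> p (map (\<lambda>Y. Y p) (?Zs[i := lie_bracket ?X (?Zs ! i)]))"
  \<comment> \<open>Only the component of the Lie bracket along \<open>slot gs i\<close> counts,
    because the other fields are already among the arguments. It is the trace of \<open>a\<close>
    without the entry \<open>a i i\<close>, divided by the bracket of \<open>gs\<close>.\<close>
  have t1: "?t i = ((?X p ?G - a i i) / ?G p) * (?G p ^ (n - 1) * \<mu> p (?ys p))" if i: "i < n" for i
  proof -
    let ?S = "\<lambda>f. \<Sum>j\<in>{..<n} - {i}. (- a i j / ?G p) * slot gs j p f"
    have iM: "i < CARD('m)" using i n_le by simp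
    have ST: "?S \<in> T p" by (rule fun_subspace_sum[OF T_subspace]) (use sT in auto)
    have "?Zs ! i = slot gs i" using i by (simp add: nth_append)
    then have "?t i = \<nu> p ((slots gs p @ ?ys p)[i := lie_bracket ?X (slot gs i) p])"
      by (simp only: map_update zs)
    also have "\<dots> = ((\<Sum>j\<in>{..<n} - {i}. a j j) / ?G p) * \<nu> p ((slots gs p @ ?ys p)[i := slot gs i p]) +
        1 * \<nu> p ((slots gs p @ ?ys p)[i := ?S])"
      unfolding ham_bracket[OF fs gs i] a_def[symmetric]
      by (rule alternating_on_lin[OF form_alternating[OF \<nu>] vs iM sT[OF i] ST])
    also have "\<nu> p ((slots gs p @ ?ys p)[i := ?S]) =
        (\<Sum>j\<in>{..<n} - {i}. (- a i j / ?G p) * \<nu> p ((slots gs p @ ?ys p)[i := slot gs j p]))"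
      by (rule alternating_on_sum[OF form_alternating[OF \<nu>] T_subspace vs iM]) (use sT in auto)
    also have "\<dots> = 0"
    proof (rule sum.neutral, rule ballI)
      fix j assume j: "j \<in> {..<n} - {i}"
      have "\<nu> p ((slots gs p @ ?ys p)[i := slot gs j p]) = 0"
        by (rule alternating_on_update_eq[OF form_alternating[OF \<nu>] vs _ iM, of _ j])
          (use j n_le sT in \<open>auto simp: nth_append\<close>)
      then show "(- a i j / ?G p) * \<nu> p ((slots gs p @ ?ys p)[i := slot gs j p]) = 0" by simp
    qed
    also have "(slots gs p @ ?ys p)[i := slot gs i p] = slots gs p @ ?ys p"
      using i list_update_id[of "slots gs p @ ?ys p" i] by (simp add: nth_append)
    also have "\<nu> p (slots gs p @ ?ys p) = ?G p ^ (n - 1) * \<mu> p (?ys p)" by (rule rel[OF N(2) ys])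
    also have "(\<Sum>j\<in>{..<n} - {i}. a j j) = ?X p ?G - a i i"
      unfolding XG using i by (subst sum.remove[of "{..<n}" i]) auto
    finally show ?thesis by simp
  qed
  have t2: "?t (n + l) = ?G p ^ (n - 1) * \<mu> p (map (\<lambda>Y. Y p) (Ys[l := lie_bracket ?X (Ys ! l)]))"
    if l: "l < CARD('m) - n" for l
  proof -
    have bV: "lie_bracket ?X (Ys ! l) \<in> V"
      using l Ys by (intro bracket_vf[OF XV]) (auto simp: subset_iff)
    have "?t (n + l) = \<nu> p (slots gs p @ map (\<lambda>Y. Y p) (Ys[l := lie_bracket ?X (Ys ! l)]))"
      by (simp add: nth_append list_update_append o_def)
    also have "\<dots> = ?G p ^ (n - 1) * \<mu> p (map (\<lambda>Y. Y p) (Ys[l := lie_bracket ?X (Ys ! l)]))"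
      by (rule rel[OF N(2) _ V_list[OF set_list_update_subset[OF Ys(2) bV]]]) (use Ys in simp)
    finally show ?thesis .
  qed
  have "(\<Sum>i<CARD('m). ?t i) = (\<Sum>i<n. ?t i) + (\<Sum>l<CARD('m) - n. ?t (n + l))"
    using sum_lessThan_add[of ?t n "CARD('m) - n"] n_le by simp
  also have "(\<Sum>i<n. ?t i) = (\<Sum>i<n. ((?X p ?G - a i i) / ?G p) * (?G p ^ (n - 1) * \<mu> p (?ys p)))"
    by (rule sum.cong[OF refl]) (use t1 in simp)
  also have "\<dots> = (\<Sum>i<n. ?X p ?G - a i i) / ?G p * (?G p ^ (n - 1) * \<mu> p (?ys p))"
    by (simp only: sum_distrib_right[symmetric] sum_divide_distrib[symmetric])
  \<comment> \<open>\<open>n\<close> copies of the trace minus the trace itself. This factor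
    \<open>n - 1\<close> is the one produced by differentiating the power of the bracket, so the two
    contributions cancel at the end.\<close>
  also have "(\<Sum>i<n. ?X p ?G - a i i) = real (n - 1) * ?X p ?G"
    using n3 by (simp add: sum_subtractf XG[symmetric] of_nat_diff algebra_simps)
  also have "real (n - 1) * ?X p ?G / ?G p * (?G p ^ (n - 1) * \<mu> p (?ys p)) =
      \<mu> p (?ys p) * (real (n - 1) * ?G p ^ (n - 2) * ?X p ?G)"
    using gs(3) \<open>n - 1 = Suc (n - 2)\<close> by simp
  also have "(\<Sum>l<CARD('m) - n. ?t (n + l)) =
      ?G p ^ (n - 1) * (\<Sum>l<CARD('m) - n. \<mu> p (map (\<lambda>Y. Y p) (Ys[l := lie_bracket ?X (Ys ! l)])))"
    unfolding sum_distrib_left by (rule sum.cong[OF refl]) (use t2 in simp)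
  finally have "(\<Sum>i<CARD('m). ?t i) = \<mu> p (?ys p) * (real (n - 1) * ?G p ^ (n - 2) * ?X p ?G) +
      ?G p ^ (n - 1) * (\<Sum>l<CARD('m) - n. \<mu> p (map (\<lambda>Y. Y p) (Ys[l := lie_bracket ?X (Ys ! l)])))" .
  then show ?thesis
    unfolding lie_derivative_def Zs(1) Ys(1) 1 by (simp add: right_diff_distrib)
qed

end

section \<open>The modular class and basic volumes\<close>

context manifold
begin

text \<open>These forms serve as test arguments for cochains and, in top degree, as local volume
  forms.\<close>

lemma wedge_form:
  assumes fs: "length fs = k" "set fs \<subseteq> C"
  shows "(\<lambda>p. wedge (T p) (map (\<lambda>f. d f p) fs)) \<in> forms A k"
  unfolding forms_def mem_Collect_eq
proof (intro conjI allI impI)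
  show "wedge (T p) (map (\<lambda>f. d f p) fs) \<in> alternating_maps (T p) k" for p
    by (rule wedge_alternating[OF T_subspace _ d_list]) (simp add: fs)
  fix Xs assume "length Xs = k \<and> set Xs \<subseteq> V"
  then have Xs: "length Xs = k" "set Xs \<subseteq> V" by auto
  have fC: "fs ! i \<in> C" if "i < k" for i using fs that by (auto simp: subset_iff)
  have XV: "Xs ! i \<in> V" if "i < k" for i using Xs that by (auto simp: subset_iff)
  have "wedge (T p) (map (\<lambda>f. d f p) fs) (map (\<lambda>X. X p) Xs) =
      (\<Sum>\<pi> | \<pi> permutes {..<k}. of_int (sign \<pi>) * (\<Prod>i<k. (Xs ! \<pi> i) p (fs ! i)))" for p
  proof -
    have "(\<Prod>i<k. (map (\<lambda>f. d f p) fs ! i) (map (\<lambda>X. X p) Xs ! \<pi> i)) = (\<Prod>i<k. (Xs ! \<pi> i) p (fs ! i))"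
      if \<pi>: "\<pi> permutes {..<k}" for \<pi>
    proof (rule prod.cong[OF refl])
      fix i assume i: "i \<in> {..<k}"
      then have "\<pi> i < k" using permutes_in_image[OF \<pi>, of i] by simp
      then show "(map (\<lambda>f. d f p) fs ! i) (map (\<lambda>X. X p) Xs ! \<pi> i) = (Xs ! \<pi> i) p (fs ! i)"
        using i fs Xs d_apply[OF V_D(1)[OF XV]] by simp
    qed
    then show ?thesis using V_list[OF Xs(2)] Xs(1) fs(1) by (simp add: wedge_def)
  qed
  moreover have "(\<lambda>p. \<Sum>\<pi> | \<pi> permutes {..<k}. of_int (sign \<pi>) * (\<Prod>i<k. (Xs ! \<pi> i) p (fs ! i))) \<in> C"
  proof (intro C_sum C_scale C_prod)
    fix \<pi> i assume "\<pi> \<in> {\<pi>. \<pi> permutes {..<k}}" "i \<in> {..<k}"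
    then have "\<pi> i < k" "i < k" using permutes_in_image[of \<pi> "{..<k}" i] by auto
    then show "(\<lambda>p. (Xs ! \<pi> i) p (fs ! i)) \<in> C" by (intro V_D(2)[OF XV] fC)
  qed
  ultimately show "(\<lambda>p. wedge (T p) (map (\<lambda>f. d f p) fs) (map (\<lambda>X. X p) Xs)) \<in> C" by simp
qed

lemma contraction_forms:
  assumes F: "dual_frames (T p) CARD('m) e \<epsilon>" and \<beta>: "\<beta> \<in> forms A k"
    and P: "alternating_on (T' p) (k + length \<gamma>s) P" and \<gamma>s: "set \<gamma>s \<subseteq> T' p"
  shows "contraction (T p) k (\<beta> p) P \<gamma>s = (\<Sum>I\<in>increasing_lists CARD('m) k. \<beta> p (map e I) * P (map \<epsilon> I @ \<gamma>s))"
  by (rule contraction_eq[OF F _ alternating_on_append_right[OF P refl \<gamma>s]])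
    (use \<beta> in \<open>simp add: forms_def\<close>)

text \<open>\<open>h\<close> is the quotient of the values on one tuple of fields on which
  \<open>Q\<close> does not vanish at \<open>p\<close>; cross-multiplication carries it over to all
  arguments.\<close>

lemma form_ratio_local:
  assumes P: "P \<in> forms A k" and Q: "Q \<in> forms A k" and nz: "Q p us \<noteq> 0"
    and ratio: "\<And>q vs ws. length vs = k \<Longrightarrow> set vs \<subseteq> T q \<Longrightarrow> length ws = k \<Longrightarrow> set ws \<subseteq> T q \<Longrightarrow>
      P q vs * Q q ws = P q ws * Q q vs"
  obtains h N where "h \<in> C" "open N" "p \<in> N" "\<And>q vs. q \<in> N \<Longrightarrow> P q vs = h q * Q q vs"
proof -
  have us: "length us = k" "set us \<subseteq> T p" using nz form_outside[OF Q] by blast+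
  obtain Xs where Xs: "set Xs \<subseteq> V" "length Xs = length us" "us = map (\<lambda>X. X p) Xs"
    by (rule vectors_fields[OF us(2)])
  have l: "length Xs = k" using Xs us by simp
  let ?f = "\<lambda>q. P q (map (\<lambda>X. X q) Xs)" and ?g = "\<lambda>q. Q q (map (\<lambda>X. X q) Xs)"
  have fg: "smooth_in UNIV ?f" "smooth_in UNIV ?g"
    using form_smooth[OF P l Xs(1)] form_smooth[OF Q l Xs(1)] by (simp_all add: C_iff)
  have gp: "?g p \<noteq> 0" using nz Xs(3) by simp
  obtain N1 where N1: "open N1" "p \<in> N1" "\<And>q. q \<in> N1 \<Longrightarrow> ?g q \<noteq> 0"
    by (rule smooth_in_nonzero[OF open_UNIV fg(2) UNIV_I gp]) (rule that)
  have "smooth_in N1 (\<lambda>q. ?f q / ?g q)"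
    by (rule smooth_in_divide[OF N1(1) smooth_in_subset[OF fg(1)] smooth_in_subset[OF fg(2)] N1(3)]) auto
  then obtain h N where h: "h \<in> C" "open N" "p \<in> N" "N \<subseteq> N1" "\<And>q. q \<in> N \<Longrightarrow> h q = ?f q / ?g q"
    by (rule extend_smooth[OF N1(1,2)]) (rule that)
  show thesis
  proof (rule that[OF h(1-3)])
    fix q vs assume q: "q \<in> N"
    have gq: "?g q \<noteq> 0" using q h(4) N1(3) by blast
    show "P q vs = h q * Q q vs"
    proof (cases "length vs = k \<and> set vs \<subseteq> T q")
      case True
      have "P q vs * ?g q = ?f q * Q q vs"
        by (rule ratio) (use True l V_list[OF Xs(1)] in auto)
      then have "P q vs = ?f q * Q q vs / ?g q" using gq by (simp add: nonzero_eq_divide_eq)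
      then show ?thesis unfolding h(5)[OF q] by simp
    next
      case False
      then show ?thesis using form_outside[OF P] form_outside[OF Q] by simp
    qed
  qed
qed

text \<open>\<open>Q\<close> vanishes nowhere, so the quotient is determined at each point and the
  local quotients agree wherever both are defined.\<close>

lemma volume_ratio:
  assumes P: "P \<in> volume_forms A" and Q: "Q \<in> volume_forms A"
  obtains h where "h \<in> C" "\<And>p. h p \<noteq> 0" "P = (\<lambda>p vs. h p * Q p vs)"
proof -
  have PQ: "P \<in> forms A CARD('m)" "Q \<in> forms A CARD('m)" and nz: "\<And>p. P p \<noteq> (\<lambda>_. 0)" "\<And>p. Q p \<noteq> (\<lambda>_. 0)"
    using P Q by (auto simp: volume_forms_def nowhere_zero_def)
  have ratio: "P q vs * Q q ws = P q ws * Q q vs"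
    if "length vs = CARD('m)" "set vs \<subseteq> T q" "length ws = CARD('m)" "set ws \<subseteq> T q" for q vs ws
  proof -
    obtain e \<epsilon> where F: "dual_frames (T q) CARD('m) e \<epsilon>" by (rule frame_at)
    show ?thesis by (rule top_forms_proportional[OF F form_alternating[OF PQ(1)] form_alternating[OF PQ(2)] that])
  qed
  have "\<exists>g N. g \<in> C \<and> open N \<and> p \<in> N \<and> (\<forall>q\<in>N. \<forall>vs. P q vs = g q * Q q vs)" for p
  proof -
    obtain us where us: "Q p us \<noteq> 0" using nz(2)[of p] by auto
    show ?thesis by (rule form_ratio_local[OF PQ us ratio]) blast+
  qed
  then obtain g N where g: "\<And>p. g p \<in> C" "\<And>p. open (N p)" "\<And>p. p \<in> N p"
    "\<And>p q vs. q \<in> N p \<Longrightarrow> P q vs = g p q * Q q vs" by metis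
  define h where "h p = g p p" for p
  have eq: "P p vs = h p * Q p vs" for p vs unfolding h_def by (rule g(4)[OF g(3)])
  have hg: "h q = g p q" if q: "q \<in> N p" for p q
  proof -
    obtain us where us: "Q q us \<noteq> 0" using nz(2)[of q] by auto
    have "h q * Q q us = g p q * Q q us" by (rule trans[OF eq[symmetric] g(4)[OF q]])
    then show ?thesis using us by auto
  qed
  have "h \<in> C"
  proof (rule C_local)
    fix p
    have "smooth_in (N p) h"
      by (rule smooth_in_cong[OF C_smooth_in[OF g(1)[of p]] g(2)]) (simp add: hg)
    then show "\<exists>N. open N \<and> p \<in> N \<and> smooth_in N h" using g(2,3) by blast
  qed
  moreover have "h p \<noteq> 0" for p
  proof
    assume "h p = 0"
    then have "P p = (\<lambda>_. 0)" using eq by auto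
    then show False using nz(1) by blast
  qed
  moreover have "P = (\<lambda>p vs. h p * Q p vs)" using eq by auto
  ultimately show thesis by (rule that)
qed

text \<open>\<open>l\<close> is \<open>ln |h|\<close>, written as half the logarithm of
  \<open>h^2\<close> to treat both signs of \<open>h\<close> at once. Differentiating
  \<open>exp (ln (h^2)) = h^2\<close> requires the chain rule for \<open>exp\<close> only.\<close>

lemma log_abs:
  assumes h: "h \<in> C" "\<And>p. h p \<noteq> 0"
  obtains l where "l \<in> C" "\<And>p v. v \<in> T p \<Longrightarrow> v h = h p * v l"
proof
  have pos: "h q * h q > 0" for q using not_real_square_gt_zero[of "h q"] h(2)[of q] by blast
  let ?l2 = "\<lambda>q. ln (h q * h q)"
  have l2: "?l2 \<in> C"
    unfolding C_iff
    by (rule smooth_in_compose[OF open_UNIV _ smooth_on_ln])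
      (use C_mult[OF h(1) h(1)] pos in \<open>auto simp: C_iff\<close>)
  show lC: "(\<lambda>q. (1 / 2) * ?l2 q) \<in> C" by (rule C_scale[OF l2])
  fix p v assume v: "v \<in> T p"
  have "(\<lambda>q. exp (?l2 q)) = (\<lambda>q. h q * h q)" using pos by (intro ext) simp
  then have "v (\<lambda>q. h q * h q) = exp (?l2 p) * v ?l2" using tangent_exp(1)[OF v l2] by simp
  then have "2 * h p * v h = h p * h p * v ?l2"
    using tangentD(3)[OF v h(1) h(1)] pos[of p] by simp
  then show "v h = h p * v (\<lambda>q. (1 / 2) * ?l2 q)"
    unfolding tangent_scale[OF v l2] using h(2)[of p] by simp
qed

end

context nambu_manifold
begin

section \<open>Cochains and their cohomology classes\<close>

lemma mvfield_alternating: "M \<in> multivector_fields A k \<Longrightarrow> alternating_on (T' p) k (M p)"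
  by (simp add: multivector_fields_def alternating_maps_iff)

lemma coboundary_apply:
  assumes F: "dual_frames (T p) CARD('m) e \<epsilon>" and \<alpha>: "\<alpha> \<in> forms A (n - 1)" and f: "f \<in> C"
  shows "coboundary A n \<Lambda> f \<alpha> p =
    (\<Sum>I\<in>increasing_lists CARD('m) (n - 1). \<alpha> p (map e I) * \<Lambda> p (map \<epsilon> I @ [d f p]))"
  using contraction_forms[OF F \<alpha>, of "[d f p]" "\<Lambda> p"] tensor_alternating d_dual \<alpha> f n3
  by (simp add: coboundary_def vfield_of_def sharp_def)

lemma coboundary_outside: "\<alpha> \<notin> forms A (n - 1) \<Longrightarrow> coboundary A n \<Lambda> f \<alpha> = undefined"
  by (simp add: coboundary_def)

lemma coboundary_add:
  assumes \<alpha>: "\<alpha> \<in> forms A (n - 1)" and fg: "f \<in> C" "g \<in> C"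
  shows "coboundary A n \<Lambda> (\<lambda>t. f t + g t) \<alpha> p = coboundary A n \<Lambda> f \<alpha> p + coboundary A n \<Lambda> g \<alpha> p"
proof -
  obtain e \<epsilon> where F: "dual_frames (T p) CARD('m) e \<epsilon>" by (rule frame_at)
  have "\<Lambda> p (map \<epsilon> I @ [d (\<lambda>t. f t + g t) p]) = \<Lambda> p (map \<epsilon> I @ [d f p]) + \<Lambda> p (map \<epsilon> I @ [d g p])"
    if I: "I \<in> increasing_lists CARD('m) (n - 1)" for I
  proof -
    let ?vs = "map \<epsilon> I @ [d f p]"
    have vs: "length ?vs = n" "set ?vs \<subseteq> T' p" "n - 1 < n"
      using I dual_framesD(3)[OF F] d_dual n3 by (auto simp: increasing_lists_def)
    have up: "?vs[n - 1 := v] = map \<epsilon> I @ [v]" for v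
      using I list_update_length[of "map \<epsilon> I" "d f p" "[]" v] by (simp add: increasing_lists_def)
    have "d (\<lambda>t. f t + g t) p = (\<lambda>v. d f p v + d g p v)" using d_lin[OF fg, of 1 1] by simp
    then show ?thesis
      using alternating_on_add[OF tensor_alternating vs d_dual[of f] d_dual[of g]] by (simp only: up)
  qed
  then show ?thesis
    by (simp add: coboundary_apply[OF F \<alpha>] fg C_add distrib_left sum.distrib)
qed

lemma trivial_class_eq: "trivial_class A n \<Lambda> = {coboundary A n \<Lambda> g | g. g \<in> C}"
proof -
  have "(\<lambda>\<alpha>\<in>forms A (n - 1). \<lambda>p. (\<lambda>\<alpha>\<in>forms A (n - 1). \<lambda>p. 0) \<alpha> p + coboundary A n \<Lambda> g \<alpha> p) =
      coboundary A n \<Lambda> g" for g :: "'a \<Rightarrow> real"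
    by (rule ext) (simp add: restrict_def coboundary_outside)
  then show ?thesis unfolding cohomology_class_def by simp
qed

text \<open>Adding \<open>l\<close> is a bijection of the smooth functions onto themselves, so a
  shift by a coboundary preserves the set of all coboundaries.\<close>

lemma coboundary_class:
  assumes l: "l \<in> C"
  shows "cohomology_class A n \<Lambda> (coboundary A n \<Lambda> l) = trivial_class A n \<Lambda>"
proof -
  have add: "(\<lambda>\<alpha>\<in>forms A (n - 1). \<lambda>p. coboundary A n \<Lambda> l \<alpha> p + coboundary A n \<Lambda> f \<alpha> p) =
      coboundary A n \<Lambda> (\<lambda>t. l t + f t)" if "f \<in> C" for f
    by (rule ext) (simp add: restrict_def coboundary_outside fun_eq_iff coboundary_add l that)
  have "cohomology_class A n \<Lambda> (coboundary A n \<Lambda> l) = (\<lambda>f. coboundary A n \<Lambda> (\<lambda>t. l t + f t)) ` C"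
    unfolding cohomology_class_def Setcompr_eq_image by (rule image_cong[OF refl add])
  also have "\<dots> = coboundary A n \<Lambda> ` C"
  proof (intro equalityI subsetI)
    fix c assume "c \<in> (\<lambda>f. coboundary A n \<Lambda> (\<lambda>t. l t + f t)) ` C"
    then show "c \<in> coboundary A n \<Lambda> ` C" using C_add[OF l] by blast
  next
    fix c assume "c \<in> coboundary A n \<Lambda> ` C"
    then obtain g where g: "g \<in> C" "c = coboundary A n \<Lambda> g" by blast
    then have "c = coboundary A n \<Lambda> (\<lambda>t. l t + (g t - l t))" by simp
    then show "c \<in> (\<lambda>f. coboundary A n \<Lambda> (\<lambda>t. l t + f t)) ` C"
      using C_diff[OF g(1) l] by (rule image_eqI)
  qed
  finally show ?thesis unfolding trivial_class_eq Setcompr_eq_image .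
qed

text \<open>Invariance of \<nu> is tested on tuples that begin with the fields
  \<open>slot gs i\<close>; there it is invariance of the contracted form times a nonzero power of
  the bracket.\<close>

lemma divergence_free_transverse:
  assumes \<nu>: "\<nu> \<in> volume_forms A"
    and div: "\<And>fs Ys p. length fs = n - 1 \<Longrightarrow> set fs \<subseteq> C \<Longrightarrow> length Ys = CARD('m) \<Longrightarrow> set Ys \<subseteq> V \<Longrightarrow>
      lie_derivative (ham fs) \<nu> Ys p = 0"
  shows "basic_volume A n \<Lambda> (transverse \<nu>)"
proof -
  have \<nu>f: "\<nu> \<in> forms A CARD('m)" and nz: "\<And>p. \<nu> p \<noteq> (\<lambda>_. 0)"
    using \<nu> by (auto simp: volume_forms_def nowhere_zero_def)
  note \<mu> = transverse_forms[OF \<nu>f]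
  have "transverse \<nu> p \<noteq> (\<lambda>_. 0)" for p
  proof -
    obtain us where "\<nu> p us \<noteq> 0" using nz[of p] by auto
    then obtain vs where "transverse \<nu> p vs \<noteq> 0" by (rule transverse_nonzero[OF \<nu>f]) (rule that)
    then show ?thesis by auto
  qed
  moreover have "lie_derivative (ham fs) (transverse \<nu>) Ys p = 0"
    if fs: "length fs = n - 1" "set fs \<subseteq> C" and Ys: "length Ys = CARD('m) - n" "set Ys \<subseteq> V" for fs Ys p
  proof -
    obtain gs N where gs: "length gs = n" "set gs \<subseteq> C" and N: "open N" "p \<in> N"
      and G: "\<And>q. q \<in> N \<Longrightarrow> br gs q \<noteq> 0" by (rule regular_neighbourhood[of p]) (rule that)
    have "lie_derivative (ham fs) \<nu> (map (slot gs) [0..<n] @ Ys) p =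
        br gs p ^ (n - 1) * lie_derivative (ham fs) (transverse \<nu>) Ys p"
      by (rule lie_derivative_transverse[OF fs gs G[OF N(2)] \<nu>f \<mu> N transverse_eq[OF \<nu>f gs G] Ys])
    moreover have "lie_derivative (ham fs) \<nu> (map (slot gs) [0..<n] @ Ys) p = 0"
      by (rule div[OF fs]) (use Ys n_le slot_V[OF gs] in auto)
    ultimately show ?thesis using G[OF N(2)] by simp
  qed
  moreover have "interior_product (ham fs) (transverse \<nu>) = (\<lambda>p vs. 0)"
    if "length fs = n - 1" "set fs \<subseteq> C" for fs
    unfolding interior_product_def by (intro ext transverse_kill[OF \<nu>f that])
  ultimately show ?thesis
    unfolding basic_volume_def nowhere_zero_def lie_derivative_zero_def using \<mu> by auto
qed

lemma trivial_class_imp_basic_volume: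
  assumes "modular_class A n \<Lambda> = trivial_class A n \<Lambda>"
  shows "\<exists>\<mu>. basic_volume A n \<Lambda> \<mu>"
proof -
  \<comment> \<open>The trivial class is nonempty, and membership of its zero element in the modular
    class provides a volume form, a modular tensor and the function \<open>f\<close>.\<close>
  have "coboundary A n \<Lambda> (\<lambda>_. 0) \<in> modular_class A n \<Lambda>"
    unfolding assms trivial_class_eq using C_const by blast
  then obtain \<nu> M f where \<nu>: "\<nu> \<in> volume_forms A" and M: "modular_tensor A n \<Lambda> \<nu> M" and f: "f \<in> C"
    and eq: "coboundary A n \<Lambda> (\<lambda>_. 0) =
      (\<lambda>\<alpha>\<in>forms A (n - 1). \<lambda>p. modular_cocycle A n M \<alpha> p + coboundary A n \<Lambda> f \<alpha> p)"
    unfolding modular_class_def cohomology_class_def by blast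
  have \<nu>f: "\<nu> \<in> forms A CARD('m)" and nz: "\<And>p. \<nu> p \<noteq> (\<lambda>_. 0)"
    using \<nu> by (auto simp: volume_forms_def nowhere_zero_def)
  have MV: "M \<in> multivector_fields A (n - 1)"
    and div: "\<And>fs. length fs = n - 1 \<Longrightarrow> set fs \<subseteq> C \<Longrightarrow> is_divergence A \<nu> (ham fs) (\<lambda>p. M p (map (\<lambda>f. d f p) fs))"
    using M by (auto simp: modular_tensor_def)
  \<comment> \<open>The cochain equation evaluated on a wedge product of differentials, where
    contraction is plain insertion.\<close>
  have key: "M p (map (\<lambda>f. d f p) fs) + br (fs @ [f]) p = 0" if fs: "length fs = n - 1" "set fs \<subseteq> C" for fs p
  proof -
    let ?\<alpha> = "\<lambda>p. wedge (T p) (map (\<lambda>f. d f p) fs)"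
    have \<alpha>: "?\<alpha> \<in> forms A (n - 1)" by (rule wedge_form[OF fs])
    have cob: "coboundary A n \<Lambda> g ?\<alpha> p = br (fs @ [g]) p" if "g \<in> C" for g
      using contraction_differentials[OF fs(1), of "[d g p]" p "\<Lambda> p"] tensor_alternating d_dual n3 that \<alpha>
      by (simp add: coboundary_def vfield_of_def sharp_def br_eq)
    have mc: "modular_cocycle A n M ?\<alpha> p = M p (map (\<lambda>f. d f p) fs)"
      using contraction_differentials[OF fs(1), of "[]" p "M p"] mvfield_alternating[OF MV, of p] \<alpha>
      by (simp add: modular_cocycle_def)
    have "br (fs @ [\<lambda>_. 0]) p = 0"
      using ham_apply[OF fs(1) C_const[of 0], of p] tangent_const[OF V_D(1)[OF ham_V[OF fs]], of p 0] by simp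
    then show ?thesis
      using fun_cong[OF fun_cong[OF eq, of ?\<alpha>], of p] \<alpha> by (simp add: cob C_const f mc)
  qed
  obtain X0 where X0: "\<And>p. X0 p \<in> T p" using fun_subspaceD(1)[OF T_subspace] by meson
  have eC: "(\<lambda>p. exp (f p)) \<in> C" by (rule tangent_exp(2)[OF X0 f])
  \<comment> \<open>The factor \<open>exp f\<close> adds \<open>X f\<close> to the divergence of
    \<open>X\<close>, and by \<open>key\<close> the sum is 0.\<close>
  let ?\<nu> = "\<lambda>p vs. exp (f p) * \<nu> p vs"
  have "?\<nu> \<in> volume_forms A"
    unfolding volume_forms_def nowhere_zero_def using form_scale[OF eC \<nu>f] nz by (auto simp: fun_eq_iff)
  moreover have "lie_derivative (ham fs) ?\<nu> Ys p = 0"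
    if fs: "length fs = n - 1" "set fs \<subseteq> C" and Ys: "length Ys = CARD('m)" "set Ys \<subseteq> V" for fs Ys p
  proof -
    have "ham fs p (\<lambda>p. exp (f p)) = exp (f p) * br (fs @ [f]) p"
      using tangent_exp(1)[OF V_D(1)[OF ham_V[OF fs]] f, of p] by (simp add: ham_apply[OF fs(1) f])
    moreover have "lie_derivative (ham fs) \<nu> Ys p = M p (map (\<lambda>f. d f p) fs) * \<nu> p (map (\<lambda>Y. Y p) Ys)"
      using div[OF fs] Ys by (simp add: is_divergence_def)
    ultimately have "lie_derivative (ham fs) ?\<nu> Ys p =
        exp (f p) * \<nu> p (map (\<lambda>Y. Y p) Ys) * (M p (map (\<lambda>f. d f p) fs) + br (fs @ [f]) p)"
      using lie_derivative_scale[OF ham_V[OF fs] eC \<nu>f Ys, of p] by (simp add: algebra_simps)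
    then show ?thesis by (simp add: key[OF fs])
  qed
  ultimately show ?thesis using divergence_free_transverse by blast
qed

text \<open>Locally \<open>\<nu>\<close> is a multiple of a coordinate volume; \<open>transverse \<nu> = \<mu>\<close> determines it,
  so the local solutions agree.\<close>

lemma basic_volume_imp_divergence_free:
  assumes "basic_volume A n \<Lambda> \<mu>"
  obtains \<nu> where "\<nu> \<in> volume_forms A"
    "\<And>fs Ys p. length fs = n - 1 \<Longrightarrow> set fs \<subseteq> C \<Longrightarrow> length Ys = CARD('m) \<Longrightarrow> set Ys \<subseteq> V \<Longrightarrow>
      lie_derivative (ham fs) \<nu> Ys p = 0"
proof -
  have \<mu>: "\<mu> \<in> forms A (CARD('m) - n)" and \<mu>nz: "\<And>p. \<mu> p \<noteq> (\<lambda>_. 0)"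
    and \<mu>k: "\<And>fs p vs. length fs = n - 1 \<Longrightarrow> set fs \<subseteq> C \<Longrightarrow> \<mu> p (ham fs p # vs) = 0"
    and \<mu>L: "\<And>fs Ys p. length fs = n - 1 \<Longrightarrow> set fs \<subseteq> C \<Longrightarrow> length Ys = CARD('m) - n \<Longrightarrow> set Ys \<subseteq> V \<Longrightarrow>
      lie_derivative (ham fs) \<mu> Ys p = 0"
    using assms unfolding basic_volume_def nowhere_zero_def lie_derivative_zero_def interior_product_def
    by (auto simp: fun_eq_iff)
  have near: "\<exists>\<omega> N. \<omega> \<in> forms A CARD('m) \<and> open N \<and> p \<in> N \<and> (\<forall>q\<in>N. \<forall>vs. transverse \<omega> q vs = \<mu> q vs)" for p
  proof -
    obtain x :: "nat \<Rightarrow> 'a \<Rightarrow> real" and E N0 where N0: "p \<in> N0" and x: "\<And>i. x i \<in> C"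
      and F: "\<And>q. q \<in> N0 \<Longrightarrow> dual_frames (T q) CARD('m) (\<lambda>i. E i q) (\<lambda>i. d (x i) q)"
      by (rule local_frame[of p]) (rule that)
    let ?\<omega> = "\<lambda>q. wedge (T q) (map (\<lambda>f. d f q) (map x [0..<CARD('m)]))"
    have \<omega>: "?\<omega> \<in> forms A CARD('m)" by (rule wedge_form) (use x in auto)
    have I: "[0..<CARD('m)] \<in> increasing_lists CARD('m) CARD('m)" by (auto simp: increasing_lists_def)
    have \<omega>p: "?\<omega> p (map (\<lambda>i. E i p) [0..<CARD('m)]) \<noteq> 0"
      using wedge_increasing[OF F[OF N0] I I] by (simp add: o_def)
    obtain ws where ws: "transverse ?\<omega> p ws \<noteq> 0" by (rule transverse_nonzero[OF \<omega> \<omega>p]) (rule that)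
    \<comment> \<open>Both forms are killed by all Hamiltonian fields and have the degree of the
      quotient, so they are proportional at each point.\<close>
    have ratio: "\<mu> q vs * transverse ?\<omega> q us = \<mu> q us * transverse ?\<omega> q vs"
      if "length vs = CARD('m) - n" "set vs \<subseteq> T q" "length us = CARD('m) - n" "set us \<subseteq> T q" for q vs us
      by (rule killed_proportional[OF \<mu> \<mu>k transverse_forms[OF \<omega>] transverse_kill[OF \<omega>] that])
    obtain h N where h: "h \<in> C" and N: "open N" "p \<in> N"
      and hN: "\<And>q vs. q \<in> N \<Longrightarrow> \<mu> q vs = h q * transverse ?\<omega> q vs"
      by (rule form_ratio_local[OF \<mu> transverse_forms[OF \<omega>] ws ratio]) (assumption | rule that)+
    have "transverse (\<lambda>q vs. h q * ?\<omega> q vs) q vs = \<mu> q vs" if "q \<in> N" for q vs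
      using hN[OF that, of vs] by (simp add: transverse_def Let_def)
    then show ?thesis using form_scale[OF h \<omega>] N by blast
  qed
  \<comment> \<open>\<open>R p w\<close> expresses within a single tangent space that
    \<open>w\<close> contracts to \<mu>. Quantifying over all tuples \<open>gs\<close> makes it
    independent of the choice made in \<open>transverse\<close>.\<close>
  define R where "R p w \<longleftrightarrow> w \<in> alternating_maps (T p) CARD('m) \<and>
      (\<forall>gs vs. length gs = n \<and> set gs \<subseteq> C \<and> br gs p \<noteq> 0 \<and> length vs = CARD('m) - n \<and> set vs \<subseteq> T p \<longrightarrow>
        w (slots gs p @ vs) = br gs p ^ (n - 1) * \<mu> p vs)" for p w
  have RI: "R p (\<omega> p)" if \<omega>: "\<omega> \<in> forms A CARD('m)" "\<And>vs. transverse \<omega> p vs = \<mu> p vs" for \<omega> p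
    unfolding R_def using transverse_eq[OF \<omega>(1)] \<omega>(1) by (auto simp: forms_def \<omega>(2))
  have \<mu>w: "\<exists>ws. length ws = CARD('m) - n \<and> set ws \<subseteq> T p \<and> \<mu> p ws \<noteq> 0" for p
  proof -
    obtain ws where "\<mu> p ws \<noteq> 0" using \<mu>nz[of p] by auto
    then show ?thesis using form_outside[OF \<mu>] by blast
  qed
  \<comment> \<open>A top form is determined by one nonzero value, and \<open>R\<close> prescribes
    such values because \<mu> is nonzero at \<open>p\<close>.\<close>
  have Runique: "w = w'" if R: "R p w" "R p w'" for p w w'
  proof
    fix vs
    have alt: "alternating_on (T p) CARD('m) w" "alternating_on (T p) CARD('m) w'"
      using R by (auto simp: R_def alternating_maps_iff)
    show "w vs = w' vs"
    proof (cases "length vs = CARD('m) \<and> set vs \<subseteq> T p")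
      case True
      obtain gs where gs: "length gs = n" "set gs \<subseteq> C" "br gs p \<noteq> 0" by (rule regular_functions)
      obtain ws where ws: "length ws = CARD('m) - n" "set ws \<subseteq> T p" "\<mu> p ws \<noteq> 0" using \<mu>w[of p] by blast
      obtain e \<epsilon> where F: "dual_frames (T p) CARD('m) e \<epsilon>" by (rule frame_at)
      let ?us = "slots gs p @ ws"
      have us: "length ?us = CARD('m)" "set ?us \<subseteq> T p" using ws slots_T[OF gs(1,2)] n_le by auto
      have v: "w ?us = br gs p ^ (n - 1) * \<mu> p ws" "w' ?us = br gs p ^ (n - 1) * \<mu> p ws"
        using R gs ws by (auto simp: R_def)
      have "w vs * w' ?us = w ?us * w' vs"
        by (rule top_forms_proportional[OF F alt _ _ us]) (use True in auto)
      then show ?thesis using v gs(3) ws(3) by simp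
    next
      case False
      then show ?thesis using R by (auto simp: R_def alternating_maps_iff)
    qed
  qed
  \<comment> \<open>The solution at each point is unique, so it coincides with every local solution
    nearby and inherits its smoothness; no partition of unity is involved.\<close>
  define \<nu> where "\<nu> p = (THE w. R p w)" for p
  have \<nu>eq: "\<nu> p = w" if "R p w" for p w
    unfolding \<nu>_def by (rule the_equality[where P="R p"]) (use that Runique in blast)+
  have R\<nu>: "R p (\<nu> p)" for p
  proof -
    obtain \<omega> N where "\<omega> \<in> forms A CARD('m)" "p \<in> N" "\<forall>q\<in>N. \<forall>vs. transverse \<omega> q vs = \<mu> q vs"
      using near[of p] by blast
    then have "R p (\<omega> p)" by (intro RI) auto
    then show ?thesis using \<nu>eq by simp
  qed
  have \<nu>f: "\<nu> \<in> forms A CARD('m)"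
    unfolding forms_def mem_Collect_eq
  proof (intro conjI allI impI)
    show "\<nu> p \<in> alternating_maps (T p) CARD('m)" for p using R\<nu> by (simp add: R_def)
    fix Xs assume "length Xs = CARD('m) \<and> set Xs \<subseteq> V"
    then have Xs: "length Xs = CARD('m)" "set Xs \<subseteq> V" by auto
    show "(\<lambda>p. \<nu> p (map (\<lambda>X. X p) Xs)) \<in> C"
    proof (rule C_local)
      fix p
      obtain \<omega> N where \<omega>: "\<omega> \<in> forms A CARD('m)" and N: "open N" "p \<in> N"
        and tr: "\<forall>q\<in>N. \<forall>vs. transverse \<omega> q vs = \<mu> q vs"
        using near[of p] by blast
      have "\<nu> q = \<omega> q" if "q \<in> N" for q
        by (rule \<nu>eq, rule RI[OF \<omega>]) (use tr that in blast)
      then have "smooth_in N (\<lambda>p. \<nu> p (map (\<lambda>X. X p) Xs))"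
        by (intro smooth_in_cong[OF C_smooth_in[OF form_smooth[OF \<omega> Xs]] N(1)]) simp
      then show "\<exists>N. open N \<and> p \<in> N \<and> smooth_in N (\<lambda>p. \<nu> p (map (\<lambda>X. X p) Xs))" using N by blast
    qed
  qed
  have rel: "\<nu> p (slots gs p @ vs) = br gs p ^ (n - 1) * \<mu> p vs"
    if "length gs = n" "set gs \<subseteq> C" "br gs p \<noteq> 0" "length vs = CARD('m) - n" "set vs \<subseteq> T p" for gs p vs
    using R\<nu>[of p] that by (simp add: R_def)
  have test: "\<exists>gs ws. length gs = n \<and> set gs \<subseteq> C \<and> br gs p \<noteq> 0 \<and> length ws = CARD('m) - n \<and> set ws \<subseteq> T p \<and>
      \<nu> p (slots gs p @ ws) \<noteq> 0" for p
  proof -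
    obtain gs where gs: "length gs = n" "set gs \<subseteq> C" "br gs p \<noteq> 0" by (rule regular_functions)
    obtain ws where ws: "length ws = CARD('m) - n" "set ws \<subseteq> T p" "\<mu> p ws \<noteq> 0" using \<mu>w[of p] by blast
    show ?thesis using gs ws rel[OF gs ws(1,2)] by (intro exI[of _ gs] exI[of _ ws]) simp
  qed
  show thesis
  proof (rule that)
    have "\<nu> p \<noteq> (\<lambda>_. 0)" for p using test[of p] by auto
    then show "\<nu> \<in> volume_forms A" using \<nu>f by (simp add: volume_forms_def nowhere_zero_def)
    fix fs Ys p
    assume fs: "length fs = n - 1" "set fs \<subseteq> C" and Ys: "length Ys = CARD('m)" "set Ys \<subseteq> V"
    obtain gs N where gs: "length gs = n" "set gs \<subseteq> C" and N: "open N" "p \<in> N"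
      and G: "\<And>q. q \<in> N \<Longrightarrow> br gs q \<noteq> 0" by (rule regular_neighbourhood[of p]) (rule that)
    obtain ws where ws: "length ws = CARD('m) - n" "set ws \<subseteq> T p" "\<mu> p ws \<noteq> 0" using \<mu>w[of p] by blast
    obtain Ws where Ws: "set Ws \<subseteq> V" "length Ws = length ws" "ws = map (\<lambda>W. W p) Ws"
      by (rule vectors_fields[OF ws(2)])
    have Wl: "length Ws = CARD('m) - n" using Ws ws by simp
    \<comment> \<open>The test tuple: fields along the foliation followed by fields on which \<mu>
      is nonzero at \<open>p\<close>, so that \<nu> is nonzero on it while its Lie derivative
      reduces to that of \<mu>.\<close>
    let ?Zs = "map (slot gs) [0..<n] @ Ws"
    have "lie_derivative (ham fs) \<nu> ?Zs p = br gs p ^ (n - 1) * lie_derivative (ham fs) \<mu> Ws p"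
      by (rule lie_derivative_transverse[OF fs gs G[OF N(2)] \<nu>f \<mu> N rel[OF gs G] Wl Ws(1)])
    also have "\<dots> = 0" using \<mu>L[OF fs Wl Ws(1)] by simp
    finally have L0: "lie_derivative (ham fs) \<nu> ?Zs p = 0" .
    have zs: "map (\<lambda>Z. Z p) ?Zs = slots gs p @ ws" using Ws(3) by simp
    have nz: "\<nu> p (map (\<lambda>Z. Z p) ?Zs) \<noteq> 0"
      unfolding zs rel[OF gs G[OF N(2)] ws(1,2)] using G[OF N(2)] ws(3) by simp
    have Zs: "length ?Zs = CARD('m)" "set ?Zs \<subseteq> V" using Wl Ws(1) n_le slot_V[OF gs] by auto
    show "lie_derivative (ham fs) \<nu> Ys p = 0"
      by (rule lie_derivative_top_zero[OF ham_V[OF fs] \<nu>f Zs nz L0 Ys])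
  qed
qed

lemma modular_cocycle_coboundary:
  assumes \<nu>: "\<nu> \<in> volume_forms A"
    and div: "\<And>fs Ys p. length fs = n - 1 \<Longrightarrow> set fs \<subseteq> C \<Longrightarrow> length Ys = CARD('m) \<Longrightarrow> set Ys \<subseteq> V \<Longrightarrow>
      lie_derivative (ham fs) \<nu> Ys p = 0"
    and \<nu>': "\<nu>' \<in> volume_forms A" and M: "modular_tensor A n \<Lambda> \<nu>' M"
  obtains l where "l \<in> C" "modular_cocycle A n M = coboundary A n \<Lambda> l"
proof -
  obtain h where h: "h \<in> C" "\<And>p. h p \<noteq> 0" and eq: "\<nu>' = (\<lambda>p vs. h p * \<nu> p vs)"
    by (rule volume_ratio[OF \<nu>' \<nu>]) (rule that)
  obtain l where l: "l \<in> C" "\<And>p v. v \<in> T p \<Longrightarrow> v h = h p * v l"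
    by (rule log_abs[OF h]) (rule that)
  have \<nu>f: "\<nu> \<in> forms A CARD('m)" and nz: "\<And>p. \<nu> p \<noteq> (\<lambda>_. 0)"
    using \<nu> by (auto simp: volume_forms_def nowhere_zero_def)
  have MV: "M \<in> multivector_fields A (n - 1)"
    and Mdiv: "\<And>fs. length fs = n - 1 \<Longrightarrow> set fs \<subseteq> C \<Longrightarrow> is_divergence A \<nu>' (ham fs) (\<lambda>p. M p (map (\<lambda>f. d f p) fs))"
    using M by (auto simp: modular_tensor_def)
  have Mfs: "M p (map (\<lambda>f. d f p) fs) = br (fs @ [l]) p" if fs: "length fs = n - 1" "set fs \<subseteq> C" for fs p
  proof -
    obtain us where us: "\<nu> p us \<noteq> 0" using nz[of p] by auto
    then have us': "length us = CARD('m)" "set us \<subseteq> T p" using form_outside[OF \<nu>f] by blast+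
    obtain Xs where Xs: "set Xs \<subseteq> V" "length Xs = length us" "us = map (\<lambda>X. X p) Xs"
      by (rule vectors_fields[OF us'(2)])
    have len: "length Xs = CARD('m)" using Xs us' by simp
    have "ham fs p h * \<nu> p us + h p * lie_derivative (ham fs) \<nu> Xs p =
        M p (map (\<lambda>f. d f p) fs) * (h p * \<nu> p us)"
      using Mdiv[OF fs] lie_derivative_scale[OF ham_V[OF fs] h(1) \<nu>f len Xs(1), of p] len Xs(1)
      by (simp add: is_divergence_def eq Xs(3))
    moreover have "ham fs p h = h p * br (fs @ [l]) p"
      using l(2)[OF V_D(1)[OF ham_V[OF fs]]] by (simp add: ham_apply[OF fs(1) l(1)])
    ultimately show ?thesis using div[OF fs len Xs(1), of p] us h(2)[of p] by simp
  qed
  \<comment> \<open>Every covector at \<open>p\<close> is a differential, so the identity for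
    functions determines the tensor.\<close>
  have M\<alpha>: "M p \<alpha>s = \<Lambda> p (\<alpha>s @ [d l p])" if \<alpha>s: "length \<alpha>s = n - 1" "set \<alpha>s \<subseteq> T' p" for \<alpha>s p
  proof -
    obtain fs where fs: "set fs \<subseteq> C" "length fs = length \<alpha>s" "\<alpha>s = map (\<lambda>f. d f p) fs"
      by (rule covectors_differentials[OF \<alpha>s(2)])
    then show ?thesis using Mfs[of fs p] \<alpha>s(1) by (simp add: br_eq)
  qed
  have "modular_cocycle A n M \<alpha> p = coboundary A n \<Lambda> l \<alpha> p" if \<alpha>: "\<alpha> \<in> forms A (n - 1)" for \<alpha> p
  proof -
    obtain e \<epsilon> where F: "dual_frames (T p) CARD('m) e \<epsilon>" by (rule frame_at)
    have "modular_cocycle A n M \<alpha> p = (\<Sum>I\<in>increasing_lists CARD('m) (n - 1). \<alpha> p (map e I) * M p (map \<epsilon> I))"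
      using contraction_forms[OF F \<alpha>, of "[]" "M p"] mvfield_alternating[OF MV, of p] \<alpha>
      by (simp add: modular_cocycle_def)
    also have "\<dots> = (\<Sum>I\<in>increasing_lists CARD('m) (n - 1). \<alpha> p (map e I) * \<Lambda> p (map \<epsilon> I @ [d l p]))"
      using dual_framesD(3)[OF F] by (intro sum.cong refl) (subst M\<alpha>, auto simp: increasing_lists_def)
    also have "\<dots> = coboundary A n \<Lambda> l \<alpha> p" by (rule coboundary_apply[OF F \<alpha> l(1), symmetric])
    finally show ?thesis .
  qed
  \<comment> \<open>Outside the \<open>(n - 1)\<close>-forms both cochains are
    \<open>undefined\<close>, so they agree as functions.\<close>
  then have "modular_cocycle A n M = coboundary A n \<Lambda> l"
    by (intro ext[of "modular_cocycle A n M"]) (metis (no_types, lifting) coboundary_outside ext modular_cocycle_def restrict_apply)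
  then show thesis by (rule that[OF l(1)])
qed

lemma basic_volume_imp_trivial_class:
  assumes "basic_volume A n \<Lambda> \<mu>"
  shows "modular_class A n \<Lambda> = trivial_class A n \<Lambda>"
proof -
  obtain \<nu> where \<nu>: "\<nu> \<in> volume_forms A"
    and div: "\<And>fs Ys p. length fs = n - 1 \<Longrightarrow> set fs \<subseteq> C \<Longrightarrow> length Ys = CARD('m) \<Longrightarrow> set Ys \<subseteq> V \<Longrightarrow>
      lie_derivative (ham fs) \<nu> Ys p = 0"
    by (rule basic_volume_imp_divergence_free[OF assms]) (rule that)
  \<comment> \<open>For the invariant volume form the zero field is a modular tensor; this keeps the
    union that defines the modular class from being empty.\<close>
  have "(\<lambda>p \<alpha>s. 0) \<in> multivector_fields A (n - 1)"
    unfolding multivector_fields_def by (auto simp: alternating_maps_def C_const)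
  moreover have "is_divergence A \<nu> (ham fs) (\<lambda>p. 0)" if "length fs = n - 1" "set fs \<subseteq> C" for fs
    unfolding is_divergence_def using div[OF that] by (auto simp: fun_eq_iff)
  ultimately have M0: "modular_tensor A n \<Lambda> \<nu> (\<lambda>p \<alpha>s. 0)" by (simp add: modular_tensor_def)
  have triv: "cohomology_class A n \<Lambda> (modular_cocycle A n M) = trivial_class A n \<Lambda>"
    if \<nu>': "\<nu>' \<in> volume_forms A" and M: "modular_tensor A n \<Lambda> \<nu>' M" for \<nu>' M
  proof -
    obtain l where l: "l \<in> C" "modular_cocycle A n M = coboundary A n \<Lambda> l"
      by (rule modular_cocycle_coboundary[OF \<nu> div \<nu>' M])
    show ?thesis unfolding l(2) by (rule coboundary_class[OF l(1)])
  qed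
  show ?thesis unfolding modular_class_def using triv M0 \<nu> by blast
qed

end

theorem theorem6p3:
  fixes A :: "('a::{t2_space, second_countable_topology}, 'm::finite) chart set"
    and \<Lambda> :: "'a mvfield" and n :: nat
  assumes "connected (UNIV :: 'a set)"
    and "oriented_atlas A"
    and "n \<ge> 3"
    and "nambu_poisson A n \<Lambda>"
    and "nowhere_zero \<Lambda>"
  shows "modular_class A n \<Lambda> = trivial_class A n \<Lambda> \<longleftrightarrow> (\<exists>\<mu>. basic_volume A n \<Lambda> \<mu>)"
proof -
  interpret nambu_manifold A n \<Lambda>
    by unfold_locales (use assms in \<open>auto simp: oriented_atlas_def\<close>)
  show ?thesis
    using trivial_class_imp_basic_volume basic_volume_imp_trivial_class by blast
qed

end
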